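(* ETC can be solved in time $(10T)^k\cdot T^3|V|^5$ on inputs $(\mathcal G,k,\Delta_1,\Delta_2)$, where $V$ is the vertex set and $T$ the lifetime of the input temporal graph $\mathcal G$.
   Context: A temporal graph $\mathcal G=(G,\mathcal T)$ consists of a finite static undirected graph $G=(V,E)$ and a function $\mathcal T:E\to 2^{\mathbb Z^+}\setminus\{\emptyset\}$ (finite sets) giving the times at which each edge appears; its time-edges are $\mathcal E(\mathcal G)=\{(e,t):e\in E,\ t\in\mathcal T(e)\}$ and its lifetime is $T(\mathcal G)=\max\{t:(e,t)\in\mathcal E(\mathcal G)\}$ (the earliest time is assumed to be $1$). An interval $[a,b]$ means the integer set $\{a,\dots,b\}$. An edge $e$ is $\Delta_1$-dense in $[a,b]$ if for every $\tau\in[a,\max\{a,b-\Delta_1+1\}]$ there is $t\in\mathcal T(e)$ with $\tau\le t\le \tau+\Delta_1-1$. A template is a pair $(X,[a,b])$ with $X$ a vertex set. Templates $(X,[a,b])$, $(Y,[c,d])$ are $\Delta_2$-independent if $X\cap Y=\emptyset$ or $|s-t|\ge\Delta_2$ for all $s\in[a,b]$, $t\in[c,d]$. $\mathcal G$ realises a collection $\{(X_i,[a_i,b_i])\}_i$ of pairwise $\Delta_2$-independent templates with $1\le a_i\le b_i\le T(\mathcal G)$ if every time-edge $(xy,t)$ has some $i$ with $x,y\in X_i$, $t\in[a_i,b_i]$, and for every $i$ and distinct $x,y\in X_i$, $xy$ is an edge that is $\Delta_1$-dense in $[a_i,b_i]$. $\mathcal G$ is a $(\Delta_1,\Delta_2)$-cluster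 temporal graph if it realises some such collection. Throughout, $\Delta_2>\Delta_1\ge1$. ETC (Editing to Temporal Cliques): Input: a temporal graph $\mathcal G$ and positive integers $k,\Delta_1,\Delta_2$. Question: is there a set $\Pi$ of at most $k$ time-edge modifications (additions or deletions of time-edges) such that the modified temporal graph is a $(\Delta_1,\Delta_2)$-cluster temporal graph? *)

theory Defs
  imports Main
begin

section \<open>Temporal graphs\<close>

text \<open>Edges are two-element vertex sets. Only the values of \<open>times\<close> on \<open>edges\<close> are meaningful.\<close>

record 'v temporal_graph =
  verts :: "'v set"
  edges :: "'v set set"
  times :: "'v set \<Rightarrow> nat set"

definition vertex_pairs :: "'v set \<Rightarrow> 'v set set" where
  "vertex_pairs V = {e. e \<subseteq> V \<and> card e = 2}"

definition wf_temporal_graph :: "'v temporal_graph \<Rightarrow> bool" where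
  "wf_temporal_graph G \<longleftrightarrow>
     finite (verts G) \<and> edges G \<subseteq> vertex_pairs (verts G) \<and>
     (\<forall>e\<in>edges G. finite (times G e) \<and> times G e \<noteq> {} \<and> (\<forall>t\<in>times G e. 1 \<le> t))"

definition time_edges :: "'v temporal_graph \<Rightarrow> ('v set \<times> nat) set" where
  "time_edges G = {(e, t). e \<in> edges G \<and> t \<in> times G e}"

definition lifetime :: "'v temporal_graph \<Rightarrow> nat" where
  "lifetime G = Max (snd ` time_edges G)"

definition earliest_time :: "'v temporal_graph \<Rightarrow> nat" where
  "earliest_time G = Min (snd ` time_edges G)"

section \<open>Cluster temporal graphs\<close>

text \<open>Truncated subtraction is harmless in \<open>b + 1 - \<Delta>1\<close> because of the maximum with \<open>a\<close>.\<close>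

definition dense_in :: "nat \<Rightarrow> 'v temporal_graph \<Rightarrow> 'v set \<Rightarrow> nat \<Rightarrow> nat \<Rightarrow> bool" where
  "dense_in \<Delta>1 G e a b \<longleftrightarrow>
     (\<forall>\<tau>\<in>{a..max a (b + 1 - \<Delta>1)}. \<exists>t\<in>times G e. \<tau> \<le> t \<and> t \<le> \<tau> + \<Delta>1 - 1)"

text \<open>The triple \<open>(X, a, b)\<close> is the template on vertex set \<open>X\<close> and interval \<open>[a, b]\<close>.\<close>

type_synonym 'v template = "'v set \<times> nat \<times> nat"

fun independent :: "nat \<Rightarrow> 'v template \<Rightarrow> 'v template \<Rightarrow> bool" where
  "independent \<Delta>2 (X, a, b) (Y, c, d) \<longleftrightarrow>
     X \<inter> Y = {} \<or> (\<forall>s\<in>{a..b}. \<forall>t\<in>{c..d}. int \<Delta>2 \<le> \<bar>int s - int t\<bar>)"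

text \<open>
  A graph without time-edges realises the empty collection, so the unspecified value of its
  \<open>lifetime\<close> is irrelevant for being a cluster temporal graph. A set of templates suffices in
  place of an indexed family: two equal templates with nonempty vertex set and \<open>a \<le> b\<close> are
  never independent, and templates with empty vertex set impose and cover nothing.
\<close>

definition realises :: "nat \<Rightarrow> nat \<Rightarrow> 'v temporal_graph \<Rightarrow> 'v template set \<Rightarrow> bool" where
  "realises \<Delta>1 \<Delta>2 G C \<longleftrightarrow>
     (\<forall>(X, a, b)\<in>C. X \<subseteq> verts G \<and> 1 \<le> a \<and> a \<le> b \<and> b \<le> lifetime G) \<and>
     (\<forall>p\<in>C. \<forall>q\<in>C. p \<noteq> q \<longrightarrow> independent \<Delta>2 p q) \<and>
     (\<forall>(e, t)\<in>time_edges G. \<exists>(X, a, b)\<in>C. e \<subseteq> X \<and> t \<in> {a..b}) \<and>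
     (\<forall>(X, a, b)\<in>C. \<forall>x\<in>X. \<forall>y\<in>X. x \<noteq> y \<longrightarrow>
        {x, y} \<in> edges G \<and> dense_in \<Delta>1 G {x, y} a b)"

definition cluster_temporal_graph :: "nat \<Rightarrow> nat \<Rightarrow> 'v temporal_graph \<Rightarrow> bool" where
  "cluster_temporal_graph \<Delta>1 \<Delta>2 G \<longleftrightarrow> (\<exists>C. realises \<Delta>1 \<Delta>2 G C)"

section \<open>Editing to temporal cliques\<close>

text \<open>
  A modification is identified with the time-edge it concerns: it deletes that time-edge if it is
  present and adds it otherwise. The static edges of the modified graph are the pairs that still
  (or newly) have at least one time.
\<close>

definition modify :: "'v temporal_graph \<Rightarrow> ('v set \<times> nat) set \<Rightarrow> 'v temporal_graph" where
  "modify G \<Pi> = (let S = (time_edges G - \<Pi>) \<union> (\<Pi> - time_edges G) in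
     \<lparr>verts = verts G, edges = fst ` S, times = (\<lambda>e. {t. (e, t) \<in> S})\<rparr>)"

definition ETC :: "'v temporal_graph \<Rightarrow> nat \<Rightarrow> nat \<Rightarrow> nat \<Rightarrow> bool" where
  "ETC G k \<Delta>1 \<Delta>2 \<longleftrightarrow>
     (\<exists>\<Pi>. \<Pi> \<subseteq> vertex_pairs (verts G) \<times> {1..} \<and> finite \<Pi> \<and> card \<Pi> \<le> k \<and>
          cluster_temporal_graph \<Delta>1 \<Delta>2 (modify G \<Pi>))"

definition ETC_instance :: "'v temporal_graph \<Rightarrow> nat \<Rightarrow> nat \<Rightarrow> nat \<Rightarrow> bool" where
  "ETC_instance G k \<Delta>1 \<Delta>2 \<longleftrightarrow>
     wf_temporal_graph G \<and> time_edges G \<noteq> {} \<and> earliest_time G = 1 \<and>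
     1 \<le> k \<and> 1 \<le> \<Delta>1 \<and> \<Delta>1 < \<Delta>2"

section \<open>Random access machines\<close>

text \<open>
  A unit-cost random access machine in the style of Cook and Reckhow, with structured control
  flow instead of jumps. A state consists of registers and an unbounded memory, both holding
  natural numbers. The only arithmetic is addition and truncated subtraction; multiplication is
  omitted because on unbounded numbers it would not be realistic at unit cost. A program is a
  finite term and so mentions finitely many registers; memory is addressed indirectly through
  them. Every executed operation and every evaluated test costs one step.
\<close>

type_synonym ram_state = "(nat \<Rightarrow> nat) \<times> (nat \<Rightarrow> nat)"

datatype ram =
    Skip
  | Const nat nat
  | Add nat nat nat
  | Sub nat nat nat
  | Load nat nat
  | Store nat nat
  | Seq ram ram
  | IfLess nat nat ram ram
  | WhileLess nat nat ram

inductive exec :: "ram \<Rightarrow> ram_state \<Rightarrow> nat \<Rightarrow> ram_state \<Rightarrow> bool" where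
  Skip: "exec Skip s 1 s"
| Const: "exec (Const r c) (R, M) 1 (R(r := c), M)"
| Add: "exec (Add r i j) (R, M) 1 (R(r := R i + R j), M)"
| Sub: "exec (Sub r i j) (R, M) 1 (R(r := R i - R j), M)"
| Load: "exec (Load r i) (R, M) 1 (R(r := M (R i)), M)"
| Store: "exec (Store i j) (R, M) 1 (R, M(R i := R j))"
| Seq: "exec p s m s' \<Longrightarrow> exec q s' n s'' \<Longrightarrow> exec (Seq p q) s (m + n) s''"
| IfTrue: "fst s i < fst s j \<Longrightarrow> exec p s n s' \<Longrightarrow> exec (IfLess i j p q) s (Suc n) s'"
| IfFalse: "\<not> fst s i < fst s j \<Longrightarrow> exec q s n s' \<Longrightarrow> exec (IfLess i j p q) s (Suc n) s'"
| WhileFalse: "\<not> fst s i < fst s j \<Longrightarrow> exec (WhileLess i j p) s 1 s"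
| WhileTrue: "fst s i < fst s j \<Longrightarrow> exec p s m s' \<Longrightarrow> exec (WhileLess i j p) s' n s'' \<Longrightarrow>
    exec (WhileLess i j p) s (Suc (m + n)) s''"

lemma exec_deterministic:
  "exec p s m s1 \<Longrightarrow> exec p s n s2 \<Longrightarrow> m = n \<and> s1 = s2"
proof (induction arbitrary: n s2 rule: exec.induct)
  case (Seq p s m s' q k s'')
  from Seq.prems show ?case by (cases rule: exec.cases) (use Seq.IH in blast)+
next
  case (IfTrue s i j p k s' q)
  from IfTrue.prems show ?case
    by (cases rule: exec.cases) (use IfTrue.IH IfTrue.hyps in blast)+
next
  case (IfFalse s i j q k s' p)
  from IfFalse.prems show ?case
    by (cases rule: exec.cases) (use IfFalse.IH IfFalse.hyps in blast)+
next
  case (WhileFalse s i j p)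
  from WhileFalse.prems show ?case
    by (cases rule: exec.cases) (use WhileFalse.hyps in blast)+
next
  case (WhileTrue s i j p m s' k s'')
  from WhileTrue.prems show ?case
    by (cases rule: exec.cases) (use WhileTrue.IH WhileTrue.hyps in blast)+
qed (auto elim: exec.cases)

text \<open>The input word occupies an initial segment of the memory; everything else is zero.\<close>

definition initial_state :: "nat list \<Rightarrow> ram_state" where
  "initial_state w = ((\<lambda>_. 0), (\<lambda>i. if i < length w then w ! i else 0))"

text \<open>The answer, 1 for yes and 0 for no, is left in register 0.\<close>

definition decides_within :: "ram \<Rightarrow> nat list \<Rightarrow> bool \<Rightarrow> nat \<Rightarrow> bool" where
  "decides_within p w answer bound \<longleftrightarrow>
     (\<exists>n R M. exec p (initial_state w) n (R, M) \<and> n \<le> bound \<and> R 0 = (if answer then 1 else 0))"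

text \<open>
  Encoding of an instance: the vertices are numbered by their positions in some list \<open>vs\<close>, and
  the time-edges are listed, each exactly once and in any order, as triples \<open>(i, j, t)\<close> with
  \<open>i < j\<close>. The numbering and the order are arbitrary, so an instance has several encodings.
\<close>

definition encodes ::
  "nat list \<Rightarrow> 'v temporal_graph \<Rightarrow> nat \<Rightarrow> nat \<Rightarrow> nat \<Rightarrow> bool" where
  "encodes w G k \<Delta>1 \<Delta>2 \<longleftrightarrow>
     (\<exists>vs ts. distinct vs \<and> set vs = verts G \<and> distinct ts \<and>
        (\<forall>(i, j, t)\<in>set ts. i < j \<and> j < length vs) \<and>
        (\<lambda>(i, j, t). ({vs ! i, vs ! j}, t)) ` set ts = time_edges G \<and>
        w = [length vs, length ts, k, \<Delta>1, \<Delta>2] @ concat (map (\<lambda>(i, j, t). [i, j, t]) ts))"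

end

theory Submission
  imports Defs
begin

text \<open>
  A template meets the times of each of its edges in a single maximal run with gaps at most \<open>\<Delta>1\<close>,
  and two runs less than \<open>\<Delta>2\<close> apart on edges that share a vertex lie in the same template. So the
  templates are determined by the time-edges, and being a cluster temporal graph becomes a local
  condition: no walk \<open>q p v r s\<close> carries a violation. A violation depends only on the times of the
  five pairs \<open>qp\<close>, \<open>pv\<close>, \<open>vr\<close>, \<open>rs\<close>, \<open>pr\<close>, hence every solution modifies one of these pairs, and
  solutions need no times beyond the lifetime \<open>T\<close>: there are \<open>5 T\<close> branches.

  Since \<open>(k + 1) (5 T)\<^sup>k \<le> (10 T)\<^sup>k\<close>, the machine can afford to run through all \<open>(5 T)\<^sup>k\<close>
  branching sequences with a counter and to replay each of them from the input, so no recursion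
  stack is needed. A replay makes \<open>k + 1\<close> searches for a violation, which loop over five vertices
  and two times with a scan of one row of the time table inside.
\<close>

section \<open>Runs of times\<close>

text \<open>The bound dictates the shape of \<open>violation\<close>. The replays lose a factor
  \<open>k + 1\<close>, and \<open>k + 1 <= 2 ^ k\<close> leaves room for five pairs per branching
  step, while one search may take only \<open>T^3 * n^5\<close> steps. So a certificate has to live
  on five vertices, be named by two times, and read only five of the ten pairs. The hard direction
  is to build templates when no violation exists. Call two time-edges adjacent if they share a
  vertex and their runs are less than \<open>d2\<close> apart. Adjacency is not transitive, since
  disjoint edges of one clique are never adjacent. Walks with repeated vertices show, however, that
  chains of two adjacencies are aligned and that triangles close, and then every chain of three
  shrinks to a chain of two. So chains of two form an equivalence relation, and each class spans a
  clique over the hull of its runs. The general walk serves only to keep different classes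
  apart.\<close>

definition run_last :: "nat \<Rightarrow> nat set \<Rightarrow> nat \<Rightarrow> nat" where
  "run_last d A t = (LEAST l. l \<in> A \<and> t \<le> l \<and> (\<forall>u\<in>A. u \<le> l \<or> l + d < u))"

text \<open>The two functions are the ends of the maximal run through \<open>t\<close>: going up
  (down) from \<open>t\<close>, the first time of \<open>A\<close> with no further time of
  \<open>A\<close> within distance \<open>d\<close>.\<close>

definition run_first :: "nat \<Rightarrow> nat set \<Rightarrow> nat \<Rightarrow> nat" where
  "run_first d A t = (GREATEST f. f \<in> A \<and> f \<le> t \<and> (\<forall>u\<in>A. f \<le> u \<or> u + d < f))"

lemma run_last:
  assumes "finite A" "t \<in> A"
  shows run_last_mem: "run_last d A t \<in> A" and run_last_ge: "t \<le> run_last d A t"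
    and run_last_maximal: "\<And>u. u \<in> A \<Longrightarrow> u \<le> run_last d A t \<or> run_last d A t + d < u"
proof -
  have "Max A \<in> A \<and> t \<le> Max A \<and> (\<forall>u\<in>A. u \<le> Max A \<or> Max A + d < u)"
    using assms by (auto intro: Max_in)
  from LeastI[of "\<lambda>l. l \<in> A \<and> t \<le> l \<and> (\<forall>u\<in>A. u \<le> l \<or> l + d < u)", OF this]
  show "run_last d A t \<in> A" "t \<le> run_last d A t"
    "\<And>u. u \<in> A \<Longrightarrow> u \<le> run_last d A t \<or> run_last d A t + d < u"
    unfolding run_last_def[symmetric] by auto
qed

lemma run_first:
  assumes "finite A" "t \<in> A"
  shows run_first_mem: "run_first d A t \<in> A" and run_first_le: "run_first d A t \<le> t"
    and run_first_minimal: "\<And>u. u \<in> A \<Longrightarrow> run_first d A t \<le> u \<or> u + d < run_first d A t"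
proof -
  have "Min A \<in> A \<and> Min A \<le> t \<and> (\<forall>u\<in>A. Min A \<le> u \<or> u + d < Min A)"
    using assms by (auto intro: Min_in)
  from GreatestI_nat[of "\<lambda>f. f \<in> A \<and> f \<le> t \<and> (\<forall>u\<in>A. f \<le> u \<or> u + d < f)" _ t, OF this]
  show "run_first d A t \<in> A" "run_first d A t \<le> t"
    "\<And>u. u \<in> A \<Longrightarrow> run_first d A t \<le> u \<or> u + d < run_first d A t"
    unfolding run_first_def[symmetric] by auto
qed

lemma greatest_at_most:
  fixes t b :: nat
  assumes "t \<in> A" "t \<le> b"
  obtains w where "w \<in> A" "w \<le> b" "t \<le> w" "\<And>u. u \<in> A \<Longrightarrow> u \<le> b \<Longrightarrow> u \<le> w"
proof
  let ?B = "A \<inter> {..b}"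
  have "finite ?B" and ne: "?B \<noteq> {}" using assms by auto
  then show "Max ?B \<in> A" "Max ?B \<le> b" "t \<le> Max ?B"
    "\<And>u. u \<in> A \<Longrightarrow> u \<le> b \<Longrightarrow> u \<le> Max ?B"
    using Max_in[of ?B] assms by auto
qed

lemma least_at_least:
  fixes t a :: nat
  assumes "t \<in> A" "a \<le> t"
  obtains w where "w \<in> A" "a \<le> w" "w \<le> t" "\<And>u. u \<in> A \<Longrightarrow> a \<le> u \<Longrightarrow> w \<le> u"
proof
  let ?P = "\<lambda>w. w \<in> A \<and> a \<le> w"
  have "?P t" using assms by simp
  from LeastI[of ?P, OF this] Least_le[of ?P, OF this]
  show "Least ?P \<in> A" "a \<le> Least ?P" "Least ?P \<le> t" by simp_all
  show "Least ?P \<le> u" if "u \<in> A" "a \<le> u" for u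
    using that by (intro Least_le) simp
qed

text \<open>A gap above \<open>x\<close> would end the run. For \<open>t <= x\<close> it makes
  \<open>x\<close> a candidate for \<open>run_last\<close>; for \<open>x < t\<close> it makes the
  next time after \<open>x\<close> a candidate for \<open>run_first\<close>.\<close>

lemma run_gap:
  assumes "finite A" "t \<in> A" "x \<in> A" "run_first d A t \<le> x" "x < run_last d A t"
  shows "\<exists>u\<in>A. x < u \<and> u \<le> x + d"
proof (rule ccontr)
  assume neg: "\<not> ?thesis"
  show False
  proof (cases "t \<le> x")
    case True
    have "x \<in> A \<and> t \<le> x \<and> (\<forall>u\<in>A. u \<le> x \<or> x + d < u)"
      using neg assms(3) True by (meson not_le)
    then have "run_last d A t \<le> x"
      unfolding run_last_def by (rule Least_le)
    then show False using assms(5) by simp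
  next
    case False
    obtain y where y: "y \<in> A" "Suc x \<le> y" "y \<le> t"
      and y_least: "\<And>u. u \<in> A \<Longrightarrow> Suc x \<le> u \<Longrightarrow> y \<le> u"
      using least_at_least[OF assms(2), of "Suc x"] False by auto
    have "\<not> y \<le> x + d" using neg y by auto
    have "y \<le> u \<or> u + d < y" if "u \<in> A" for u
      using y_least[OF that] \<open>\<not> y \<le> x + d\<close> by linarith
    with y have P: "y \<in> A \<and> y \<le> t \<and> (\<forall>u\<in>A. y \<le> u \<or> u + d < y)" by blast
    have "y \<le> run_first d A t"
      unfolding run_first_def by (rule Greatest_le_nat
          [of "\<lambda>f. f \<in> A \<and> f \<le> t \<and> (\<forall>u\<in>A. f \<le> u \<or> u + d < f)" y t, OF P]) simp
    then show False using y assms(4) by simp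
  qed
qed

text \<open>The last time \<open>x\<close> before \<open>\<tau>\<close> lies in the run, so it has a
  successor within \<open>d\<close>; by the choice of \<open>x\<close> this successor is not before
  \<open>\<tau>\<close>.\<close>

lemma run_window:
  assumes A: "finite A" "t \<in> A"
    and \<tau>: "run_first d A t < \<tau>" "\<tau> \<le> run_last d A t"
  shows "\<exists>u\<in>A. \<tau> \<le> u \<and> u < \<tau> + d"
proof -
  have "run_first d A t \<le> \<tau> - 1" using \<tau> by simp
  then obtain x where x: "x \<in> A" "x \<le> \<tau> - 1" "run_first d A t \<le> x"
    and x_greatest: "\<And>u. u \<in> A \<Longrightarrow> u \<le> \<tau> - 1 \<Longrightarrow> u \<le> x"
    using greatest_at_most[OF run_first_mem[OF A]] by blast
  have "x < run_last d A t" using x \<tau> by linarith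
  then obtain u where u: "u \<in> A" "x < u" "u \<le> x + d"
    using run_gap[OF A x(1,3)] by blast
  have "\<tau> \<le> u" using x_greatest[OF u(1)] u(2) by linarith
  moreover have "u < \<tau> + d" using u x \<tau> by linarith
  ultimately show ?thesis using u by blast
qed

section \<open>Intervals at small distance\<close>

text \<open>For nonempty intervals and \<open>d > 0\<close>: some point of \<open>[f, l]\<close> and
  some point of \<open>[f', l']\<close> are less than \<open>d\<close> apart. Sums avoid truncated
  subtraction; \<open>near d u u f l\<close> compares a single time with an interval.\<close>

definition near :: "nat \<Rightarrow> nat \<Rightarrow> nat \<Rightarrow> nat \<Rightarrow> nat \<Rightarrow> bool" where
  "near d f l f' l' \<longleftrightarrow> f < l' + d \<and> f' < l + d"

text \<open>With \<open>d1\<close> for \<open>d\<close>, this holds for any two runs in one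
  template: each starts less than \<open>d1\<close> after the template starts and ends less than
  \<open>d1\<close> before it ends.\<close>

definition aligned :: "nat \<Rightarrow> nat \<Rightarrow> nat \<Rightarrow> nat \<Rightarrow> nat \<Rightarrow> bool" where
  "aligned d f l f' l' \<longleftrightarrow> f < f' + d \<and> f' < f + d \<and> l < l' + d \<and> l' < l + d"

lemma near_sym: "near d f l f' l' \<longleftrightarrow> near d f' l' f l"
  by (auto simp: near_def)

lemma near_if_aligned:
  "aligned d f l f' l' \<Longrightarrow> f \<le> l \<Longrightarrow> f' \<le> l' \<Longrightarrow> d \<le> d' \<Longrightarrow> near d' f l f' l'"
  by (auto simp: near_def aligned_def)

lemma near_run_point:
  assumes A: "finite A" "t \<in> A" and "d < d'" "f \<le> l"
    and n: "near d' (run_first d A t) (run_last d A t) f l"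
  shows "\<exists>u\<in>A. near d' u u f l"
proof (cases "f < run_first d A t + d'")
  case True
  then show ?thesis
    using n run_first_mem[OF A, of d] by (auto simp: near_def)
next
  case False
  \<comment> \<open>The window opens at the first time less than \<open>d'\<close> below
    \<open>f\<close>; since \<open>d < d'\<close>, all its points are below
    \<open>f\<close>.\<close>
  have "\<exists>u\<in>A. f + 1 - d' \<le> u \<and> u < f + 1 - d' + d"
    using False n by (intro run_window[OF A]) (auto simp: near_def)
  then obtain u where "u \<in> A" "f + 1 - d' \<le> u" "u < f + 1 - d' + d" by blast
  then show ?thesis
    using False assms(3,4) by (intro bexI[of _ u]) (auto simp: near_def)
qed

section \<open>Violations\<close>

definition edge_times :: "('v set \<times> nat) set \<Rightarrow> 'v set \<Rightarrow> nat set" where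
  "edge_times S e = {t. (e, t) \<in> S}"

definition linked ::
  "nat set \<Rightarrow> nat set \<Rightarrow> bool \<Rightarrow> nat \<Rightarrow> nat \<Rightarrow> nat \<Rightarrow> nat \<Rightarrow> nat \<Rightarrow> bool" where
  "linked A B touch d f l f' l' \<longleftrightarrow>
     (\<exists>t\<in>A. near d t t f l) \<and> (\<exists>t\<in>B. near d t t f' l') \<and>
     (near d f l f' l' \<or> touch \<and> (\<exists>t\<in>A. near d t t f l \<and> near d t t f' l'))"

text \<open>
  A violation lives on a walk \<open>q p v r s\<close>. The runs of \<open>qp\<close> and \<open>rs\<close> are forced into one template
  by \<open>linked\<close>: either they are close in time and both templates contain \<open>v\<close>, or the edge \<open>pv\<close>,
  which must then also meet \<open>rs\<close>, is close to both of them. One template requires that both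
  endpoints of the runs nearly agree and that \<open>pr\<close> is present.
\<close>

definition violation ::
  "nat \<Rightarrow> nat \<Rightarrow> ('v set \<times> nat) set \<Rightarrow> 'v \<Rightarrow> 'v \<Rightarrow> 'v \<Rightarrow> 'v \<Rightarrow> 'v \<Rightarrow> nat \<Rightarrow> nat \<Rightarrow> bool" where
  "violation d1 d2 S q p v r s t t' \<longleftrightarrow>
     t \<in> edge_times S {q, p} \<and> t' \<in> edge_times S {r, s} \<and>
     (let f = run_first d1 (edge_times S {q, p}) t; l = run_last d1 (edge_times S {q, p}) t;
          f' = run_first d1 (edge_times S {r, s}) t'; l' = run_last d1 (edge_times S {r, s}) t'
      in linked (edge_times S {p, v}) (edge_times S {v, r}) (r = p \<or> s = v) d2 f l f' l' \<and>
         \<not> (aligned d1 f l f' l' \<and>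
            (r = p \<or> (\<exists>u\<in>edge_times S {p, r}. near d2 u u f l \<and> near d2 u u f' l'))))"

definition violated :: "nat \<Rightarrow> nat \<Rightarrow> ('v set \<times> nat) set \<Rightarrow> 'v \<Rightarrow> 'v \<Rightarrow> 'v \<Rightarrow> 'v \<Rightarrow> 'v \<Rightarrow> bool" where
  "violated d1 d2 S q p v r s \<longleftrightarrow> (\<exists>t t'. violation d1 d2 S q p v r s t t')"

text \<open>This is the shape of the result of \<open>modify\<close>, so everything below can work
  with plain sets of time-edges.\<close>

definition graph_of :: "'v set \<Rightarrow> ('v set \<times> nat) set \<Rightarrow> 'v temporal_graph" where
  "graph_of V S = \<lparr>verts = V, edges = fst ` S, times = (\<lambda>e. {t. (e, t) \<in> S})\<rparr>"

lemma time_edges_graph_of [simp]: "time_edges (graph_of V S) = S"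
  by (force simp: time_edges_def graph_of_def)

lemma graph_of_simps [simp]:
  "verts (graph_of V S) = V" "edges (graph_of V S) = fst ` S"
  "times (graph_of V S) e = edge_times S e"
  by (auto simp: graph_of_def edge_times_def)

lemma modify_eq_graph_of:
  "modify G \<Pi> = graph_of (verts G) (time_edges G - \<Pi> \<union> (\<Pi> - time_edges G))"
  by (simp add: modify_def graph_of_def Let_def)

lemma realisesD:
  assumes "realises d1 d2 G C"
  shows realises_covers:
      "\<And>e t. (e, t) \<in> time_edges G \<Longrightarrow> \<exists>X a b. (X, a, b) \<in> C \<and> e \<subseteq> X \<and> a \<le> t \<and> t \<le> b"
    and realises_independent:
      "\<And>p q. p \<in> C \<Longrightarrow> q \<in> C \<Longrightarrow> p \<noteq> q \<Longrightarrow> independent d2 p q"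
    and realises_dense: "\<And>X a b x y. (X, a, b) \<in> C \<Longrightarrow> x \<in> X \<Longrightarrow> y \<in> X \<Longrightarrow> x \<noteq> y \<Longrightarrow>
      dense_in d1 G {x, y} a b"
    and realises_interval: "\<And>X a b. (X, a, b) \<in> C \<Longrightarrow> X \<subseteq> verts G \<and> 1 \<le> a \<and> a \<le> b"
proof -
  have "\<forall>(e, t)\<in>time_edges G. \<exists>(X, a, b)\<in>C. e \<subseteq> X \<and> t \<in> {a..b}"
    and ind: "\<forall>p\<in>C. \<forall>q\<in>C. p \<noteq> q \<longrightarrow> independent d2 p q"
    and clique: "\<forall>(X, a, b)\<in>C. \<forall>x\<in>X. \<forall>y\<in>X. x \<noteq> y \<longrightarrow> {x, y} \<in> edges G \<and> dense_in d1 G {x, y} a b"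
    and int: "\<forall>(X, a, b)\<in>C. X \<subseteq> verts G \<and> 1 \<le> a \<and> a \<le> b \<and> b \<le> lifetime G"
    using assms unfolding realises_def by simp_all
  then show "\<exists>X a b. (X, a, b) \<in> C \<and> e \<subseteq> X \<and> a \<le> t \<and> t \<le> b" if "(e, t) \<in> time_edges G" for e t
    using that by (fastforce dest!: bspec)
  show "independent d2 p q" if "p \<in> C" "q \<in> C" "p \<noteq> q" for p q
    using ind that by blast
  show "dense_in d1 G {x, y} a b" if "(X, a, b) \<in> C" "x \<in> X" "y \<in> X" "x \<noteq> y" for X a b x y
    using bspec[OF clique that(1)] that by auto
  show "X \<subseteq> verts G \<and> 1 \<le> a \<and> a \<le> b" if "(X, a, b) \<in> C" for X a b
    using bspec[OF int that] by auto
qed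

lemma lifetime_ge: "finite (time_edges G) \<Longrightarrow> (e, t) \<in> time_edges G \<Longrightarrow> t \<le> lifetime G"
  unfolding lifetime_def by (metis Max_ge finite_imageI imageI snd_conv)

lemma independent_shrink:
  assumes "independent d (X, a, b) (Y, c, e)" "b' \<le> b" "e' \<le> e"
  shows "independent d (X, a, b') (Y, c, e')"
proof (cases "X \<inter> Y = {}")
  case False
  then have "\<forall>s\<in>{a..b}. \<forall>t\<in>{c..e}. int d \<le> \<bar>int s - int t\<bar>" using assms(1) by simp
  then have "\<forall>s\<in>{a..b'}. \<forall>t\<in>{c..e'}. int d \<le> \<bar>int s - int t\<bar>"
    using assms(2,3) by (meson atLeastAtMost_iff order_trans)
  then show ?thesis by simp
qed simp

text \<open>A smaller right end only removes windows. The window at \<open>a\<close> always stays,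
  even if it reaches beyond \<open>b'\<close>.\<close>

lemma dense_in_shrink: "dense_in d G e a b \<Longrightarrow> b' \<le> b \<Longrightarrow> dense_in d G e a b'"
proof -
  assume "dense_in d G e a b" "b' \<le> b"
  moreover have "max a (b' + 1 - d) \<le> max a (b + 1 - d)" using \<open>b' \<le> b\<close> by linarith
  ultimately show ?thesis by (meson atLeastAtMost_iff dense_in_def order_trans)
qed

text \<open>Two conditions of \<open>realises\<close> come for free: templates can be cut at the
  lifetime, after which nothing has to be covered, and the first window of a dense pair supplies a
  time, hence the edge.\<close>

lemma cluster_if_cover:
  assumes fin: "finite S"
    and interval: "\<And>X a b. (X, a, b) \<in> C \<Longrightarrow> X \<subseteq> V \<and> 1 \<le> a \<and> a \<le> b"
    and indep: "\<And>p q. p \<in> C \<Longrightarrow> q \<in> C \<Longrightarrow> p \<noteq> q \<Longrightarrow> independent d2 p q"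
    and cover: "\<And>e t. (e, t) \<in> S \<Longrightarrow> \<exists>X a b. (X, a, b) \<in> C \<and> e \<subseteq> X \<and> a \<le> t \<and> t \<le> b"
    and dense: "\<And>X a b x y. (X, a, b) \<in> C \<Longrightarrow> x \<in> X \<Longrightarrow> y \<in> X \<Longrightarrow> x \<noteq> y \<Longrightarrow>
      dense_in d1 (graph_of V S) {x, y} a b"
  shows "cluster_temporal_graph d1 d2 (graph_of V S)"
proof -
  let ?l = "lifetime (graph_of V S)"
  define C' where "C' = {(X, a, b'). \<exists>b. (X, a, b) \<in> C \<and> a \<le> ?l \<and> b' = min b ?l}"
  have "realises d1 d2 (graph_of V S) C'"
    unfolding realises_def time_edges_graph_of graph_of_simps
  proof (intro conjI)
    show "\<forall>(X, a, b)\<in>C'. X \<subseteq> V \<and> 1 \<le> a \<and> a \<le> b \<and> b \<le> ?l"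
      unfolding C'_def using interval by fastforce
    show "\<forall>p\<in>C'. \<forall>q\<in>C'. p \<noteq> q \<longrightarrow> independent d2 p q"
    proof (intro ballI impI)
      fix p q assume "p \<in> C'" "q \<in> C'" "p \<noteq> q"
      then obtain X a b Y c e where
        pq: "(X, a, b) \<in> C" "p = (X, a, min b ?l)" "(Y, c, e) \<in> C" "q = (Y, c, min e ?l)"
        unfolding C'_def by blast
      then have "independent d2 (X, a, b) (Y, c, e)" using indep \<open>p \<noteq> q\<close> by blast
      then show "independent d2 p q" unfolding pq by (rule independent_shrink) simp_all
    qed
    show "\<forall>(e, t)\<in>S. \<exists>(X, a, b)\<in>C'. e \<subseteq> X \<and> t \<in> {a..b}"
    proof clarify
      fix e t assume S: "(e, t) \<in> S"
      then have "t \<le> ?l" using fin lifetime_ge[of "graph_of V S" e t] by simp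
      obtain X a b where X: "(X, a, b) \<in> C" "e \<subseteq> X" "a \<le> t" "t \<le> b" using cover[OF S] by blast
      then show "\<exists>(X, a, b)\<in>C'. e \<subseteq> X \<and> t \<in> {a..b}"
        using \<open>t \<le> ?l\<close> by (intro bexI[of _ "(X, a, min b ?l)"]) (auto simp: C'_def)
    qed
    show "\<forall>(X, a, b)\<in>C'. \<forall>x\<in>X. \<forall>y\<in>X. x \<noteq> y \<longrightarrow>
        {x, y} \<in> fst ` S \<and> dense_in d1 (graph_of V S) {x, y} a b"
    proof clarify
      fix X a b' x y assume "(X, a, b') \<in> C'" and xy: "x \<in> X" "y \<in> X" "x \<noteq> y"
      then obtain b where b: "(X, a, b) \<in> C" "b' \<le> b" unfolding C'_def by auto
      have d: "dense_in d1 (graph_of V S) {x, y} a b'"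
        using dense_in_shrink[OF dense[OF b(1) xy] b(2)] .
      then have "\<exists>t. t \<in> edge_times S {x, y}" by (fastforce simp: dense_in_def)
      then show "{x, y} \<in> fst ` S \<and> dense_in d1 (graph_of V S) {x, y} a b'"
        using d by (force simp: edge_times_def)
    qed
  qed
  then show ?thesis by (auto simp: cluster_temporal_graph_def)
qed

section \<open>Runs inside the templates of a realisation; violations exclude a realisation\<close>

locale time_edge_set =
  fixes V :: "'v set" and S :: "('v set \<times> nat) set" and d1 d2 :: nat
  assumes finite_S: "finite S" and S_sub: "S \<subseteq> vertex_pairs V \<times> {1..}"
    and d1: "1 \<le> d1" and d12: "d1 < d2"
begin

abbreviation "A \<equiv> edge_times S"
text \<open>Runs are never formed as objects: a time-edge represents the run of its edge through its
  time.\<close>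

definition "F \<beta> = run_first d1 (A (fst \<beta>)) (snd \<beta>)"
definition "L \<beta> = run_last d1 (A (fst \<beta>)) (snd \<beta>)"

lemma finite_A [simp]: "finite (A e)"
  unfolding edge_times_def using finite_S
  by (rule finite_surj[of _ _ snd]) force

lemma mem_A: "t \<in> A e \<longleftrightarrow> (e, t) \<in> S"
  by (simp add: edge_times_def)

lemma
  assumes "\<beta> \<in> S"
  shows F_mem: "(fst \<beta>, F \<beta>) \<in> S" and L_mem: "(fst \<beta>, L \<beta>) \<in> S"
    and F_le: "F \<beta> \<le> snd \<beta>" and L_ge: "snd \<beta> \<le> L \<beta>"
proof -
  have t: "snd \<beta> \<in> A (fst \<beta>)" using assms by (simp add: mem_A)
  show "(fst \<beta>, F \<beta>) \<in> S" "F \<beta> \<le> snd \<beta>"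
    using run_first_mem[OF finite_A t] run_first_le[OF finite_A t] by (simp_all add: F_def mem_A)
  show "(fst \<beta>, L \<beta>) \<in> S" "snd \<beta> \<le> L \<beta>"
    using run_last_mem[OF finite_A t] run_last_ge[OF finite_A t] by (simp_all add: L_def mem_A)
qed

lemma F_le_L: "\<beta> \<in> S \<Longrightarrow> F \<beta> \<le> L \<beta>"
  using F_le[of \<beta>] L_ge[of \<beta>] by simp

lemma edge_vertex_pair: "\<beta> \<in> S \<Longrightarrow> fst \<beta> \<in> vertex_pairs V"
  using S_sub by (cases \<beta>) auto

lemma edge_pair: "\<beta> \<in> S \<Longrightarrow> \<exists>x y. x \<noteq> y \<and> fst \<beta> = {x, y}"
  using edge_vertex_pair unfolding vertex_pairs_def card_2_iff by blast

lemma edge_pair_at: "\<beta> \<in> S \<Longrightarrow> x \<in> fst \<beta> \<Longrightarrow> \<exists>y. y \<noteq> x \<and> fst \<beta> = {x, y}"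
  using edge_pair[of \<beta>] by (metis insertE insert_commute singletonD)

lemma edge_verts: "\<beta> \<in> S \<Longrightarrow> fst \<beta> \<subseteq> V"
  using edge_vertex_pair unfolding vertex_pairs_def by blast

text \<open>Successive times of a run are at most \<open>d1 < d2\<close> apart, so by independence
  the run cannot leave the template. Conversely, a template reaching \<open>d1\<close> or more
  beyond the run would contain a full window without a time of the edge.\<close>

lemma template_of_run:
  assumes C: "realises d1 d2 (graph_of V S) C"
    and X: "(X, a, b) \<in> C" and \<beta>: "(e, t) \<in> S" "e \<subseteq> X" "a \<le> t" "t \<le> b"
  shows "a \<le> F (e, t)" "F (e, t) < a + d1" "L (e, t) \<le> b" "b < L (e, t) + d1"
proof -
  let ?F = "F (e, t)" and ?L = "L (e, t)"
  obtain x y where xy: "x \<noteq> y" "e = {x, y}" using edge_pair[OF \<beta>(1)] by force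
  have dense: "dense_in d1 (graph_of V S) e a b"
    using realises_dense[OF C X, of x y] xy \<beta>(2) by auto
  have window: "\<exists>u\<in>A e. \<tau> \<le> u \<and> u \<le> \<tau> + d1 - 1" if "a \<le> \<tau>" "\<tau> \<le> max a (b + 1 - d1)" for \<tau>
    using dense that by (auto simp: dense_in_def)
  \<comment> \<open>The template covering \<open>u\<close> also contains \<open>e\<close>, and
    \<open>u\<close> is closer than \<open>d2\<close> to a point \<open>w\<close> of
    \<open>[a, b]\<close>; independence forces it to be the given template.\<close>
  have stay: "a \<le> u \<and> u \<le> b" if "u \<in> A e" "a \<le> w" "w \<le> b" "u \<le> w + d1" "w \<le> u + d1" for u w
  proof -
    from that(1) obtain Y c d where Y: "(Y, c, d) \<in> C" "e \<subseteq> Y" "c \<le> u" "u \<le> d"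
      using realises_covers[OF C, of e u] by (auto simp: mem_A)
    show ?thesis
    proof (cases "(Y, c, d) = (X, a, b)")
      case False
      then have "independent d2 (X, a, b) (Y, c, d)"
        using realises_independent[OF C X Y(1)] by metis
      then have "int d2 \<le> \<bar>int w - int u\<bar>"
        using xy Y \<beta>(2) that by auto
      then show ?thesis using that d12 by auto
    qed (use Y in auto)
  qed
  have tA: "t \<in> A e" using \<beta> by (simp add: mem_A)
  have F: "?F \<in> A e" "?F \<le> t" and L: "?L \<in> A e" "t \<le> ?L"
    using F_mem[OF \<beta>(1)] F_le[OF \<beta>(1)] L_mem[OF \<beta>(1)] L_ge[OF \<beta>(1)] by (simp_all add: mem_A)
  have F_min: "\<And>u. u \<in> A e \<Longrightarrow> ?F \<le> u \<or> u + d1 < ?F"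
    and L_max: "\<And>u. u \<in> A e \<Longrightarrow> u \<le> ?L \<or> ?L + d1 < u"
    using run_first_minimal[OF finite_A tA] run_last_maximal[OF finite_A tA]
    by (auto simp: F_def L_def)
  show Lb: "?L \<le> b"
  proof (rule ccontr)
    assume "\<not> ?L \<le> b"
    obtain w where w: "w \<in> A e" "w \<le> b" "t \<le> w" and w_max: "\<And>u. u \<in> A e \<Longrightarrow> u \<le> b \<Longrightarrow> u \<le> w"
      using greatest_at_most[OF tA \<beta>(4)] by blast
    have Fw: "?F \<le> w" and wL: "w < ?L" using F w \<open>\<not> ?L \<le> b\<close> by auto
    obtain u where u: "u \<in> A e" "w < u" "u \<le> w + d1"
      using run_gap[OF finite_A tA w(1), of d1] Fw wL by (auto simp: F_def L_def)
    then have "u \<le> b"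
      using stay[of u w] w \<beta> by auto
    then show False using w_max u by fastforce
  qed
  show Fa: "a \<le> ?F"
  proof (rule ccontr)
    assume neg: "\<not> a \<le> ?F"
    have "?F \<le> a - 1" using neg by simp
    obtain w where w: "w \<in> A e" "w \<le> a - 1" "?F \<le> w"
      and w_max: "\<And>u. u \<in> A e \<Longrightarrow> u \<le> a - 1 \<Longrightarrow> u \<le> w"
      using greatest_at_most[OF F(1) \<open>?F \<le> a - 1\<close>] by blast
    have "w < ?L" using L w neg \<beta> by linarith
    obtain u where u: "u \<in> A e" "w < u" "u \<le> w + d1"
      using run_gap[OF finite_A tA w(1), of d1] \<open>w < ?L\<close> w by (auto simp: F_def L_def)
    then have ua: "a \<le> u" using w_max[of u] by linarith
    have "u \<le> ?L"
      using L_max[OF u(1)] u \<open>w < ?L\<close> by linarith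
    then have "a \<le> w"
      using stay[of w u] w u ua Lb by auto
    then show False using w neg by simp
  qed
  \<comment> \<open>The window that starts right after the run would hold a time within
    \<open>d1\<close> of its last time; the start of the run is treated in the same way.\<close>
  show "b < ?L + d1"
  proof (rule ccontr)
    assume "\<not> b < ?L + d1"
    then obtain u where "u \<in> A e" "?L + 1 \<le> u" "u \<le> ?L + 1 + d1 - 1"
      using window[of "?L + 1"] L \<beta> by fastforce
    then show False using L_max by fastforce
  qed
  show "?F < a + d1"
  proof (rule ccontr)
    assume neg: "\<not> ?F < a + d1"
    then obtain u where "u \<in> A e" "?F - d1 \<le> u" "u \<le> ?F - d1 + d1 - 1"
      using window[of "?F - d1"] F \<beta> by fastforce
    then show False using F_min[of u] neg d1 by linarith
  qed
qed

lemma same_template: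
  assumes C: "realises d1 d2 (graph_of V S) C"
    and X: "(X, a, b) \<in> C" "(Y, c, d) \<in> C" and x: "x \<in> X" "x \<in> Y"
    and f: "a \<le> f" "f \<le> l" "l \<le> b" "c \<le> f'" "f' \<le> l'" "l' \<le> d" and n: "near d2 f l f' l'"
  shows "(X, a, b) = (Y, c, d)"
proof (rule ccontr)
  assume "(X, a, b) \<noteq> (Y, c, d)"
  then have "independent d2 (X, a, b) (Y, c, d)"
    by (rule realises_independent[OF C X])
  then have far: "int d2 \<le> \<bar>int s - int t\<bar>" if "a \<le> s" "s \<le> b" "c \<le> t" "t \<le> d" for s t
    using x that by auto
  consider "l < f'" | "l' < f" | "f' \<le> l" "f \<le> l'" by linarith
  then show False
  proof cases
    case 1 then show False using far[of l f'] f n by (auto simp: near_def)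
  next
    case 2 then show False using far[of f l'] f n by (auto simp: near_def)
  next
    case 3
    \<comment> \<open>Overlapping intervals both contain the later of their two starts, a point at
      distance zero from itself.\<close>
    then show False using far[of f f] far[of f' f'] f d12 by (cases "f \<le> f'") auto
  qed
qed

lemma cluster_imp_not_violation:
  assumes "cluster_temporal_graph d1 d2 (graph_of V S)"
  shows "\<not> violation d1 d2 S q p v r s t t'"
proof
  assume viol: "violation d1 d2 S q p v r s t t'"
  from assms obtain C where C: "realises d1 d2 (graph_of V S) C"
    by (auto simp: cluster_temporal_graph_def)
  define f l f' l' where fl: "f = F ({q, p}, t)" "l = L ({q, p}, t)"
    "f' = F ({r, s}, t')" "l' = L ({r, s}, t')"
  have t: "({q, p}, t) \<in> S" "({r, s}, t') \<in> S"
    using viol by (auto simp: violation_def mem_A)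
  have link: "linked (A {p, v}) (A {v, r}) (r = p \<or> s = v) d2 f l f' l'"
    and bad: "\<not> (aligned d1 f l f' l' \<and>
            (r = p \<or> (\<exists>u\<in>A {p, r}. near d2 u u f l \<and> near d2 u u f' l')))"
    using viol by (auto simp: violation_def fl F_def L_def Let_def)
  have ex: "\<exists>X a b. (X, a, b) \<in> C \<and> e \<subseteq> X \<and> a \<le> u \<and> u \<le> b" if "(e, u) \<in> S" for e u
    using realises_covers[OF C, of e u] that by auto
  obtain X a b where X: "(X, a, b) \<in> C" "{q, p} \<subseteq> X" "a \<le> t" "t \<le> b"
    using ex t(1) by metis
  obtain Y c d where Y: "(Y, c, d) \<in> C" "{r, s} \<subseteq> Y" "c \<le> t'" "t' \<le> d"
    using ex t(2) by metis
  have fX: "a \<le> f" "f < a + d1" "l \<le> b" "b < l + d1" "f \<le> l"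
    unfolding fl using template_of_run[OF C X(1) t(1) X(2-4)] F_le_L[OF t(1)] by simp_all
  have fY: "c \<le> f'" "f' < c + d1" "l' \<le> d" "d < l' + d1" "f' \<le> l'"
    unfolding fl using template_of_run[OF C Y(1) t(2) Y(2-4)] F_le_L[OF t(2)] by simp_all
  \<comment> \<open>A template that has a vertex in \<open>X\<close> and a time near the run of
    \<open>qp\<close> is the template of that run.\<close>
  have joinX: "(Z, g, h) = (X, a, b)"
    if "(Z, g, h) \<in> C" "x \<in> Z" "x \<in> X" "g \<le> u" "u \<le> h" "near d2 u u f l" for Z g h x u
    using same_template[OF C that(1) X(1) that(2,3), of u u f l] that fX by auto
  have joinY: "(Z, g, h) = (Y, c, d)"
    if "(Z, g, h) \<in> C" "x \<in> Z" "x \<in> Y" "g \<le> u" "u \<le> h" "near d2 u u f' l'" for Z g h x u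
    using same_template[OF C that(1) Y(1) that(2,3), of u u f' l'] that fY by auto
  have "v \<in> X"
  proof -
    obtain u where u: "u \<in> A {p, v}" "near d2 u u f l" using link by (auto simp: linked_def)
    obtain Z g h where Z: "(Z, g, h) \<in> C" "{p, v} \<subseteq> Z" "g \<le> u" "u \<le> h"
      using ex[OF u(1)[unfolded mem_A]] by blast
    then show ?thesis using joinX[of Z g h p u] u X by auto
  qed
  moreover have "v \<in> Y"
  proof -
    obtain u where u: "u \<in> A {v, r}" "near d2 u u f' l'" using link by (auto simp: linked_def)
    obtain Z g h where Z: "(Z, g, h) \<in> C" "{v, r} \<subseteq> Z" "g \<le> u" "u \<le> h"
      using ex[OF u(1)[unfolded mem_A]] by blast
    then show ?thesis using joinY[of Z g h r u] u Y by auto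
  qed
  \<comment> \<open>The second alternative of \<open>linked\<close>: the template of
    \<open>pv\<close> equals both others, as it meets \<open>Y\<close> in \<open>p\<close> if
    \<open>r = p\<close> and in \<open>v\<close> if \<open>s = v\<close>.\<close>
  moreover have "(X, a, b) = (Y, c, d)"
    if u: "u \<in> A {p, v}" "near d2 u u f l" "near d2 u u f' l'" "r = p \<or> s = v" for u
  proof -
    obtain Z g h where Z: "(Z, g, h) \<in> C" "{p, v} \<subseteq> Z" "g \<le> u" "u \<le> h"
      using ex[OF u(1)[unfolded mem_A]] by blast
    have "(Z, g, h) = (X, a, b)" using joinX[of Z g h p u] Z X u by auto
    moreover have "(Z, g, h) = (Y, c, d)"
      using joinY[of Z g h p u] joinY[of Z g h v u] Z Y u by auto
    ultimately show ?thesis by simp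
  qed
  ultimately have eq: "(X, a, b) = (Y, c, d)"
    using link same_template[OF C X(1) Y(1), of v f l f' l'] fX fY by (auto simp: linked_def)
  then have "aligned d1 f l f' l'" using fX fY by (auto simp: aligned_def)
  moreover have "\<exists>u\<in>A {p, r}. near d2 u u f l \<and> near d2 u u f' l'" if "r \<noteq> p"
  proof -
    have "dense_in d1 (graph_of V S) {p, r} a b"
      using realises_dense[OF C X(1), of p r] X Y eq that by auto
    \<comment> \<open>The first window of the template provides the time of \<open>pr\<close>: both
      runs start within the same \<open>d1\<close> times, so \<open>u\<close> is near both.\<close>
    then obtain u where "u \<in> A {p, r}" "a \<le> u" "u \<le> a + d1 - 1"
      by (fastforce simp: dense_in_def)
    then show ?thesis
      using fX fY eq d12 d1 by (intro bexI[of _ u]) (auto simp: near_def)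
  qed
  ultimately show False using bad by blast
qed

end

section \<open>Templates from the absence of violations\<close>

locale no_violation = time_edge_set +
  assumes no_viol: "\<not> violated d1 d2 S q p v r s"
begin

text \<open>Adjacent time-edges are those which independence forces into one template directly;
  \<open>align\<close> is what a common template then demands of their runs.\<close>

definition adj :: "'a set \<times> nat \<Rightarrow> 'a set \<times> nat \<Rightarrow> bool" where
  "adj \<beta> \<gamma> \<longleftrightarrow> \<beta> \<in> S \<and> \<gamma> \<in> S \<and> fst \<beta> \<inter> fst \<gamma> \<noteq> {} \<and> near d2 (F \<beta>) (L \<beta>) (F \<gamma>) (L \<gamma>)"

definition align :: "'a set \<times> nat \<Rightarrow> 'a set \<times> nat \<Rightarrow> bool" where
  "align \<beta> \<gamma> \<longleftrightarrow> aligned d1 (F \<beta>) (L \<beta>) (F \<gamma>) (L \<gamma>)"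

definition near_time :: "nat \<Rightarrow> 'a set \<times> nat \<Rightarrow> bool" where
  "near_time u \<beta> \<longleftrightarrow> near d2 u u (F \<beta>) (L \<beta>)"

lemma not_violation:
  assumes "({q, p}, t) \<in> S" "({r, s}, t') \<in> S"
    and "\<exists>u\<in>A {p, v}. near_time u ({q, p}, t)" "\<exists>u\<in>A {v, r}. near_time u ({r, s}, t')"
    and "near d2 (F ({q, p}, t)) (L ({q, p}, t)) (F ({r, s}, t')) (L ({r, s}, t')) \<or>
      (r = p \<or> s = v) \<and> (\<exists>u\<in>A {p, v}. near_time u ({q, p}, t) \<and> near_time u ({r, s}, t'))"
  shows "align ({q, p}, t) ({r, s}, t')"
    and "r \<noteq> p \<Longrightarrow> \<exists>u\<in>A {p, r}. near_time u ({q, p}, t) \<and> near_time u ({r, s}, t')"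
proof -
  have "\<not> violation d1 d2 S q p v r s t t'"
    using no_viol unfolding violated_def by blast
  then have "align ({q, p}, t) ({r, s}, t') \<and>
    (r = p \<or> (\<exists>u\<in>A {p, r}. near_time u ({q, p}, t) \<and> near_time u ({r, s}, t')))"
    using assms
    unfolding violation_def linked_def Let_def F_def L_def near_time_def align_def mem_A fst_conv snd_conv
    by blast
  then show "align ({q, p}, t) ({r, s}, t')"
    and "r \<noteq> p \<Longrightarrow> \<exists>u\<in>A {p, r}. near_time u ({q, p}, t) \<and> near_time u ({r, s}, t')"
    by blast+
qed

lemma edge_at:
  assumes "\<beta> \<in> S" "p \<in> fst \<beta>"
  obtains q t where "\<beta> = ({q, p}, t)" "q \<noteq> p"
  using edge_pair_at[OF assms] by (metis insert_commute prod.collapse)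

lemma near_own_time: "(e, t) \<in> S \<Longrightarrow> near_time t (e, t)"
  using F_le[of "(e, t)"] L_ge[of "(e, t)"] d12 by (simp add: near_time_def near_def)

text \<open>Closeness of two runs becomes closeness of a single time to a run, the form in which
  \<open>linked\<close> asks for it.\<close>

lemma near_point:
  assumes "(e, t) \<in> S" "\<gamma> \<in> S" "near d2 (F (e, t)) (L (e, t)) (F \<gamma>) (L \<gamma>)"
  shows "\<exists>u\<in>A e. near_time u \<gamma>"
  using near_run_point[OF finite_A _ d12 F_le_L[OF assms(2)], of t e] assms
  by (simp add: near_time_def F_def L_def mem_A)

lemma near_of_point:
  assumes "(e, u) \<in> S" "near_time u \<gamma>"
  shows "near d2 (F (e, u)) (L (e, u)) (F \<gamma>) (L \<gamma>)"
  using F_le[OF assms(1)] L_ge[OF assms(1)] assms(2) by (simp add: near_time_def near_def)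

lemma adj_sym: "adj \<beta> \<gamma> \<longleftrightarrow> adj \<gamma> \<beta>"
  by (auto simp: adj_def near_sym)

lemma adj_refl: "\<beta> \<in> S \<Longrightarrow> adj \<beta> \<beta>"
  using edge_pair[of \<beta>] F_le_L[of \<beta>] d12 by (auto simp: adj_def near_def)

lemma adj_S: "adj \<beta> \<gamma> \<Longrightarrow> \<beta> \<in> S" "adj \<beta> \<gamma> \<Longrightarrow> \<gamma> \<in> S"
  by (auto simp: adj_def)

lemma near_if_align: "\<beta> \<in> S \<Longrightarrow> \<gamma> \<in> S \<Longrightarrow> align \<beta> \<gamma> \<Longrightarrow> near d2 (F \<beta>) (L \<beta>) (F \<gamma>) (L \<gamma>)"
  using near_if_aligned[of d1 "F \<beta>" "L \<beta>" "F \<gamma>" "L \<gamma>" d2] F_le_L d12 by (simp add: align_def)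

lemma adj_if_align:
  "\<beta> \<in> S \<Longrightarrow> \<gamma> \<in> S \<Longrightarrow> align \<beta> \<gamma> \<Longrightarrow> x \<in> fst \<beta> \<Longrightarrow> x \<in> fst \<gamma> \<Longrightarrow> adj \<beta> \<gamma>"
  using near_if_align by (auto simp: adj_def)

text \<open>The degenerate walk \<open>q p v p v\<close>, whose last edge \<open>rs\<close> is
  \<open>pv\<close> itself.\<close>

lemma adj_align:
  assumes "adj \<beta> \<gamma>"
  shows "align \<beta> \<gamma>"
proof -
  note S = adj_S[OF assms]
  from assms obtain p where p: "p \<in> fst \<beta>" "p \<in> fst \<gamma>" by (auto simp: adj_def)
  obtain q t where \<beta>: "\<beta> = ({q, p}, t)" using edge_at[OF S(1) p(1)] by metis
  obtain v t' where "\<gamma> = ({v, p}, t')" using edge_at[OF S(2) p(2)] by metis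
  then have \<gamma>: "\<gamma> = ({p, v}, t')" by (simp add: insert_commute)
  have n: "near d2 (F \<beta>) (L \<beta>) (F \<gamma>) (L \<gamma>)" using assms by (simp add: adj_def)
  have "\<exists>u\<in>A {p, v}. near_time u ({q, p}, t)"
    using near_point[of "{p, v}" t' \<beta>] S n by (simp add: \<beta> \<gamma> near_sym)
  moreover have "\<exists>u\<in>A {v, p}. near_time u ({p, v}, t')"
    using near_own_time[of "{p, v}" t'] S(2) by (auto simp: \<gamma> mem_A insert_commute)
  ultimately show ?thesis
    using not_violation(1)[of q p t p v t' v] S n by (simp add: \<beta> \<gamma>)
qed

text \<open>The middle time-edge plays \<open>pv\<close>. The walk is \<open>q p v p s\<close> if
  the third one contains \<open>p\<close>, and \<open>q p v r v\<close> if it contains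
  \<open>v\<close>: these are the cases \<open>r = p\<close> and \<open>s = v\<close> of the second
  alternative in \<open>linked\<close>.\<close>

lemma adj_adj_align:
  assumes "adj \<beta> \<gamma>" "adj \<gamma> \<delta>"
  shows "align \<beta> \<delta>"
proof -
  note S = adj_S[OF assms(1)] adj_S(2)[OF assms(2)]
  from assms(1) obtain p where p: "p \<in> fst \<beta>" "p \<in> fst \<gamma>" by (auto simp: adj_def)
  obtain q t where \<beta>: "\<beta> = ({q, p}, t)" using edge_at[OF S(1) p(1)] by metis
  obtain v u where "\<gamma> = ({v, p}, u)" using edge_at[OF S(2) p(2)] by metis
  then have \<gamma>: "\<gamma> = ({p, v}, u)" by (simp add: insert_commute)
  have al: "align \<beta> \<gamma>" "align \<gamma> \<delta>" using adj_align assms by blast+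
  have FA: "F \<gamma> \<in> A {p, v}" using F_mem[OF S(2)] by (simp add: \<gamma> mem_A)
  \<comment> \<open>By alignment the start of the middle run is one time of \<open>pv\<close> that
    is near both outer runs, although these need not be near each other a priori.\<close>
  have near: "near_time (F \<gamma>) \<beta>" "near_time (F \<gamma>) \<delta>"
    using al F_le_L[OF S(1)] F_le_L[OF S(3)] d12
    by (auto simp: near_time_def near_def align_def aligned_def)
  from assms(2) consider "p \<in> fst \<delta>" | "v \<in> fst \<delta>" by (auto simp: adj_def \<gamma>)
  then show ?thesis
  proof cases
    case 1
    obtain s t' where "\<delta> = ({s, p}, t')" using edge_at[OF S(3) 1] by metis
    then have \<delta>: "\<delta> = ({p, s}, t')" by (simp add: insert_commute)
    have "F \<gamma> \<in> A {v, p}" using FA by (simp add: insert_commute)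
    then show ?thesis
      using not_violation(1)[of q p t p s t' v] S near FA unfolding \<beta> \<delta> by blast
  next
    case 2
    obtain r t' where \<delta>: "\<delta> = ({r, v}, t')" using edge_at[OF S(3) 2] by metis
    have "\<exists>w\<in>A {v, r}. near_time w ({r, v}, t')"
      using near_own_time[of "{r, v}" t'] S(3) by (auto simp: \<delta> mem_A insert_commute)
    then show ?thesis
      using not_violation(1)[of q p t r v t' v] S near FA unfolding \<beta> \<delta> by blast
  qed
qed

text \<open>The closed walk \<open>x y x z x\<close>: here the pair \<open>pr\<close> whose presence
  is enforced is the third side \<open>yz\<close>.\<close>

lemma triangle:
  assumes "adj ({x, y}, t) ({x, z}, t')" "y \<noteq> z"
  shows "\<exists>u. adj ({y, z}, u) ({x, y}, t) \<and> adj ({y, z}, u) ({x, z}, t')"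
proof -
  note S = adj_S[OF assms(1)]
  have S': "({y, x}, t) \<in> S" "({z, x}, t') \<in> S" using S by (simp_all add: insert_commute)
  have "\<exists>u\<in>A {y, x}. near_time u ({x, y}, t)" "\<exists>u\<in>A {x, z}. near_time u ({z, x}, t')"
    using near_own_time[OF S(1)] near_own_time[OF S'(2)] S S' by (auto simp: mem_A insert_commute)
  moreover have "near d2 (F ({x, y}, t)) (L ({x, y}, t)) (F ({z, x}, t')) (L ({z, x}, t'))"
    using assms(1) by (simp add: adj_def insert_commute)
  ultimately obtain u where "u \<in> A {y, z}" "near_time u ({x, y}, t)" "near_time u ({z, x}, t')"
    using not_violation(2)[OF S(1) S'(2), of x] assms(2) by metis
  then show ?thesis
    using near_of_point[of "{y, z}" u] S S'
    by (intro exI[of _ u]) (auto simp: adj_def mem_A insert_commute)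
qed

text \<open>Two steps are the right number: in a clique, disjoint edges are not adjacent, but a
  third edge meets both.\<close>

definition rel :: "'a set \<times> nat \<Rightarrow> 'a set \<times> nat \<Rightarrow> bool" where
  "rel \<beta> \<delta> \<longleftrightarrow> (\<exists>\<gamma>. adj \<beta> \<gamma> \<and> adj \<gamma> \<delta>)"

lemma relI: "adj \<beta> \<gamma> \<Longrightarrow> adj \<gamma> \<delta> \<Longrightarrow> rel \<beta> \<delta>"
  unfolding rel_def by blast

lemma rel_S: "rel \<beta> \<delta> \<Longrightarrow> \<beta> \<in> S" "rel \<beta> \<delta> \<Longrightarrow> \<delta> \<in> S"
  using adj_S unfolding rel_def by blast+

lemma rel_align: "rel \<beta> \<delta> \<Longrightarrow> align \<beta> \<delta>"
  using adj_adj_align unfolding rel_def by blast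

lemma rel_sym: "rel \<beta> \<delta> \<Longrightarrow> rel \<delta> \<beta>"
  unfolding rel_def using adj_sym by metis

lemma rel_refl: "\<beta> \<in> S \<Longrightarrow> rel \<beta> \<beta>"
  using adj_refl relI by blast

text \<open>If the first and third, or the second and fourth, time-edges share a vertex, alignment
  makes them adjacent and a step is saved. Otherwise the middle two form a path whose closing edge
  \<open>xw\<close> is adjacent to both outer ones and replaces the two middle ones.\<close>

lemma adj_adj_adj_rel:
  assumes 1: "adj \<beta>1 \<beta>2" and 2: "adj \<beta>2 \<beta>3" and 3: "adj \<beta>3 \<beta>4"
  shows "rel \<beta>1 \<beta>4"
proof -
  note S = adj_S[OF 1] adj_S[OF 3]
  have a13: "align \<beta>1 \<beta>3" and a24: "align \<beta>2 \<beta>4" using adj_adj_align 1 2 3 by blast+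
  show ?thesis
  proof (cases "fst \<beta>1 \<inter> fst \<beta>3 = {} \<and> fst \<beta>2 \<inter> fst \<beta>4 = {}")
    case False
    then show ?thesis
      using adj_if_align[OF S(1,3) a13] adj_if_align[OF S(2,4) a24] 1 3 relI by blast
  next
    case True
    obtain z where z: "z \<in> fst \<beta>2" "z \<in> fst \<beta>3" using 2 by (auto simp: adj_def)
    obtain x t where "\<beta>2 = ({x, z}, t)" "x \<noteq> z" using edge_at[OF S(2) z(1)] by metis
    then have \<beta>2: "\<beta>2 = ({z, x}, t)" by (simp add: insert_commute)
    obtain w u where "\<beta>3 = ({w, z}, u)" "w \<noteq> z" using edge_at[OF S(3) z(2)] by metis
    then have \<beta>3: "\<beta>3 = ({z, w}, u)" by (simp add: insert_commute)
    \<comment> \<open>The vertex \<open>z\<close> lies in \<open>\<beta>3\<close> and hence not in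
      \<open>\<beta>1\<close>, so \<open>\<beta>1\<close> meets \<open>\<beta>2\<close> in its other
      end.\<close>
    have x: "x \<in> fst \<beta>1" using 1 z True by (auto simp: adj_def \<beta>2)
    have w: "w \<in> fst \<beta>4" using 3 z True by (auto simp: adj_def \<beta>3)
    have "x \<noteq> w" using True w by (auto simp: \<beta>2)
    then obtain i where i: "adj ({x, w}, i) \<beta>2" "adj ({x, w}, i) \<beta>3"
      using triangle[of z x t w u] 2 \<beta>2 \<beta>3 by auto
    let ?\<delta> = "({x, w}, i)"
    have "align \<beta>1 ?\<delta>" "align ?\<delta> \<beta>4"
      using adj_adj_align[OF 1] adj_adj_align[OF _ 3] i adj_sym by blast+
    then have "adj \<beta>1 ?\<delta>" "adj ?\<delta> \<beta>4"
      using adj_if_align[OF S(1) adj_S(1)[OF i(1)], of x]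
        adj_if_align[OF adj_S(1)[OF i(1)] S(4), of w] x w by auto
    then show ?thesis by (rule relI)
  qed
qed

lemma rel_trans:
  assumes "rel \<alpha> \<beta>" "rel \<beta> \<gamma>"
  shows "rel \<alpha> \<gamma>"
proof -
  obtain a b where "adj \<alpha> a" "adj a \<beta>" "adj \<beta> b" "adj b \<gamma>"
    using assms unfolding rel_def by blast
  then obtain c where "adj \<alpha> c" "adj c b"
    using adj_adj_adj_rel[of \<alpha> a \<beta> b] unfolding rel_def by blast
  then show ?thesis using adj_adj_adj_rel \<open>adj b \<gamma>\<close> by blast
qed

text \<open>The edge \<open>xw\<close> is one of the two given edges or closes a triangle with
  them.\<close>

lemma adj_span:
  assumes "adj \<beta> \<gamma>" "x \<in> fst \<beta>" "w \<in> fst \<gamma>" "x \<noteq> w"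
  obtains u where "adj ({x, w}, u) \<beta>" "adj ({x, w}, u) \<gamma>"
proof -
  note S = adj_S[OF assms(1)]
  obtain y t where \<beta>: "\<beta> = ({y, x}, t)" using edge_at[OF S(1) assms(2)] by metis
  obtain z t' where \<gamma>: "\<gamma> = ({z, w}, t')" using edge_at[OF S(2) assms(3)] by metis
  consider "y = w" | "z = x" | "y = z" "y \<noteq> w" "z \<noteq> x"
    using assms(1,4) by (auto simp: adj_def \<beta> \<gamma>)
  then show ?thesis
  proof cases
    case 1
    then show ?thesis
      using that[of t] assms(1) adj_refl[OF S(1)] by (simp add: \<beta> insert_commute)
  next
    case 2
    then show ?thesis
      using that[of t'] assms(1) adj_refl[OF S(2)] adj_sym by (simp add: \<gamma> insert_commute)
  next
    case 3
    then show ?thesis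
      using that triangle[of y x t w t'] assms(1,4) by (auto simp: \<beta> \<gamma>)
  qed
qed

text \<open>Behind the clique condition: replace \<open>x\<close> to \<open>w\<close> by a detour
  over a vertex \<open>c\<close> common to the last two time-edges of the chain, and apply
  \<open>adj_span\<close> on either side.\<close>

lemma rel_span:
  assumes "rel \<beta> \<delta>" "x \<in> fst \<beta>" "w \<in> fst \<delta>" "x \<noteq> w"
  obtains u where "rel ({x, w}, u) \<beta>"
proof -
  obtain \<gamma> where \<gamma>: "adj \<beta> \<gamma>" "adj \<gamma> \<delta>" using assms(1) unfolding rel_def by blast
  then obtain c where c: "c \<in> fst \<gamma>" "c \<in> fst \<delta>" by (auto simp: adj_def)
  show ?thesis
  proof (cases "x = c")
    case True
    then show ?thesis
      using adj_span[OF \<gamma>(2), of x w] c assms that \<gamma>(1) adj_sym relI by metis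
  next
    case False
    obtain u where u: "adj ({x, c}, u) \<beta>" "adj ({x, c}, u) \<gamma>"
      using adj_span[OF \<gamma>(1) assms(2) c(1) False] by blast
    have "align ({x, c}, u) \<delta>" using adj_adj_align[OF u(2) \<gamma>(2)] .
    then have "adj ({x, c}, u) \<delta>"
      using adj_if_align[OF adj_S(1)[OF u(1)] adj_S(2)[OF \<gamma>(2)], of c] c by simp
    then obtain i where "adj ({x, w}, i) ({x, c}, u)"
      using adj_span[of _ _ x w] assms by (metis fst_conv insertI1)
    then show ?thesis using that relI u(1) by blast
  qed
qed

section \<open>Equivalence classes of time-edges as templates\<close>

definition cls :: "'a set \<times> nat \<Rightarrow> ('a set \<times> nat) set" where
  "cls \<beta> = {\<gamma>. rel \<beta> \<gamma>}"

definition span :: "('a set \<times> nat) set \<Rightarrow> 'a set" where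
  "span K = \<Union> (fst ` K)"

text \<open>All runs of a class are pairwise aligned, so each of them reaches to within less than
  \<open>d1\<close> of both ends of the hull. This keeps every edge of the class dense in the whole
  hull.\<close>

definition template :: "'a set \<times> nat \<Rightarrow> 'a set \<times> nat \<times> nat" where
  "template \<beta> = (span (cls \<beta>), Min (F ` cls \<beta>), Max (L ` cls \<beta>))"

lemma finite_cls: "finite (cls \<beta>)"
  by (rule finite_subset[OF _ finite_S]) (use rel_S in \<open>unfold cls_def, blast\<close>)

lemma cls_eq: "rel \<beta> \<gamma> \<Longrightarrow> cls \<beta> = cls \<gamma>"
  using rel_trans rel_sym unfolding cls_def by blast

lemma cls_rel: "\<gamma> \<in> cls \<beta> \<Longrightarrow> \<delta> \<in> cls \<beta> \<Longrightarrow> rel \<gamma> \<delta>"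
  using rel_trans rel_sym unfolding cls_def by blast

lemma cls_S: "\<gamma> \<in> cls \<beta> \<Longrightarrow> \<gamma> \<in> S"
  using rel_S unfolding cls_def by blast

lemma self_cls: "\<beta> \<in> S \<Longrightarrow> \<beta> \<in> cls \<beta>"
  using rel_refl by (simp add: cls_def)

lemma cls_span:
  assumes "x \<in> span (cls \<beta>)" "y \<in> span (cls \<beta>)" "x \<noteq> y"
  obtains u where "({x, y}, u) \<in> cls \<beta>"
proof -
  obtain \<gamma> \<delta> where g: "\<gamma> \<in> cls \<beta>" "\<delta> \<in> cls \<beta>" "x \<in> fst \<gamma>" "y \<in> fst \<delta>"
    using assms by (auto simp: span_def)
  then obtain u where "rel ({x, y}, u) \<gamma>"
    using rel_span[OF cls_rel[OF g(1,2)] g(3,4) assms(3)] by blast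
  then have "({x, y}, u) \<in> cls \<beta>"
    using g(1) rel_trans rel_sym unfolding cls_def by blast
  then show ?thesis using that by blast
qed

text \<open>Behind independence. Here the general walk is used: \<open>qp\<close> and
  \<open>rs\<close> are \<open>\<beta>\<close> and \<open>\<delta>\<close>, the edges
  \<open>pv\<close> and \<open>vr\<close> exist inside the two classes, and the enforced time of
  \<open>pr\<close> is adjacent to both \<open>\<beta>\<close> and \<open>\<delta>\<close>.\<close>

lemma cls_merge:
  assumes \<beta>: "\<beta> \<in> cls \<kappa>" and \<delta>: "\<delta> \<in> cls \<mu>"
    and v: "v \<in> span (cls \<kappa>)" "v \<in> span (cls \<mu>)"
    and n: "near d2 (F \<beta>) (L \<beta>) (F \<delta>) (L \<delta>)"
  shows "cls \<kappa> = cls \<mu>"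
proof -
  have partner: "\<exists>q p t. \<gamma> = ({q, p}, t) \<and> (\<exists>u\<in>A {p, v}. near_time u \<gamma>)"
    if g: "\<gamma> \<in> cls \<nu>" "v \<in> span (cls \<nu>)" for \<gamma> \<nu>
  proof -
    obtain x y where xy: "x \<noteq> y" "fst \<gamma> = {x, y}" using edge_pair[OF cls_S[OF g(1)]] by blast
    \<comment> \<open>Whether or not \<open>v\<close> is an end of \<open>\<gamma>\<close>, some end
      \<open>p\<close> differs from it, and the class joins \<open>p\<close> to
      \<open>v\<close>.\<close>
    then obtain p where p: "p \<in> fst \<gamma>" "p \<noteq> v" by auto
    then obtain q t where \<gamma>: "\<gamma> = ({q, p}, t)" using edge_at[OF cls_S[OF g(1)]] by metis
    have "p \<in> span (cls \<nu>)" using g p by (auto simp: span_def)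
    then obtain u where u: "({p, v}, u) \<in> cls \<nu>" using cls_span g(2) p(2) by metis
    then have "near d2 (F ({p, v}, u)) (L ({p, v}, u)) (F \<gamma>) (L \<gamma>)"
      using near_if_align cls_S g(1) rel_align cls_rel by blast
    then show ?thesis using near_point[OF cls_S[OF u] cls_S[OF g(1)]] \<gamma> by blast
  qed
  obtain q p t where q: "\<beta> = ({q, p}, t)" "\<exists>u\<in>A {p, v}. near_time u \<beta>"
    using partner[OF \<beta> v(1)] by blast
  obtain s r t' where "\<delta> = ({s, r}, t')" and r: "\<exists>u\<in>A {r, v}. near_time u \<delta>"
    using partner[OF \<delta> v(2)] by blast
  then have s: "\<delta> = ({r, s}, t')" by (simp add: insert_commute)
  have r': "\<exists>u\<in>A {v, r}. near_time u \<delta>" using r by (simp add: insert_commute)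
  have S: "\<beta> \<in> S" "\<delta> \<in> S" using \<beta> \<delta> cls_S by auto
  have "rel \<beta> \<delta>"
  proof (cases "r = p")
    case True
    then have "adj \<beta> \<delta>" using S n by (auto simp: adj_def q(1) s)
    then show ?thesis using adj_refl[OF S(2)] relI by blast
  next
    case False
    then obtain u where u: "u \<in> A {p, r}" "near_time u \<beta>" "near_time u \<delta>"
      using not_violation(2)[of q p t r s t' v] S q(2) r' n unfolding q(1) s by blast
    have "({p, r}, u) \<in> S" using u(1) by (simp add: mem_A)
    then have "adj ({p, r}, u) \<beta>" "adj ({p, r}, u) \<delta>"
      using near_of_point[of "{p, r}" u] u S by (auto simp: adj_def q(1) s)
    then show ?thesis using relI adj_sym by blast
  qed
  moreover have "cls \<kappa> = cls \<beta>" "cls \<mu> = cls \<delta>"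
    using cls_eq \<beta> \<delta> by (auto simp: cls_def)
  ultimately show ?thesis using cls_eq by simp
qed

text \<open>The ends of a hull may come from different runs, so closeness of hulls is not at once
  closeness of runs. Pairing the extreme runs crosswise settles one of the two inequalities in each
  pair; alignment settles the other one in at least one pair.\<close>

lemma hull_near:
  assumes K: "\<And>\<beta> \<gamma>. \<beta> \<in> K \<Longrightarrow> \<gamma> \<in> K \<Longrightarrow> align \<beta> \<gamma>" "\<And>\<beta>. \<beta> \<in> K \<Longrightarrow> F \<beta> \<le> L \<beta>"
    and M: "\<And>\<beta> \<gamma>. \<beta> \<in> M \<Longrightarrow> \<gamma> \<in> M \<Longrightarrow> align \<beta> \<gamma>" "\<And>\<beta>. \<beta> \<in> M \<Longrightarrow> F \<beta> \<le> L \<beta>"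
    and fin: "finite K" "K \<noteq> {}" "finite M" "M \<noteq> {}"
    and n: "Min (F ` K) < Max (L ` M) + d2" "Min (F ` M) < Max (L ` K) + d2"
  shows "\<exists>\<beta>\<in>K. \<exists>\<gamma>\<in>M. near d2 (F \<beta>) (L \<beta>) (F \<gamma>) (L \<gamma>)"
proof -
  have "Min (F ` K) \<in> F ` K" "Max (L ` K) \<in> L ` K" "Min (F ` M) \<in> F ` M" "Max (L ` M) \<in> L ` M"
    using fin by simp_all
  then obtain a b c d where a: "a \<in> K" "Min (F ` K) = F a" and b: "b \<in> K" "Max (L ` K) = L b"
    and c: "c \<in> M" "Min (F ` M) = F c" and d: "d \<in> M" "Max (L ` M) = L d"
    by (elim imageE) blast
  have al: "F b < F a + d1" "L b < L a + d1" "F d < F c + d1" "L d < L c + d1"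
    using K(1)[OF a(1) b(1)] M(1)[OF c(1) d(1)] by (simp_all add: align_def aligned_def)
  \<comment> \<open>If both failed, alignment and \<open>d1 < d2\<close> would give
    \<open>F d < F b\<close> and \<open>F b < F d\<close>.\<close>
  have "F b < L c + d2 \<or> F d < L a + d2"
    using al K(2)[OF a(1)] M(2)[OF c(1)] d12 by linarith
  then have "near d2 (F b) (L b) (F c) (L c) \<or> near d2 (F a) (L a) (F d) (L d)"
    using n unfolding near_def a(2) b(2) c(2) d(2) by blast
  then show ?thesis using a(1) b(1) c(1) d(1) by blast
qed

lemma cls_run:
  assumes "\<gamma> \<in> cls \<beta>"
  shows "Min (F ` cls \<beta>) \<le> F \<gamma>" "F \<gamma> < Min (F ` cls \<beta>) + d1"
    "L \<gamma> \<le> Max (L ` cls \<beta>)" "Max (L ` cls \<beta>) < L \<gamma> + d1"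
proof -
  have fin: "finite (F ` cls \<beta>)" "F ` cls \<beta> \<noteq> {}" "finite (L ` cls \<beta>)" "L ` cls \<beta> \<noteq> {}"
    using finite_cls assms by auto
  show "Min (F ` cls \<beta>) \<le> F \<gamma>" "L \<gamma> \<le> Max (L ` cls \<beta>)" using fin assms by auto
  have al: "F \<gamma> < F \<delta> + d1 \<and> L \<delta> < L \<gamma> + d1" if "\<delta> \<in> cls \<beta>" for \<delta>
    using rel_align[OF cls_rel[OF assms that]] by (simp add: align_def aligned_def)
  show "F \<gamma> < Min (F ` cls \<beta>) + d1" using al Min_in[OF fin(1,2)] by auto
  show "Max (L ` cls \<beta>) < L \<gamma> + d1" using al Max_in[OF fin(3,4)] by auto
qed

text \<open>A window that starts no later than the run contains its first time, since the run starts
  less than \<open>d1\<close> after the hull. Any later window starts inside the run, where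
  \<open>run_window\<close> applies.\<close>

lemma cls_dense:
  assumes "(e, u) \<in> cls \<beta>"
  shows "dense_in d1 (graph_of V S) e (Min (F ` cls \<beta>)) (Max (L ` cls \<beta>))"
  unfolding dense_in_def graph_of_simps
proof
  let ?a = "Min (F ` cls \<beta>)" and ?b = "Max (L ` cls \<beta>)"
  fix \<tau> assume \<tau>: "\<tau> \<in> {?a..max ?a (?b + 1 - d1)}"
  note run = cls_run[OF assms] and S = cls_S[OF assms]
  show "\<exists>t\<in>A e. \<tau> \<le> t \<and> t \<le> \<tau> + d1 - 1"
  proof (cases "\<tau> \<le> F (e, u)")
    case True
    then show ?thesis
      using F_mem[OF S] \<tau> run d1 by (intro bexI[of _ "F (e, u)"]) (auto simp: mem_A)
  next
    case False
    have "\<tau> \<le> L (e, u)" using False \<tau> run by (auto simp: max_def split: if_splits)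
    then have "\<exists>t\<in>A e. \<tau> \<le> t \<and> t < \<tau> + d1"
      using run_window[OF finite_A, of u e d1 \<tau>] S False by (simp add: F_def L_def mem_A)
    then show ?thesis by fastforce
  qed
qed

lemma cluster: "cluster_temporal_graph d1 d2 (graph_of V S)"
proof (rule cluster_if_cover[OF finite_S, of "template ` S"])
  show "X \<subseteq> V \<and> 1 \<le> a \<and> a \<le> b" if "(X, a, b) \<in> template ` S" for X a b
  proof -
    from that obtain \<beta> where \<beta>: "\<beta> \<in> S" and eq: "(X, a, b) = template \<beta>" by blast
    have fin: "finite (F ` cls \<beta>)" "F ` cls \<beta> \<noteq> {}"
      using finite_cls self_cls[OF \<beta>] by blast+
    have "X \<subseteq> V"
      using eq edge_verts[OF cls_S] unfolding template_def span_def prod.inject by blast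
    moreover have "1 \<le> F \<gamma>" if "\<gamma> \<in> cls \<beta>" for \<gamma>
      using S_sub F_mem[OF cls_S[OF that]] by auto
    then have "1 \<le> a" using eq Min_in[OF fin] by (auto simp: template_def)
    moreover have "a \<le> b"
      using eq cls_run[OF self_cls[OF \<beta>]] F_le_L[OF \<beta>] by (simp add: template_def)
    ultimately show ?thesis by blast
  qed
next
  fix p q assume "p \<in> template ` S" "q \<in> template ` S" "p \<noteq> q"
  then obtain \<beta> \<gamma> where g: "\<beta> \<in> S" "\<gamma> \<in> S" "p = template \<beta>" "q = template \<gamma>" by blast
  have ne: "cls \<beta> \<noteq> cls \<gamma>"
    using \<open>p \<noteq> q\<close> g(3,4) by (metis template_def)
  show "independent d2 p q"
  proof (rule ccontr)
    assume "\<not> independent d2 p q"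
    then obtain v s t where v: "v \<in> span (cls \<beta>)" "v \<in> span (cls \<gamma>)"
      and st: "Min (F ` cls \<beta>) \<le> s" "s \<le> Max (L ` cls \<beta>)" "Min (F ` cls \<gamma>) \<le> t"
        "t \<le> Max (L ` cls \<gamma>)" "\<not> int d2 \<le> \<bar>int s - int t\<bar>"
      by (auto simp: g template_def)
    have al: "align \<eta> \<theta>" if "\<eta> \<in> cls \<kappa>" "\<theta> \<in> cls \<kappa>" for \<kappa> \<eta> \<theta>
      using that rel_align cls_rel by blast
    have le: "F \<eta> \<le> L \<eta>" if "\<eta> \<in> cls \<kappa>" for \<kappa> \<eta>
      using that F_le_L cls_S by blast
    have nonempty: "cls \<beta> \<noteq> {}" "cls \<gamma> \<noteq> {}"
      using g(1,2) self_cls by blast+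
    have "Min (F ` cls \<beta>) < Max (L ` cls \<gamma>) + d2" "Min (F ` cls \<gamma>) < Max (L ` cls \<beta>) + d2"
      using st by linarith+
    from hull_near[OF al le al le finite_cls nonempty(1) finite_cls nonempty(2) this]
    have "\<exists>\<eta>\<in>cls \<beta>. \<exists>\<theta>\<in>cls \<gamma>. near d2 (F \<eta>) (L \<eta>) (F \<theta>) (L \<theta>)" .
    then show False using cls_merge v ne by blast
  qed
next
  fix e t assume S: "(e, t) \<in> S"
  then have c: "(e, t) \<in> cls (e, t)" by (rule self_cls)
  have "e \<subseteq> span (cls (e, t))" using c by (force simp: span_def)
  moreover have "Min (F ` cls (e, t)) \<le> t" "t \<le> Max (L ` cls (e, t))"
    using cls_run[OF c] F_le[OF S] L_ge[OF S] by auto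
  moreover have "template (e, t) \<in> template ` S" using S by (rule imageI)
  ultimately show "\<exists>X a b. (X, a, b) \<in> template ` S \<and> e \<subseteq> X \<and> a \<le> t \<and> t \<le> b"
    unfolding template_def[of "(e, t)"] by blast
next
  fix X a b x y assume "(X, a, b) \<in> template ` S" and xy: "x \<in> X" "y \<in> X" "x \<noteq> y"
  then obtain \<beta> where eq: "(X, a, b) = template \<beta>" by blast
  then obtain u where u: "({x, y}, u) \<in> cls \<beta>"
    using cls_span[of x \<beta> y] xy by (auto simp: template_def)
  show "dense_in d1 (graph_of V S) {x, y} a b"
    using cls_dense[OF u] eq by (simp add: template_def)
qed

end

lemma (in time_edge_set) cluster_iff:
  "cluster_temporal_graph d1 d2 (graph_of V S) \<longleftrightarrow> (\<forall>q p v r s. \<not> violated d1 d2 S q p v r s)"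
proof
  assume "\<forall>q p v r s. \<not> violated d1 d2 S q p v r s"
  then interpret no_violation V S d1 d2 by unfold_locales blast
  show "cluster_temporal_graph d1 d2 (graph_of V S)" by (rule cluster)
qed (use cluster_imp_not_violation in \<open>auto simp: violated_def\<close>)

section \<open>Restricting modifications to the lifetime\<close>

text \<open>
  Cutting the templates at time \<open>T\<close> can leave an edge without a time in a short final interval.
  Such an edge has an added time after \<open>T\<close>; adding the time \<open>T\<close> instead costs no more.
\<close>

lemma (in time_edge_set) cluster_until:
  assumes cluster: "cluster_temporal_graph d1 d2 (graph_of V S)"
    and fin: "finite S0" and S0: "S0 \<subseteq> vertex_pairs V \<times> {1..T}"
  shows "\<exists>S'. S' \<subseteq> vertex_pairs V \<times> {1..T} \<and> finite S' \<and>
    cluster_temporal_graph d1 d2 (graph_of V S') \<and> card (sym_diff S0 S') \<le> card (sym_diff S0 S)"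
proof -
  from cluster obtain C where C: "realises d1 d2 (graph_of V S) C"
    by (auto simp: cluster_temporal_graph_def)
  define cut where "cut = {e. \<exists>X a b. (X, a, b) \<in> C \<and> e \<subseteq> X \<and> card e = 2 \<and> a \<le> T \<and>
    (\<forall>t\<in>A e. \<not> (a \<le> t \<and> t \<le> T))}"
  define S' where "S' = {(e, t). (e, t) \<in> S \<and> t \<le> T} \<union> cut \<times> {T}"
  have cutD: "\<exists>X a b u. (X, a, b) \<in> C \<and> e \<subseteq> X \<and> card e = 2 \<and> 1 \<le> a \<and> a \<le> T \<and> T < u \<and> u \<le> b \<and>
      (e, u) \<in> S \<and> (\<forall>t\<in>A e. \<not> (a \<le> t \<and> t \<le> T))" if cut: "e \<in> cut" for e
  proof -
    from cut obtain X a b where X: "(X, a, b) \<in> C" "e \<subseteq> X" "card e = 2" "a \<le> T"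
      and none: "\<forall>t\<in>A e. \<not> (a \<le> t \<and> t \<le> T)" unfolding cut_def by blast
    obtain x y where xy: "x \<noteq> y" "e = {x, y}" using X(3) by (meson card_2_iff)
    have ab: "1 \<le> a" "a \<le> b" using realises_interval[OF C X(1)] by auto
    have "dense_in d1 (graph_of V S) e a b"
      using realises_dense[OF C X(1), of x y] xy X(2) by auto
    then obtain u where u: "u \<in> A e" "a \<le> u" "u \<le> a + d1 - 1"
      by (fastforce simp: dense_in_def)
    then have "(e, u) \<in> S" by (simp add: mem_A)
    then obtain Y c d where Y: "(Y, c, d) \<in> C" "e \<subseteq> Y" "c \<le> u" "u \<le> d"
      using realises_covers[OF C, of e u] by auto
    \<comment> \<open>The time \<open>u\<close> is at most \<open>d1 - 1\<close> after
      \<open>a\<close>, too close to \<open>a\<close> for an independent template to cover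
      it.\<close>
    have "(X, a, b) = (Y, c, d)"
      using X Y xy ab u d12 d1
      by (intro same_template[OF C X(1) Y(1), of x a a u u]) (auto simp: near_def)
    then have "u \<le> b" using Y by simp
    moreover have "T < u" using none u by force
    ultimately show ?thesis using X none ab \<open>(e, u) \<in> S\<close> by blast
  qed
  have cut_pairs: "cut \<subseteq> vertex_pairs V"
  proof
    fix e assume "e \<in> cut"
    then obtain u where "(e, u) \<in> S" using cutD by blast
    then show "e \<in> vertex_pairs V" using edge_vertex_pair by fastforce
  qed
  have sub: "S' \<subseteq> vertex_pairs V \<times> {1..T}"
    using S_sub cut_pairs cutD unfolding S'_def by fastforce
  have "cut \<subseteq> fst ` S" using cutD by force
  then have finS': "finite S'"
    unfolding S'_def using finite_S
    by (intro finite_UnI finite_cartesian_product) (auto intro: finite_subset[of _ S] finite_subset)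
  define C' where "C' = {(X, a, b'). \<exists>b. (X, a, b) \<in> C \<and> a \<le> T \<and> b' = min b T}"
  have "cluster_temporal_graph d1 d2 (graph_of V S')"
  proof (rule cluster_if_cover[OF finS', of C'])
    show "X \<subseteq> V \<and> 1 \<le> a \<and> a \<le> b" if "(X, a, b) \<in> C'" for X a b
      using that realises_interval[OF C] unfolding C'_def by fastforce
    show "independent d2 p q" if pq: "p \<in> C'" "q \<in> C'" "p \<noteq> q" for p q
    proof -
      obtain X a b Y c e where
        pq': "(X, a, b) \<in> C" "p = (X, a, min b T)" "(Y, c, e) \<in> C" "q = (Y, c, min e T)"
        using pq unfolding C'_def by blast
      then have "independent d2 (X, a, b) (Y, c, e)" using realises_independent[OF C] pq by blast
      then show ?thesis unfolding pq' by (rule independent_shrink) simp_all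
    qed
    show "\<exists>X a b. (X, a, b) \<in> C' \<and> e \<subseteq> X \<and> a \<le> t \<and> t \<le> b" if et: "(e, t) \<in> S'" for e t
    proof -
      obtain X a b where "(X, a, b) \<in> C" "e \<subseteq> X" "a \<le> t" "t \<le> b" "t \<le> T"
        using et realises_covers[OF C, of e t] cutD[of e] unfolding S'_def by fastforce
      moreover from this have "(X, a, min b T) \<in> C'" unfolding C'_def using order_trans by blast
      ultimately show ?thesis by (meson min.boundedI)
    qed
    show "dense_in d1 (graph_of V S') {x, y} a b'"
      if t: "(X, a, b') \<in> C'" and xy: "x \<in> X" "y \<in> X" "x \<noteq> y" for X a b' x y
      unfolding dense_in_def graph_of_simps
    proof
      fix \<tau> assume \<tau>: "\<tau> \<in> {a..max a (b' + 1 - d1)}"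
      obtain b where b: "(X, a, b) \<in> C" "a \<le> T" "b' = min b T" using t unfolding C'_def by auto
      have "dense_in d1 (graph_of V S) {x, y} a b'"
        using dense_in_shrink[OF realises_dense[OF C b(1) xy]] b(3) by simp
      then obtain t where t: "t \<in> A {x, y}" "\<tau> \<le> t" "t \<le> \<tau> + d1 - 1"
        using \<tau> unfolding dense_in_def graph_of_simps by blast
      show "\<exists>t\<in>edge_times S' {x, y}. \<tau> \<le> t \<and> t \<le> \<tau> + d1 - 1"
      proof (cases "t \<le> T")
        case True
        then show ?thesis using t by (auto simp: S'_def edge_times_def)
      next
        case False
        have "b' \<le> T" using b by simp
        \<comment> \<open>Windows that start after \<open>a\<close> end by \<open>b'\<close>, hence
          by \<open>T\<close>; only the first window can reach past \<open>T\<close>.\<close>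
        then have \<tau>a: "\<tau> = a" using \<tau> t False d1 by auto
        show ?thesis
        proof (cases "\<exists>u\<in>A {x, y}. a \<le> u \<and> u \<le> T")
          case True
          then obtain u where u: "u \<in> A {x, y}" "a \<le> u" "u \<le> T" by blast
          then have "u \<in> edge_times S' {x, y}" by (simp add: S'_def edge_times_def)
          moreover have "u \<le> \<tau> + d1 - 1" using u False t by linarith
          ultimately show ?thesis using u \<tau>a by blast
        next
          case none: False
          have "{x, y} \<in> cut"
            unfolding cut_def using none b xy by auto
          then have "T \<in> edge_times S' {x, y}" by (simp add: S'_def edge_times_def)
          \<comment> \<open>The window contains \<open>t > T\<close> and starts at
            \<open>a <= T\<close>, so the inserted time \<open>T\<close> lies in it.\<close>
          moreover have "T \<le> \<tau> + d1 - 1" using False t by linarith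
          ultimately show ?thesis using \<tau>a b by blast
        qed
      qed
    qed
  qed
  moreover have "card (sym_diff S0 S') \<le> card (sym_diff S0 S)"
  proof -
    define late where "late e = (SOME u. T < u \<and> (e, u) \<in> S)" for e
    have late: "T < late e \<and> (e, late e) \<in> S" if "e \<in> cut" for e
      unfolding late_def using cutD[OF that] by (metis (mono_tags, lifting) someI_ex)
    \<comment> \<open>Each inserted \<open>(e, T)\<close> is charged to a time-edge of
      \<open>S\<close> after \<open>T\<close>, which \<open>S0\<close> cannot contain; all other
      modifications are charged to themselves.\<close>
    define g where "g = (\<lambda>(e, t). if e \<in> cut \<and> t = T then (e, late e) else (e, t))"
    have "inj_on g (sym_diff S0 S')"
    proof (rule inj_onI)
      fix x y assume x: "x \<in> sym_diff S0 S'" and y: "y \<in> sym_diff S0 S'" and eq: "g x = g y"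
      have "snd x \<le> T" "snd y \<le> T" using x y sub S0 by auto
      then show "x = y"
        using eq late[of "fst x"] late[of "fst y"]
        by (cases x; cases y) (auto simp: g_def split: if_splits)
    qed
    moreover have "g ` sym_diff S0 S' \<subseteq> sym_diff S0 S"
    proof
      fix z assume "z \<in> g ` sym_diff S0 S'"
      then obtain e t where et: "(e, t) \<in> sym_diff S0 S'" "z = g (e, t)" by auto
      show "z \<in> sym_diff S0 S"
      proof (cases "e \<in> cut \<and> t = T")
        case True
        then have "(e, late e) \<notin> S0" using late[of e] S0 by auto
        then show ?thesis using True late[of e] et by (auto simp: g_def)
      next
        case False
        then have "t \<le> T" using et sub S0 by auto
        then show ?thesis using False et by (auto simp: g_def S'_def)
      qed
    qed
    ultimately show ?thesis
      using card_inj_on_le fin finite_S by (metis finite_Diff finite_UnI)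
  qed
  ultimately show ?thesis using sub finS' by blast
qed

text \<open>Stated for an arbitrary set with budget \<open>j\<close>, so that it also describes the
  nodes below the root of the branching.\<close>

definition fixable :: "'v set \<Rightarrow> nat \<Rightarrow> nat \<Rightarrow> nat \<Rightarrow> nat \<Rightarrow> ('v set \<times> nat) set \<Rightarrow> bool" where
  "fixable V T d1 d2 j S \<longleftrightarrow> (\<exists>\<Pi>. \<Pi> \<subseteq> vertex_pairs V \<times> {1..T} \<and> finite \<Pi> \<and> card \<Pi> \<le> j \<and>
     (\<forall>q p v r s. \<not> violated d1 d2 (sym_diff S \<Pi>) q p v r s))"

lemma time_edges_wf:
  assumes "wf_temporal_graph G"
  shows "finite (time_edges G)" "time_edges G \<subseteq> vertex_pairs (verts G) \<times> {1..lifetime G}"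
proof -
  have "finite (vertex_pairs (verts G))"
    using assms by (simp add: wf_temporal_graph_def vertex_pairs_def)
  then have "finite (Sigma (edges G) (times G))"
    using assms unfolding wf_temporal_graph_def by (intro finite_SigmaI) (auto intro: finite_subset)
  also have "Sigma (edges G) (times G) = time_edges G" by (auto simp: time_edges_def)
  finally show fin: "finite (time_edges G)" .
  have "t \<le> lifetime G" if "(e, t) \<in> time_edges G" for e t
    using lifetime_ge[OF fin that] .
  then show "time_edges G \<subseteq> vertex_pairs (verts G) \<times> {1..lifetime G}"
    using assms by (auto simp: wf_temporal_graph_def time_edges_def)
qed

lemma ETC_iff_fixable:
  assumes wf: "wf_temporal_graph G" and d: "1 \<le> d1" "d1 < d2"
  shows "ETC G k d1 d2 \<longleftrightarrow> fixable (verts G) (lifetime G) d1 d2 k (time_edges G)"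
proof
  let ?V = "verts G" and ?S = "time_edges G" and ?T = "lifetime G"
  note S = time_edges_wf[OF wf]
  {
    assume "ETC G k d1 d2"
    then obtain \<Pi> where \<Pi>: "\<Pi> \<subseteq> vertex_pairs ?V \<times> {1..}" "finite \<Pi>" "card \<Pi> \<le> k"
      and c: "cluster_temporal_graph d1 d2 (graph_of ?V (sym_diff ?S \<Pi>))"
      by (auto simp: ETC_def modify_eq_graph_of)
    interpret time_edge_set ?V "sym_diff ?S \<Pi>" d1 d2
      using S \<Pi> d by unfold_locales auto
    obtain S' where S': "S' \<subseteq> vertex_pairs ?V \<times> {1..?T}" "finite S'"
      "cluster_temporal_graph d1 d2 (graph_of ?V S')"
      "card (sym_diff ?S S') \<le> card (sym_diff ?S (sym_diff ?S \<Pi>))"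
      using cluster_until[OF c S] by blast
    \<comment> \<open>Symmetric difference with \<open>?S\<close> is an involution, so modification
      sets and resulting sets determine each other.\<close>
    have eq: "sym_diff ?S (sym_diff ?S X) = X" for X by blast
    interpret S': time_edge_set ?V S' d1 d2
      using S' d by unfold_locales auto
    show "fixable ?V ?T d1 d2 k ?S"
      unfolding fixable_def
    proof (intro exI[of _ "sym_diff ?S S'"] conjI)
      show "sym_diff ?S S' \<subseteq> vertex_pairs ?V \<times> {1..?T}" using S(2) S'(1) by blast
      show "finite (sym_diff ?S S')" using S(1) S'(2) by simp
      show "card (sym_diff ?S S') \<le> k" using S'(4) \<Pi>(3) unfolding eq by linarith
      show "\<forall>q p v r s. \<not> violated d1 d2 (sym_diff ?S (sym_diff ?S S')) q p v r s"
        using S'.cluster_iff S'(3) unfolding eq by blast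
    qed
  }
  {
    assume "fixable ?V ?T d1 d2 k ?S"
    then obtain \<Pi> where \<Pi>: "\<Pi> \<subseteq> vertex_pairs ?V \<times> {1..?T}" "finite \<Pi>" "card \<Pi> \<le> k"
      and v: "\<forall>q p v r s. \<not> violated d1 d2 (sym_diff ?S \<Pi>) q p v r s"
      by (auto simp: fixable_def)
    interpret time_edge_set ?V "sym_diff ?S \<Pi>" d1 d2
      using S \<Pi> d by unfold_locales auto
    have "cluster_temporal_graph d1 d2 (graph_of ?V (sym_diff ?S \<Pi>))"
      using cluster_iff v by blast
    then show "ETC G k d1 d2"
      unfolding ETC_def modify_eq_graph_of using \<Pi> by (intro exI[of _ \<Pi>]) auto
  }
qed

section \<open>Branching\<close>

text \<open>Polymorphic because it is applied both to vertices, in the branching argument, and to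
  their positions, as the machine does; index \<open>4\<close> is \<open>pr\<close>.\<close>

fun branch_pair :: "nat \<Rightarrow> 'a \<times> 'a \<times> 'a \<times> 'a \<times> 'a \<Rightarrow> 'a \<times> 'a" where
  "branch_pair i (q, p, v, r, s) =
     (if i = 0 then (q, p) else if i = 1 then (p, v) else if i = 2 then (v, r)
      else if i = 3 then (r, s) else (p, r))"

lemma violated_cong:
  assumes "violated d1 d2 S q p v r s"
    and "\<And>i x y. i < 5 \<Longrightarrow> branch_pair i (q, p, v, r, s) = (x, y) \<Longrightarrow>
      edge_times S {x, y} = edge_times S' {x, y}"
  shows "violated d1 d2 S' q p v r s"
proof -
  have "edge_times S {q, p} = edge_times S' {q, p}" "edge_times S {p, v} = edge_times S' {p, v}"
    "edge_times S {v, r} = edge_times S' {v, r}" "edge_times S {r, s} = edge_times S' {r, s}"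
    "edge_times S {p, r} = edge_times S' {p, r}"
    using assms(2)[of 0] assms(2)[of 1] assms(2)[of 2] assms(2)[of 3] assms(2)[of 4] by auto
  then show ?thesis using assms(1) by (simp add: violated_def violation_def)
qed

text \<open>A solution that avoids all five pairs would leave the violation in place. Moving one of
  its time-edges on these pairs into \<open>S\<close> leaves a solution with one modification
  less.\<close>

lemma fixable_branch:
  assumes viol: "violated d1 d2 S q p v r s" and fixbl: "fixable V T d1 d2 j S"
  shows "\<exists>i<5. \<exists>x y t. branch_pair i (q, p, v, r, s) = (x, y) \<and> {x, y} \<in> vertex_pairs V \<and>
    1 \<le> t \<and> t \<le> T \<and> 0 < j \<and> fixable V T d1 d2 (j - 1) (sym_diff S {({x, y}, t)})"
proof -
  from fixbl obtain \<Pi> where \<Pi>: "\<Pi> \<subseteq> vertex_pairs V \<times> {1..T}" "finite \<Pi>" "card \<Pi> \<le> j"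
    and v: "\<forall>q p v r s. \<not> violated d1 d2 (sym_diff S \<Pi>) q p v r s"
    by (auto simp: fixable_def)
  have "\<not> violated d1 d2 (sym_diff S \<Pi>) q p v r s" using v by blast
  then obtain i x y where i: "i < 5" "branch_pair i (q, p, v, r, s) = (x, y)"
    and "edge_times S {x, y} \<noteq> edge_times (sym_diff S \<Pi>) {x, y}"
    using violated_cong[OF viol] by meson
  then obtain t where t: "({x, y}, t) \<in> \<Pi>" by (auto simp: edge_times_def)
  have "0 < j" using t \<Pi>(2,3) by (metis card_gt_0_iff empty_iff le_zero_eq neq0_conv)
  let ?\<Pi> = "\<Pi> - {({x, y}, t)}"
  have eq: "sym_diff (sym_diff S {({x, y}, t)}) ?\<Pi> = sym_diff S \<Pi>" using t by blast
  have "card ?\<Pi> \<le> j - 1" using \<Pi>(2,3) t by simp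
  then have "fixable V T d1 d2 (j - 1) (sym_diff S {({x, y}, t)})"
    unfolding fixable_def using \<Pi> v by (intro exI[of _ ?\<Pi>]) (auto simp only: eq)
  moreover have "{x, y} \<in> vertex_pairs V" "1 \<le> t" "t \<le> T" using t \<Pi>(1) by auto
  ultimately show ?thesis using i \<open>0 < j\<close> by blast
qed

text \<open>A digit \<open>d < 5 * T\<close> encodes the pair \<open>d div T\<close> and the time
  \<open>d mod T + 1\<close>. On walks with repeated vertices a pair may degenerate to
  \<open>x = y\<close>, which is no edge; that branch does nothing.\<close>

definition flip ::
  "'v list \<Rightarrow> nat \<Rightarrow> ('v set \<times> nat) set \<Rightarrow> nat \<times> nat \<times> nat \<times> nat \<times> nat \<Rightarrow> nat \<Rightarrow> ('v set \<times> nat) set"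
where
  "flip vs T S z d = (case branch_pair (d div T) z of (x, y) \<Rightarrow>
     if x = y then S else sym_diff S {({vs ! x, vs ! y}, d mod T + 1)})"

text \<open>All that correctness asks of the search. \<open>pick_None\<close> is restricted to times
  up to \<open>T\<close> because the search only tries those.\<close>

locale branching =
  fixes vs :: "'v list" and T d1 d2 :: nat
    and pick :: "('v set \<times> nat) set \<Rightarrow> (nat \<times> nat \<times> nat \<times> nat \<times> nat) option"
  assumes distinct_vs: "distinct vs" and T: "1 \<le> T"
    and pick_None: "\<And>S. S \<subseteq> vertex_pairs (set vs) \<times> {1..T} \<Longrightarrow> pick S = None \<Longrightarrow>
      \<not> violated d1 d2 S q p v r s"
    and pick_Some: "\<And>S i1 i2 i3 i4 i5. pick S = Some (i1, i2, i3, i4, i5) \<Longrightarrow>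
      i1 < length vs \<and> i2 < length vs \<and> i3 < length vs \<and> i4 < length vs \<and> i5 < length vs \<and>
      violated d1 d2 S (vs ! i1) (vs ! i2) (vs ! i3) (vs ! i4) (vs ! i5)"
begin

definition step :: "('v set \<times> nat) set \<Rightarrow> nat \<Rightarrow> ('v set \<times> nat) set" where
  "step S d = (case pick S of None \<Rightarrow> S | Some z \<Rightarrow> flip vs T S z d)"

text \<open>A root-to-leaf path of the branching tree, selected by a digit sequence fixed in
  advance, so that a counter can enumerate the paths.\<close>

fun steps :: "('v set \<times> nat) set \<Rightarrow> (nat \<Rightarrow> nat) \<Rightarrow> nat \<Rightarrow> ('v set \<times> nat) set" where
  "steps S \<sigma> 0 = S"
| "steps S \<sigma> (Suc i) = step (steps S \<sigma> i) (\<sigma> i)"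

lemma steps_shift: "steps S \<sigma> (Suc i) = steps (step S (\<sigma> 0)) (\<lambda>j. \<sigma> (Suc j)) i"
  by (induction i) auto

lemma steps_cong: "(\<And>j. j < i \<Longrightarrow> \<sigma> j = \<sigma>' j) \<Longrightarrow> steps S \<sigma> i = steps S \<sigma>' i"
  by (induction i) auto

lemma step_sym_diff:
  "\<exists>\<Pi>. \<Pi> \<subseteq> vertex_pairs (set vs) \<times> {1..T} \<and> finite \<Pi> \<and> card \<Pi> \<le> 1 \<and> step S d = sym_diff S \<Pi>"
proof (cases "pick S")
  case None
  then show ?thesis by (intro exI[of _ "{}"]) (simp add: step_def)
next
  case (Some z)
  obtain i1 i2 i3 i4 i5 where z: "z = (i1, i2, i3, i4, i5)" by (cases z)
  obtain x y where xy: "branch_pair (d div T) z = (x, y)" by fastforce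
  have "x < length vs \<and> y < length vs"
    using pick_Some[OF Some[unfolded z]] xy by (auto simp: z split: if_splits)
  then have "{vs ! x, vs ! y} \<in> vertex_pairs (set vs)" if "x \<noteq> y"
    using that distinct_vs by (simp add: vertex_pairs_def nth_eq_iff_index_eq)
  moreover have "d mod T < T" using T by simp
  ultimately show ?thesis
    using Some xy
    by (intro exI[of _ "if x = y then {} else {({vs ! x, vs ! y}, d mod T + 1)}"])
      (auto simp: step_def flip_def)
qed

lemma step_sub:
  "S \<subseteq> vertex_pairs (set vs) \<times> {1..T} \<Longrightarrow> step S d \<subseteq> vertex_pairs (set vs) \<times> {1..T}"
  using step_sym_diff[of S d] by blast

lemma steps_sub:
  "S \<subseteq> vertex_pairs (set vs) \<times> {1..T} \<Longrightarrow> steps S \<sigma> i \<subseteq> vertex_pairs (set vs) \<times> {1..T}"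
  by (induction i) (simp_all only: steps.simps step_sub)

text \<open>Soundness of a replay: toggles may repeat and cancel, so \<open>i\<close> steps amount
  to at most \<open>i\<close> modifications.\<close>

lemma steps_sym_diff:
  "\<exists>\<Pi>. \<Pi> \<subseteq> vertex_pairs (set vs) \<times> {1..T} \<and> finite \<Pi> \<and> card \<Pi> \<le> i \<and> steps S \<sigma> i = sym_diff S \<Pi>"
proof (induction i)
  case 0
  then show ?case by (intro exI[of _ "{}"]) simp
next
  case (Suc i)
  then obtain \<Pi> where \<Pi>: "\<Pi> \<subseteq> vertex_pairs (set vs) \<times> {1..T}" "finite \<Pi>" "card \<Pi> \<le> i"
    "steps S \<sigma> i = sym_diff S \<Pi>" by blast
  obtain \<Theta> where \<Theta>: "\<Theta> \<subseteq> vertex_pairs (set vs) \<times> {1..T}" "finite \<Theta>" "card \<Theta> \<le> 1"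
    "step (steps S \<sigma> i) (\<sigma> i) = sym_diff (steps S \<sigma> i) \<Theta>"
    using step_sym_diff[of "steps S \<sigma> i" "\<sigma> i"] by blast
  have "sym_diff \<Pi> \<Theta> \<subseteq> vertex_pairs (set vs) \<times> {1..T}" using \<Pi>(1) \<Theta>(1) by blast
  moreover have "card (sym_diff \<Pi> \<Theta>) \<le> card (\<Pi> \<union> \<Theta>)"
    using \<Pi>(2) \<Theta>(2) by (intro card_mono) auto
  then have "card (sym_diff \<Pi> \<Theta>) \<le> Suc i" using card_Un_le[of \<Pi> \<Theta>] \<Pi>(3) \<Theta>(3) by linarith
  moreover have "steps S \<sigma> (Suc i) = sym_diff S (sym_diff \<Pi> \<Theta>)"
  proof -
    have "steps S \<sigma> (Suc i) = sym_diff (steps S \<sigma> i) \<Theta>" using \<Theta>(4) by (simp only: steps.simps)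
    then show ?thesis unfolding \<Pi>(4) by blast
  qed
  moreover have "finite (sym_diff \<Pi> \<Theta>)" using \<Pi>(2) \<Theta>(2) by simp
  ultimately show ?case by blast
qed

text \<open>Completeness: the digits follow a solution, and each digit uses up one of its
  modifications.\<close>

lemma fixable_imp_steps:
  assumes "fixable (set vs) T d1 d2 j S" "S \<subseteq> vertex_pairs (set vs) \<times> {1..T}"
  shows "\<exists>\<sigma>. (\<forall>i. \<sigma> i < 5 * T) \<and> (\<exists>i\<le>j. pick (steps S \<sigma> i) = None)"
  using assms
proof (induction j arbitrary: S)
  case 0
  have "pick S = None"
  proof (rule ccontr)
    assume "pick S \<noteq> None"
    then obtain i1 i2 i3 i4 i5 where "pick S = Some (i1, i2, i3, i4, i5)" by auto
    then show False using fixable_branch[OF _ 0(1)] pick_Some by blast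
  qed
  then show ?case using T by (intro exI[of _ "\<lambda>_. 0"]) auto
next
  case (Suc j)
  show ?case
  proof (cases "pick S")
    case None
    then show ?thesis
      using T by (intro exI[of _ "\<lambda>_. 0"] conjI exI[of _ 0]) auto
  next
    case (Some z)
    obtain i1 i2 i3 i4 i5 where z: "z = (i1, i2, i3, i4, i5)" by (cases z)
    note viol = pick_Some[OF Some[unfolded z]]
    obtain i x y t where i: "i < 5"
      and xy: "branch_pair i (vs ! i1, vs ! i2, vs ! i3, vs ! i4, vs ! i5) = (x, y)"
        "{x, y} \<in> vertex_pairs (set vs)" and t: "1 \<le> t" "t \<le> T"
      and f: "fixable (set vs) T d1 d2 j (sym_diff S {({x, y}, t)})"
      using fixable_branch[of d1 d2 S "vs ! i1" "vs ! i2" "vs ! i3" "vs ! i4" "vs ! i5"] viol Suc.prems(1)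
      by (metis diff_Suc_1)
    \<comment> \<open>The inverse of the decoding in \<open>flip\<close>; times start at
      \<open>1\<close>, remainders at \<open>0\<close>.\<close>
    define d where "d = i * T + (t - 1)"
    obtain t0 where t0: "t = Suc t0" "t0 < T" using t by (cases t) auto
    have d: "d div T = i" "d mod T + 1 = t" using t0 unfolding d_def by simp_all
    obtain a b where ab: "branch_pair i z = (a, b)" by fastforce
    have "vs ! a = x" "vs ! b = y" using xy(1) ab by (auto simp: z split: if_splits)
    moreover have "x \<noteq> y" using xy(2) by (auto simp: vertex_pairs_def)
    ultimately have st: "step S d = sym_diff S {({x, y}, t)}"
      using Some ab d by (auto simp: step_def flip_def)
    have "fixable (set vs) T d1 d2 j (step S d)" using f unfolding st .
    from Suc.IH[OF this step_sub[OF Suc.prems(2)]]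
    obtain \<sigma> l where \<sigma>: "\<forall>i. \<sigma> i < 5 * T" "l \<le> j" "pick (steps (step S d) \<sigma> l) = None" by blast
    define \<sigma>' where "\<sigma>' = (\<lambda>i. case i of 0 \<Rightarrow> d | Suc i \<Rightarrow> \<sigma> i)"
    have "d < (i + 1) * T" unfolding d_def using t by simp
    also have "\<dots> \<le> 5 * T" using i by (intro mult_le_mono1) simp
    finally have "\<forall>i. \<sigma>' i < 5 * T" using \<sigma>(1) by (simp add: \<sigma>'_def split: nat.split)
    moreover have "steps S \<sigma>' (Suc l) = steps (step S d) \<sigma> l"
      unfolding steps_shift by (simp add: \<sigma>'_def)
    then have "pick (steps S \<sigma>' (Suc l)) = None" using \<sigma>(3) by metis
    ultimately show ?thesis using \<sigma>(2) by (intro exI[of _ \<sigma>']) (auto simp del: steps.simps)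
  qed
qed

lemma fixable_iff_steps:
  assumes "S \<subseteq> vertex_pairs (set vs) \<times> {1..T}"
  shows "fixable (set vs) T d1 d2 k S \<longleftrightarrow>
    (\<exists>\<sigma>. (\<forall>i<k. \<sigma> i < 5 * T) \<and> (\<exists>i\<le>k. pick (steps S \<sigma> i) = None))"
proof
  assume "\<exists>\<sigma>. (\<forall>i<k. \<sigma> i < 5 * T) \<and> (\<exists>i\<le>k. pick (steps S \<sigma> i) = None)"
  then obtain \<sigma> i where i: "i \<le> k" "pick (steps S \<sigma> i) = None" by blast
  obtain \<Pi> where \<Pi>: "\<Pi> \<subseteq> vertex_pairs (set vs) \<times> {1..T}" "finite \<Pi>" "card \<Pi> \<le> i"
    "steps S \<sigma> i = sym_diff S \<Pi>" using steps_sym_diff[where S = S and \<sigma> = \<sigma> and i = i] by blast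
  have "\<not> violated d1 d2 (sym_diff S \<Pi>) q p v r s" for q p v r s
    using pick_None[OF steps_sub[OF assms] i(2)] unfolding \<Pi>(4) .
  moreover have "card \<Pi> \<le> k" using \<Pi>(3) i(1) by simp
  ultimately show "fixable (set vs) T d1 d2 k S"
    unfolding fixable_def by (intro exI[of _ \<Pi>] conjI allI \<Pi>(1,2))
qed (use fixable_imp_steps[OF _ assms] in blast)

end

section \<open>Searching for a violation\<close>

text \<open>A selector overwrites its argument with some element of \<open>X\<close>, unless \<open>X\<close> is empty.\<close>

definition selects :: "'a set \<Rightarrow> ('a option \<Rightarrow> 'a option) \<Rightarrow> bool" where
  "selects X f \<longleftrightarrow> (X = {} \<and> (\<forall>a. f a = a)) \<or> (\<exists>z\<in>X. \<forall>a. f a = Some z)"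

lemma selects_fold:
  assumes "\<And>i. i \<in> set is \<Longrightarrow> selects (X i) (f i)"
  shows "selects (\<Union>i\<in>set is. X i) (fold f is)"
  using assms
proof (induction "is" rule: rev_induct)
  case Nil
  then show ?case by (simp add: selects_def)
next
  case (snoc i "is")
  then have "selects (\<Union>i\<in>set is. X i) (fold f is)" "selects (X i) (f i)" by simp_all
  then show ?case by (auto simp: selects_def)
qed

definition test :: "nat \<Rightarrow> nat \<Rightarrow> ('v set \<times> nat) set \<Rightarrow> 'v list \<Rightarrow>
  nat \<Rightarrow> nat \<Rightarrow> nat \<Rightarrow> nat \<Rightarrow> nat \<Rightarrow> nat \<Rightarrow> nat \<Rightarrow>
  (nat \<times> nat \<times> nat \<times> nat \<times> nat) option \<Rightarrow> (nat \<times> nat \<times> nat \<times> nat \<times> nat) option" where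
  "test d1 d2 S vs q p v r s t t' a =
     (if violation d1 d2 S (vs ! q) (vs ! p) (vs ! v) (vs ! r) (vs ! s) t t'
      then Some (q, p, v, r, s) else a)"

definition ticks :: "nat \<Rightarrow> nat list" where
  "ticks T = [1..<Suc T]"

lemma set_ticks [simp]: "set (ticks T) = {1..T}"
  by (auto simp: ticks_def)

text \<open>The search keeps the last hit instead of stopping at the first one, which matches
  machine loops that always run to their end.\<close>

definition search :: "nat \<Rightarrow> nat \<Rightarrow> ('v set \<times> nat) set \<Rightarrow> 'v list \<Rightarrow> nat \<Rightarrow>
  (nat \<times> nat \<times> nat \<times> nat \<times> nat) option \<Rightarrow> (nat \<times> nat \<times> nat \<times> nat \<times> nat) option" where
  "search d1 d2 S vs T =
     fold (\<lambda>q. fold (\<lambda>p. fold (\<lambda>v. fold (\<lambda>r. fold (\<lambda>s.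
       fold (\<lambda>t. fold (\<lambda>t'. test d1 d2 S vs q p v r s t t') (ticks T)) (ticks T))
     [0..<length vs]) [0..<length vs]) [0..<length vs]) [0..<length vs]) [0..<length vs]"

lemma search_selects:
  "selects (\<Union>q\<in>set [0..<length vs]. \<Union>p\<in>set [0..<length vs]. \<Union>v\<in>set [0..<length vs].
     \<Union>r\<in>set [0..<length vs]. \<Union>s\<in>set [0..<length vs]. \<Union>t\<in>set (ticks T). \<Union>t'\<in>set (ticks T).
       {z. z = (q, p, v, r, s) \<and> violation d1 d2 S (vs ! q) (vs ! p) (vs ! v) (vs ! r) (vs ! s) t t'})
     (search d1 d2 S vs T)"
  unfolding search_def
  by (intro selects_fold) (auto simp: selects_def test_def)

text \<open>\<open>linked\<close> requires a time on \<open>pv\<close>, so \<open>v\<close> is a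
  vertex too. This makes loops over vertex positions and times up to \<open>T\<close>
  exhaustive.\<close>

lemma violation_verts:
  assumes "violation d1 d2 S q p v r s t t'" "S \<subseteq> vertex_pairs V \<times> {1..T}"
  shows "{q, p, v, r, s} \<subseteq> V" "t \<in> {1..T}" "t' \<in> {1..T}"
proof -
  have "t \<in> edge_times S {q, p}" "t' \<in> edge_times S {r, s}" "\<exists>u. u \<in> edge_times S {p, v}"
    using assms(1) by (auto simp: violation_def linked_def Let_def)
  then show "{q, p, v, r, s} \<subseteq> V" "t \<in> {1..T}" "t' \<in> {1..T}"
    using assms(2) by (auto simp: edge_times_def vertex_pairs_def)
qed

lemma branching_search:
  assumes "distinct vs" "1 \<le> T"
  shows "branching vs T d1 d2 (\<lambda>S. search d1 d2 S vs T None)"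
proof
  fix S q p v r s
  assume S: "S \<subseteq> vertex_pairs (set vs) \<times> {1..T}" and none: "search d1 d2 S vs T None = None"
  show "\<not> violated d1 d2 S q p v r s"
  proof
    assume "violated d1 d2 S q p v r s"
    then obtain t t' where viol: "violation d1 d2 S q p v r s t t'" by (auto simp: violated_def)
    note V = violation_verts[OF viol S]
    then obtain i1 i2 i3 i4 i5 where
      "i1 < length vs" "i2 < length vs" "i3 < length vs" "i4 < length vs" "i5 < length vs"
      "q = vs ! i1" "p = vs ! i2" "v = vs ! i3" "r = vs ! i4" "s = vs ! i5"
      by (metis in_set_conv_nth insert_subset)
    moreover have "t \<in> set (ticks T)" "t' \<in> set (ticks T)" using V by auto
    ultimately show False
      using search_selects[where vs = vs and T = T and ?d1.0 = d1 and ?d2.0 = d2 and S = S] none viol unfolding selects_def by fastforce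
  qed
next
  fix S i1 i2 i3 i4 i5
  assume some: "search d1 d2 S vs T None = Some (i1, i2, i3, i4, i5)"
  then show "i1 < length vs \<and> i2 < length vs \<and> i3 < length vs \<and> i4 < length vs \<and> i5 < length vs \<and>
    violated d1 d2 S (vs ! i1) (vs ! i2) (vs ! i3) (vs ! i4) (vs ! i5)"
    using search_selects[where vs = vs and T = T and ?d1.0 = d1 and ?d2.0 = d2 and S = S] unfolding selects_def violated_def by fastforce
qed (use assms in auto)

section \<open>Reasoning about machine programs\<close>

text \<open>A weakest precondition for total correctness; the step count is an argument of the
  postcondition, so result and running time are proved together.\<close>

definition ends :: "ram \<Rightarrow> ram_state \<Rightarrow> (nat \<Rightarrow> ram_state \<Rightarrow> bool) \<Rightarrow> bool" where
  "ends p s Q \<longleftrightarrow> (\<exists>m s'. exec p s m s' \<and> Q m s')"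

inductive_cases exec_elims:
  "exec Skip s m s'" "exec (Const r c) s m s'" "exec (Add r i j) s m s'" "exec (Sub r i j) s m s'"
  "exec (Load r i) s m s'" "exec (Store i j) s m s'" "exec (Seq p q) s m s'"
  "exec (IfLess i j p q) s m s'" "exec (WhileLess i j p) s m s'"

lemma ends_Skip: "ends Skip s Q \<longleftrightarrow> Q 1 s"
  unfolding ends_def
proof
  show "\<exists>m s'. exec Skip s m s' \<and> Q m s'" if "Q 1 s"
    using that exec.Skip by blast
qed (auto elim!: exec_elims(1))

lemma ends_Const: "ends (Const r c) (R, M) Q \<longleftrightarrow> Q 1 (R(r := c), M)"
  unfolding ends_def
proof
  show "\<exists>m s'. exec (Const r c) (R, M) m s' \<and> Q m s'" if "Q 1 (R(r := c), M)"
    using that exec.Const by blast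
qed (auto elim!: exec_elims(2))

lemma ends_Add: "ends (Add r i j) (R, M) Q \<longleftrightarrow> Q 1 (R(r := R i + R j), M)"
  unfolding ends_def
proof
  show "\<exists>m s'. exec (Add r i j) (R, M) m s' \<and> Q m s'" if "Q 1 (R(r := R i + R j), M)"
    using that exec.Add by blast
qed (auto elim!: exec_elims(3))

lemma ends_Sub: "ends (Sub r i j) (R, M) Q \<longleftrightarrow> Q 1 (R(r := R i - R j), M)"
  unfolding ends_def
proof
  show "\<exists>m s'. exec (Sub r i j) (R, M) m s' \<and> Q m s'" if "Q 1 (R(r := R i - R j), M)"
    using that exec.Sub by blast
qed (auto elim!: exec_elims(4))

lemma ends_Load: "ends (Load r i) (R, M) Q \<longleftrightarrow> Q 1 (R(r := M (R i)), M)"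
  unfolding ends_def
proof
  show "\<exists>m s'. exec (Load r i) (R, M) m s' \<and> Q m s'" if "Q 1 (R(r := M (R i)), M)"
    using that exec.Load by blast
qed (auto elim!: exec_elims(5))

lemma ends_Store: "ends (Store i j) (R, M) Q \<longleftrightarrow> Q 1 (R, M(R i := R j))"
  unfolding ends_def
proof
  show "\<exists>m s'. exec (Store i j) (R, M) m s' \<and> Q m s'" if "Q 1 (R, M(R i := R j))"
    using that exec.Store by blast
qed (auto elim!: exec_elims(6))

lemma ends_IfLess: "ends (IfLess i j p q) (R, M) Q \<longleftrightarrow>
    (if R i < R j then ends p (R, M) (\<lambda>m. Q (Suc m)) else ends q (R, M) (\<lambda>m. Q (Suc m)))"
proof (cases "R i < R j")
  case True
  then show ?thesis
    unfolding ends_def using exec.IfTrue[of "(R, M)" i j] by (auto elim!: exec_elims(8)) blast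
next
  case False
  then show ?thesis
    unfolding ends_def using exec.IfFalse[of "(R, M)" i j] by (auto elim!: exec_elims(8)) blast
qed

lemmas ends_simps = ends_Skip ends_Const ends_Add ends_Sub ends_Load ends_Store ends_IfLess

lemma ends_Seq:
  "ends (Seq p q) s Q \<longleftrightarrow> ends p s (\<lambda>m s'. ends q s' (\<lambda>k. Q (m + k)))"
  unfolding ends_def by (fast intro: exec.Seq elim!: exec_elims)

lemma ends_mono: "ends p s P \<Longrightarrow> (\<And>m s'. P m s' \<Longrightarrow> Q m s') \<Longrightarrow> ends p s Q"
  unfolding ends_def by blast

lemma ends_SeqI:
  assumes "ends p s P" "\<And>m s'. P m s' \<Longrightarrow> ends q s' (\<lambda>k. Q (m + k))"
  shows "ends (Seq p q) s Q"
  unfolding ends_Seq using assms by (rule ends_mono)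

lemma ends_exec_Seq: "exec p s m s' \<Longrightarrow> ends q s' (\<lambda>k. Q (m + k)) \<Longrightarrow> ends (Seq p q) s Q"
  unfolding ends_def using exec.Seq by blast

lemma endsE:
  assumes "ends p (R, M) (\<lambda>m (R', M'). m \<le> c \<and> M' = N \<and> P R')"
  obtains m R' where "exec p (R, M) m (R', N)" "m \<le> c" "P R'"
  using assms unfolding ends_def by auto

text \<open>Exactly \<open>N\<close> iterations, each costing a test and at most \<open>c\<close>
  steps, plus the final failing test. The proof is by induction on the number of iterations still to
  come.\<close>

lemma ends_WhileLess:
  assumes "I 0 s"
    and body: "\<And>i s. i < N \<Longrightarrow> I i s \<Longrightarrow>
      fst s a < fst s b \<and> ends p s (\<lambda>m s'. m \<le> c \<and> I (Suc i) s')"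
    and final: "\<And>s. I N s \<Longrightarrow> \<not> fst s a < fst s b"
  shows "ends (WhileLess a b p) s (\<lambda>m s'. m \<le> N * (c + 1) + 1 \<and> I N s')"
proof -
  have "ends (WhileLess a b p) s (\<lambda>m s'. m \<le> j * (c + 1) + 1 \<and> I N s')"
    if "I (N - j) s" "j \<le> N" for j s
    using that
  proof (induction j arbitrary: s)
    case 0
    then have "I N s" by simp
    then have "exec (WhileLess a b p) s 1 s" by (intro exec.WhileFalse final)
    then show ?case using \<open>I N s\<close> unfolding ends_def by (intro exI[of _ 1] exI[of _ s]) simp
  next
    case (Suc j)
    then obtain m s1 where m: "fst s a < fst s b" "exec p s m s1" "m \<le> c" "I (Suc (N - Suc j)) s1"
      using body[of "N - Suc j" s] Suc.prems(1) unfolding ends_def by (metis Suc.prems(2) diff_less less_le_trans zero_less_Suc)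
    have "Suc (N - Suc j) = N - j" using Suc.prems by simp
    then obtain k s2 where k: "exec (WhileLess a b p) s1 k s2" "k \<le> j * (c + 1) + 1" "I N s2"
      using Suc.IH[of s1] m(4) Suc.prems(2) unfolding ends_def by (metis Suc_leD)
    have "exec (WhileLess a b p) s (Suc (m + k)) s2"
      using m(1,2) k(1) by (rule exec.WhileTrue)
    moreover have "Suc (m + k) \<le> Suc j * (c + 1) + 1" using m(3) k(2) by simp
    ultimately show ?case
      using k(3) unfolding ends_def by (intro exI[of _ "Suc (m + k)"] exI[of _ s2]) simp
  qed
  from this[of N s] show ?thesis using assms(1) by simp
qed

text \<open>
  Register conventions: \<open>1\<close> and \<open>2\<close> hold the constants one and zero, \<open>3\<close> the lifetime \<open>T\<close>,
  \<open>4\<close> the row length \<open>T + 1\<close> and \<open>5\<close> the size \<open>n (T + 1)\<close> of a plane of the time table, which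
  starts at the address in \<open>8\<close>; \<open>6\<close> and \<open>7\<close> hold the two distances. A vertex \<open>x\<close> is kept in two
  consecutive registers as its multiples \<open>x (T + 1)\<close> and \<open>x n (T + 1)\<close>, so that no
  multiplication is needed to address the table. A loop over register \<open>t\<close> preserves all
  registers below \<open>t\<close>.
\<close>

definition tloop :: "nat \<Rightarrow> ram \<Rightarrow> ram" where
  "tloop t p = Seq (Const t 1) (WhileLess t 4 (Seq p (Add t t 1)))"

definition vloop :: "nat \<Rightarrow> ram \<Rightarrow> ram" where
  "vloop x p = Seq (Const x 0) (Seq (Const (Suc x) 0)
     (WhileLess x 5 (Seq p (Seq (Add x x 4) (Add (Suc x) (Suc x) 5)))))"

text \<open>Ties the loop to \<open>fold\<close>: \<open>A acc R\<close> says that the registers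
  represent the abstract accumulator. Increment and test add \<open>2\<close> to each pass,
  initialisation and last test add \<open>2\<close> overall.\<close>

lemma tloop:
  assumes t: "4 < t" and R: "R 1 = 1" "R 4 = Suc T" and A: "A acc R"
    and stable: "\<And>acc R v. A acc R \<Longrightarrow> A acc (R(t := v))"
    and body: "\<And>i R' acc. 1 \<le> i \<Longrightarrow> i \<le> T \<Longrightarrow> \<forall>r<t. R' r = R r \<Longrightarrow> R' t = i \<Longrightarrow> A acc R' \<Longrightarrow>
      ends p (R', M) (\<lambda>m (R'', M'). m \<le> c \<and> M' = M \<and> (\<forall>r<Suc t. R'' r = R' r) \<and> A (f i acc) R'')"
  shows "ends (tloop t p) (R, M) (\<lambda>m (R', M'). m \<le> T * (c + 2) + 2 \<and> M' = M \<and>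
    (\<forall>r<t. R' r = R r) \<and> A (fold f (ticks T) acc) R')"
proof -
  let ?I = "\<lambda>i (R', M'). M' = M \<and> (\<forall>r<t. R' r = R r) \<and> R' t = Suc i \<and>
    A (fold f [1..<Suc i] acc) R'"
  have "ends (WhileLess t 4 (Seq p (Add t t 1))) (R(t := 1), M)
    (\<lambda>m s'. m \<le> T * ((c + 1) + 1) + 1 \<and> ?I T s')"
  proof (rule ends_WhileLess[where I = ?I])
    show "?I 0 (R(t := 1), M)" using A stable by simp
    show "fst s t < fst s 4 \<and> ends (Seq p (Add t t 1)) s (\<lambda>m s'. m \<le> c + 1 \<and> ?I (Suc i) s')"
      if i: "i < T" and I: "?I i s" for i s
    proof -
      obtain R' M' where s: "s = (R', M')" by (cases s)
      have R': "\<forall>r<t. R' r = R r" "R' t = Suc i" "A (fold f [1..<Suc i] acc) R'" "M' = M"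
        using I by (simp_all add: s)
      have "ends p (R', M) (\<lambda>m (R'', M'). m \<le> c \<and> M' = M \<and> (\<forall>r<Suc t. R'' r = R' r) \<and>
          A (f (Suc i) (fold f [1..<Suc i] acc)) R'')"
        using body[of "Suc i" R'] i R' by simp
      then have "ends (Seq p (Add t t 1)) s (\<lambda>m s'. m \<le> c + 1 \<and> ?I (Suc i) s')"
        unfolding s R'(4)
        by (rule ends_SeqI) (use R' R t stable in \<open>auto simp: ends_simps\<close>)
      moreover have "R' t < R' 4" using R' R t i by simp
      ultimately show ?thesis by (simp add: s)
    qed
    show "\<not> fst s t < fst s 4" if "?I T s" for s
      using that R t by (cases s) auto
  qed
  then show ?thesis
    unfolding tloop_def ends_Seq ends_simps ticks_def
    by (rule ends_mono) (auto simp: algebra_simps)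
qed

lemma vloop:
  assumes x: "5 < x" and R: "R 4 = Suc T" "R 5 = n * Suc T" and A: "A acc R"
    and stable: "\<And>acc R v. A acc R \<Longrightarrow> A acc (R(x := v))" "\<And>acc R v. A acc R \<Longrightarrow> A acc (R(Suc x := v))"
    and body: "\<And>i R' acc. i < n \<Longrightarrow> \<forall>r<x. R' r = R r \<Longrightarrow> R' x = i * Suc T \<Longrightarrow>
      R' (Suc x) = i * (n * Suc T) \<Longrightarrow> A acc R' \<Longrightarrow>
      ends p (R', M) (\<lambda>m (R'', M'). m \<le> c \<and> M' = M \<and> (\<forall>r<Suc (Suc x). R'' r = R' r) \<and> A (f i acc) R'')"
  shows "ends (vloop x p) (R, M) (\<lambda>m (R', M'). m \<le> n * (c + 3) + 3 \<and> M' = M \<and>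
    (\<forall>r<x. R' r = R r) \<and> A (fold f [0..<n] acc) R')"
proof -
  let ?I = "\<lambda>i (R', M'). M' = M \<and> (\<forall>r<x. R' r = R r) \<and> R' x = i * Suc T \<and>
    R' (Suc x) = i * (n * Suc T) \<and> A (fold f [0..<i] acc) R'"
  have "ends (WhileLess x 5 (Seq p (Seq (Add x x 4) (Add (Suc x) (Suc x) 5)))) (R(x := 0, Suc x := 0), M)
    (\<lambda>m s'. m \<le> n * ((c + 2) + 1) + 1 \<and> ?I n s')"
  proof (rule ends_WhileLess[where I = ?I])
    show "?I 0 (R(x := 0, Suc x := 0), M)" using A stable by simp
    show "fst s x < fst s 5 \<and> ends (Seq p (Seq (Add x x 4) (Add (Suc x) (Suc x) 5))) s
        (\<lambda>m s'. m \<le> c + 2 \<and> ?I (Suc i) s')"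
      if i: "i < n" and I: "?I i s" for i s
    proof -
      obtain R' M' where s: "s = (R', M')" by (cases s)
      have R': "\<forall>r<x. R' r = R r" "R' x = i * Suc T" "R' (Suc x) = i * (n * Suc T)"
        "A (fold f [0..<i] acc) R'" "M' = M"
        using I by (simp_all add: s)
      have "ends p (R', M) (\<lambda>m (R'', M'). m \<le> c \<and> M' = M \<and> (\<forall>r<Suc (Suc x). R'' r = R' r) \<and>
          A (f i (fold f [0..<i] acc)) R'')"
        using body[of i R'] i R' by simp
      then have "ends (Seq p (Seq (Add x x 4) (Add (Suc x) (Suc x) 5))) s
          (\<lambda>m s'. m \<le> c + 2 \<and> ?I (Suc i) s')"
        unfolding s R'(5)
        by (rule ends_SeqI) (use R' R x stable in \<open>auto simp: ends_simps ends_Seq algebra_simps\<close>)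
      moreover have "i * Suc T < n * Suc T" using i by (intro mult_less_mono1) auto
      then have "R' x < R' 5" using R' R x by simp
      ultimately show ?thesis by (simp add: s)
    qed
    show "\<not> fst s x < fst s 5" if "?I n s" for s
      using that R x by (cases s) auto
  qed
  then show ?thesis
    unfolding vloop_def ends_Seq ends_simps
    by (rule ends_mono) (auto simp: algebra_simps)
qed

section \<open>Scanning the times of an edge\<close>

lemma fold_upt_invariant:
  assumes "I 1 a" "\<And>i a. 1 \<le> i \<Longrightarrow> i \<le> T \<Longrightarrow> I i a \<Longrightarrow> I (Suc i) (f i a)"
  shows "I (Suc T) (fold f (ticks T) a)"
proof -
  have "I (Suc j) (fold f [1..<Suc j] a)" if "j \<le> T" for j
    using that
  proof (induction j)
    case 0
    then show ?case using assms(1) by simp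
  next
    case (Suc j)
    then show ?case using assms(2)[of "Suc j"] by simp
  qed
  then show ?thesis by (simp add: ticks_def)
qed

text \<open>One ascending pass suffices: once a time lies beyond \<open>c + d\<close>, so do all
  later ones.\<close>

lemma fold_run_last:
  assumes A: "A \<subseteq> {1..T}" "t \<in> A"
  shows "fold (\<lambda>u c. if u \<in> A \<and> c < u \<and> u \<le> c + d then u else c) (ticks T) t = run_last d A t"
proof -
  have fin: "finite A" using A finite_subset by blast
  let ?c = "fold (\<lambda>u c. if u \<in> A \<and> c < u \<and> u \<le> c + d then u else c) (ticks T) t"
  \<comment> \<open>The current value never overtakes the end of the run, and the times seen so far
    leave the gap after it empty.\<close>
  let ?I = "\<lambda>i c. c \<in> A \<and> t \<le> c \<and> c \<le> run_last d A t \<and> (\<forall>u\<in>A. u < i \<longrightarrow> u \<le> c \<or> c + d < u)"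
  have I: "?I (Suc T) ?c"
  proof (rule fold_upt_invariant[where I = ?I])
    show "?I 1 t" using A run_last_ge[OF fin A(2)] by force
    fix i c assume i: "1 \<le> i" "i \<le> T" and I: "?I i c"
    have "i \<le> run_last d A t" if "i \<in> A" "i \<le> c + d"
      using run_last_maximal[OF fin A(2) that(1), of d] that(2) I by linarith
    then show "?I (Suc i) (if i \<in> A \<and> c < i \<and> i \<le> c + d then i else c)"
      using I by (auto simp: less_Suc_eq not_le)
  qed
  have "u < Suc T" if "u \<in> A" for u using A that by auto
  then have "\<forall>u\<in>A. u \<le> ?c \<or> ?c + d < u" using I by blast
  then have "run_last d A t \<le> ?c"
    using I unfolding run_last_def by (intro Least_le) blast
  then show ?thesis using I by auto
qed

text \<open>The mirror image. Machine loops count upwards, so the descending pass visits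
  \<open>Suc T - w\<close>.\<close>

lemma fold_run_first:
  assumes A: "A \<subseteq> {1..T}" "t \<in> A"
  shows "fold (\<lambda>w c. if Suc T - w \<in> A \<and> Suc T - w < c \<and> c \<le> Suc T - w + d then Suc T - w else c)
    (ticks T) t = run_first d A t"
proof -
  have fin: "finite A" using A finite_subset by blast
  let ?c = "fold (\<lambda>w c. if Suc T - w \<in> A \<and> Suc T - w < c \<and> c \<le> Suc T - w + d then Suc T - w else c)
    (ticks T) t"
  let ?I = "\<lambda>i c. c \<in> A \<and> c \<le> t \<and> run_first d A t \<le> c \<and>
    (\<forall>u\<in>A. Suc T < u + i \<longrightarrow> c \<le> u \<or> u + d < c)"
  have I: "?I (Suc T) ?c"
  proof (rule fold_upt_invariant[where I = ?I])
    show "?I 1 t" using A run_first_le[OF fin A(2)] by force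
    fix i c assume i: "1 \<le> i" "i \<le> T" and I: "?I i c"
    define w where "w = Suc T - i"
    have w: "Suc T < u + Suc i \<longleftrightarrow> Suc T < u + i \<or> u = w" for u using i unfolding w_def by auto
    have "run_first d A t \<le> w" if "w \<in> A" "c \<le> w + d"
      using run_first_minimal[OF fin A(2) that(1), of d] that(2) I by linarith
    then show "?I (Suc i) (if Suc T - i \<in> A \<and> Suc T - i < c \<and> c \<le> Suc T - i + d then Suc T - i else c)"
      using I unfolding w w_def[symmetric] by (auto simp: not_le)
  qed
  have "\<forall>u\<in>A. ?c \<le> u \<or> u + d < ?c" using I A(1) by fastforce
  then have "?c \<le> run_first d A t"
    using I unfolding run_first_def by (intro Greatest_le_nat[where b = t]) blast+
  then show ?thesis using I by auto
qed

lemma fold_exists: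
  assumes A: "A \<subseteq> {1..T}"
  shows "fold (\<lambda>u c. if u \<in> A \<and> P u then 1 else c) (ticks T) 0 = (of_bool (\<exists>u\<in>A. P u) :: nat)"
proof -
  let ?c = "fold (\<lambda>u c. if u \<in> A \<and> P u then 1 else c) (ticks T) (0 :: nat)"
  have "?c = of_bool (\<exists>u\<in>A. u < Suc T \<and> P u)"
  proof (rule fold_upt_invariant)
    show "0 = (of_bool (\<exists>u\<in>A. u < 1 \<and> P u) :: nat)" using A by auto
  qed (auto simp: less_Suc_eq of_bool_def)
  moreover have "u < Suc T" if "u \<in> A" for u using A that by auto
  then have "(\<exists>u\<in>A. u < Suc T \<and> P u) \<longleftrightarrow> (\<exists>u\<in>A. P u)" by blast
  ultimately show ?thesis by simp
qed

text \<open>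
  The scans work in the registers from \<open>60\<close> to \<open>69\<close>. Register \<open>b\<close> holds the base address of the
  row of an edge.
\<close>

definition scan_last :: "nat \<Rightarrow> nat \<Rightarrow> nat \<Rightarrow> ram" where
  "scan_last b t c = Seq (Add 69 t 2) (Seq (tloop 60
     (Seq (Add 61 b 60) (Seq (Load 61 61) (Seq (Add 62 69 6)
       (IfLess 2 61 (IfLess 69 60 (IfLess 62 60 Skip (Add 69 60 2)) Skip) Skip)))))
     (Add c 69 2))"

definition scan_first :: "nat \<Rightarrow> nat \<Rightarrow> nat \<Rightarrow> ram" where
  "scan_first b t c = Seq (Add 69 t 2) (Seq (tloop 60
     (Seq (Sub 63 4 60) (Seq (Add 61 b 63) (Seq (Load 61 61) (Seq (Add 62 63 6)
       (IfLess 2 61 (IfLess 63 69 (IfLess 62 69 Skip (Add 69 63 2)) Skip) Skip))))))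
     (Add c 69 2))"

definition scan_near :: "nat \<Rightarrow> nat \<Rightarrow> nat \<Rightarrow> nat \<Rightarrow> nat \<Rightarrow> nat \<Rightarrow> ram" where
  "scan_near b f l f' l' c = Seq (Const 69 0) (Seq (tloop 60
     (Seq (Add 61 b 60) (Seq (Load 61 61) (Seq (Add 62 l 7) (Seq (Add 63 60 7) (Seq (Add 64 l' 7)
       (IfLess 2 61 (IfLess 60 62 (IfLess f 63 (IfLess 60 64 (IfLess f' 63
         (Const 69 1) Skip) Skip) Skip) Skip) Skip)))))))
     (Add c 69 2))"

text \<open>Registers below \<open>60\<close> hold the state of the search and those from
  \<open>100\<close> its result; a scan may touch only the range between and its target
  \<open>c\<close>.\<close>

definition scratch_frame :: "nat \<Rightarrow> (nat \<Rightarrow> nat) \<Rightarrow> (nat \<Rightarrow> nat) \<Rightarrow> bool" where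
  "scratch_frame c R R' \<longleftrightarrow> (\<forall>r. (r < 60 \<or> 100 \<le> r) \<and> r \<noteq> c \<longrightarrow> R' r = R r)"

lemma scratch_frameD:
  "scratch_frame c R R' \<Longrightarrow> r < 60 \<Longrightarrow> r \<noteq> c \<Longrightarrow> R' r = R r"
  "scratch_frame c R R' \<Longrightarrow> 100 \<le> r \<Longrightarrow> c < 60 \<Longrightarrow> R' r = R r"
  by (auto simp: scratch_frame_def)

locale row =
  fixes R M :: "nat \<Rightarrow> nat" and T d1 d2 b :: nat and A :: "nat set"
  assumes R: "R 1 = 1" "R 2 = 0" "R 4 = Suc T" "R 6 = d1" "R 7 = d2"
    and b: "b < 60" and A: "A \<subseteq> {1..T}"
    and cell: "\<And>u. 1 \<le> u \<Longrightarrow> u \<le> T \<Longrightarrow> M (R b + u) = of_bool (u \<in> A)"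
begin

lemma scan_loop:
  assumes R': "\<forall>r. r < 60 \<or> 100 \<le> r \<longrightarrow> R' r = R r"
    and body: "\<And>i R' c. 1 \<le> i \<Longrightarrow> i \<le> T \<Longrightarrow> \<forall>r. r < 60 \<or> 100 \<le> r \<longrightarrow> R' r = R r \<Longrightarrow> R' 60 = i \<Longrightarrow>
      R' 69 = c \<Longrightarrow> ends p (R', M) (\<lambda>m (R'', M'). m \<le> 11 \<and> M' = M \<and>
        (\<forall>r. r < 61 \<or> 100 \<le> r \<longrightarrow> R'' r = R' r) \<and> R'' 69 = f i c)"
  shows "ends (Seq (tloop 60 p) (Add c 69 2)) (R', M) (\<lambda>m (R'', M'). m \<le> T * 13 + 3 \<and> M' = M \<and>
    scratch_frame c R R'' \<and> R'' c = fold f (ticks T) (R' 69))"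
proof -
  have "ends (tloop 60 p) (R', M) (\<lambda>m (R'', M'). m \<le> T * (11 + 2) + 2 \<and> M' = M \<and>
      (\<forall>r<60. R'' r = R' r) \<and>
      (\<lambda>c R. R 69 = c \<and> (\<forall>r\<ge>100. R r = R' r)) (fold f (ticks T) (R' 69)) R'')"
  proof (rule tloop)
    fix i R'' c assume "1 \<le> i" "i \<le> T" "\<forall>r<60. R'' r = R' r" "R'' 60 = i"
      and "R'' 69 = c \<and> (\<forall>r\<ge>100. R'' r = R' r)"
    then have "ends p (R'', M) (\<lambda>m (R''', M'). m \<le> 11 \<and> M' = M \<and>
        (\<forall>r. r < 61 \<or> 100 \<le> r \<longrightarrow> R''' r = R'' r) \<and> R''' 69 = f i c)"
      using R' by (intro body) auto
    then show "ends p (R'', M) (\<lambda>m (R''', M'). m \<le> 11 \<and> M' = M \<and> (\<forall>r<Suc 60. R''' r = R'' r) \<and>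
        (R''' 69 = f i c \<and> (\<forall>r\<ge>100. R''' r = R' r)))"
      by (rule ends_mono) (use \<open>R'' 69 = c \<and> _\<close> in auto)
  qed (use R R' in auto)
  then show ?thesis
    by (rule ends_SeqI) (use R R' in \<open>auto simp: ends_simps scratch_frame_def\<close>)
qed

lemma scan_last:
  assumes "t < 60" "R t \<in> A"
  shows "ends (scan_last b t c) (R, M) (\<lambda>m (R', M'). m \<le> T * 13 + 4 \<and> M' = M \<and>
    scratch_frame c R R' \<and> R' c = run_last d1 A (R t))"
  unfolding scan_last_def ends_Seq[of "Add 69 t 2"] ends_simps
proof (rule ends_mono[OF scan_loop[where f = "\<lambda>u c. if u \<in> A \<and> c < u \<and> u \<le> c + d1 then u else c"]],
    goal_cases)
  case (2 i R' c)
  then have "M (R' b + i) = of_bool (i \<in> A)" using b cell by simp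
  then show ?case using 2 b R by (simp add: ends_simps ends_Seq)
next
  case (3 m s')
  then show ?case using fold_run_last[OF A assms(2), of d1] R by auto
qed auto

lemma scan_first:
  assumes "t < 60" "R t \<in> A"
  shows "ends (scan_first b t c) (R, M) (\<lambda>m (R', M'). m \<le> T * 13 + 4 \<and> M' = M \<and>
    scratch_frame c R R' \<and> R' c = run_first d1 A (R t))"
  unfolding scan_first_def ends_Seq[of "Add 69 t 2"] ends_simps
proof (rule ends_mono[OF scan_loop[where
      f = "\<lambda>w c. if Suc T - w \<in> A \<and> Suc T - w < c \<and> c \<le> Suc T - w + d1 then Suc T - w else c"]],
    goal_cases)
  case (2 i R' c)
  define w where "w = Suc T - i"
  have "1 \<le> w" "w \<le> T" using 2 unfolding w_def by simp_all
  then have "M (R' b + w) = of_bool (w \<in> A)" using 2 b cell by simp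
  then show ?case using 2 b R unfolding w_def[symmetric] by (simp add: ends_simps ends_Seq w_def[symmetric])
next
  case (3 m s')
  then show ?case using fold_run_first[OF A assms(2), of d1] R by auto
qed auto

lemma scan_near:
  assumes "f < 60" "l < 60" "f' < 60" "l' < 60"
  shows "ends (scan_near b f l f' l' c) (R, M) (\<lambda>m (R', M'). m \<le> T * 13 + 4 \<and> M' = M \<and>
    scratch_frame c R R' \<and>
    R' c = of_bool (\<exists>u\<in>A. near d2 u u (R f) (R l) \<and> near d2 u u (R f') (R l')))"
  unfolding scan_near_def ends_Seq[of "Const 69 0"] ends_simps
proof (rule ends_mono[OF scan_loop[where
      f = "\<lambda>u c. if u \<in> A \<and> near d2 u u (R f) (R l) \<and> near d2 u u (R f') (R l') then 1 else c"]],
    goal_cases)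
  case (2 i R' c)
  then have "M (R' b + i) = of_bool (i \<in> A)" using b cell by simp
  then show ?case using 2 b R assms by (simp add: ends_simps ends_Seq near_def)
next
  case (3 m s')
  then show ?case using fold_exists[OF A] R by auto
qed auto

end

section \<open>The search program\<close>

definition setlt :: "nat \<Rightarrow> nat \<Rightarrow> nat \<Rightarrow> ram" where
  "setlt c i j = IfLess i j (Const c 1) (Const c 0)"

text \<open>Flags are \<open>0\<close> or \<open>1\<close>, so their sum exceeds one, held in
  register \<open>1\<close>, for a conjunction, and exceeds zero, held in register \<open>2\<close>,
  for a disjunction.\<close>

definition conj_flag :: "nat \<Rightarrow> nat \<Rightarrow> nat \<Rightarrow> ram" where
  "conj_flag c i j = Seq (Add c i j) (setlt c 1 c)"

definition disj_flag :: "nat \<Rightarrow> nat \<Rightarrow> nat \<Rightarrow> ram" where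
  "disj_flag c i j = Seq (Add c i j) (setlt c 2 c)"

definition both_below :: "nat \<Rightarrow> nat \<Rightarrow> nat \<Rightarrow> nat \<Rightarrow> nat \<Rightarrow> nat \<Rightarrow> ram" where
  "both_below c i j i' j' d = Seq (Add c j d) (Seq (setlt c i c)
     (Seq (Add 58 j' d) (Seq (setlt 58 i' 58) (conj_flag c c 58))))"

definition equal_flag :: "nat \<Rightarrow> nat \<Rightarrow> nat \<Rightarrow> ram" where
  "equal_flag c i j = Seq (setlt c i j) (Seq (setlt 58 j i) (Seq (Add c c 58) (Sub c 1 c)))"

text \<open>An opaque copy of \<open>of_bool\<close>, so that the simplifier leaves computed flags alone.\<close>

definition flag :: "bool \<Rightarrow> nat" where
  "flag P = of_bool P"

lemma flag_simps:
  "Suc 0 < flag P + flag Q \<longleftrightarrow> P \<and> Q" "0 < flag P \<longleftrightarrow> P" "flag P = 0 \<longleftrightarrow> \<not> P" "Suc 0 - flag P = flag (\<not> P)"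
  "Suc 0 - (flag (x < y) + flag (y < x)) = flag (x = y)" for x y :: nat
  by (auto simp: flag_def)

lemma ends_setlt: "ends (setlt c i j) (R, M) Q \<longleftrightarrow> Q 2 (R(c := flag (R i < R j)), M)"
  by (simp add: setlt_def flag_def ends_simps numeral_2_eq_2)

text \<open>Inputs: \<open>36\<close>, \<open>37\<close> and \<open>40\<close>, \<open>41\<close>
  are the ends of the two runs; \<open>38\<close> and \<open>42\<close> tell whether
  \<open>pv\<close> and \<open>vr\<close> are near their runs, \<open>43\<close> and
  \<open>44\<close> whether \<open>pr\<close> and \<open>pv\<close> are near both. Register
  \<open>48\<close> collects \<open>linked\<close>, \<open>49\<close> first the demands of a common
  template and then their negation, \<open>59\<close> the verdict.\<close>

definition evaluate :: ram where
  "evaluate =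
     Seq (both_below 45 36 41 40 37 7)
    (Seq (equal_flag 46 26 22)
    (Seq (equal_flag 47 28 24)
    (Seq (disj_flag 48 46 47)
    (Seq (conj_flag 48 48 44)
    (Seq (disj_flag 48 45 48)
    (Seq (conj_flag 48 48 38)
    (Seq (conj_flag 48 48 42)
    (Seq (both_below 49 36 40 40 36 6)
    (Seq (both_below 50 37 41 41 37 6)
    (Seq (conj_flag 49 49 50)
    (Seq (disj_flag 50 46 43)
    (Seq (conj_flag 49 49 50)
    (Seq (Sub 49 1 49)
         (conj_flag 59 48 49))))))))))))))"

lemma ends_evaluate:
  assumes R: "R (Suc 0) = Suc 0" "R 2 = 0" "R 38 = flag a" "R 42 = flag b" "R 43 = flag c" "R 44 = flag d"
  shows "ends evaluate (R, M) (\<lambda>m (R', M'). m \<le> 100 \<and> M' = M \<and>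
    (\<forall>r. r < 45 \<or> 60 \<le> r \<longrightarrow> R' r = R r) \<and>
    R' 59 = flag (
      (a \<and> b \<and> (near (R 7) (R 36) (R 37) (R 40) (R 41) \<or> (R 26 = R 22 \<or> R 28 = R 24) \<and> d)) \<and>
      \<not> (aligned (R 6) (R 36) (R 37) (R 40) (R 41) \<and> (R 26 = R 22 \<or> c))))"
  unfolding evaluate_def both_below_def equal_flag_def conj_flag_def disj_flag_def near_def aligned_def
  by (simp add: R ends_Seq ends_Add ends_Sub ends_setlt flag_simps conj_ac disj_ac)

text \<open>Adding register \<open>2\<close>, which is zero, serves as a move.\<close>

definition record_walk :: ram where
  "record_walk = Seq (Const 100 1)
    (Seq (Add 101 20 2) (Seq (Add 102 21 2) (Seq (Add 103 22 2) (Seq (Add 104 23 2)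
    (Seq (Add 105 24 2) (Seq (Add 106 25 2) (Seq (Add 107 26 2) (Seq (Add 108 27 2)
    (Seq (Add 109 28 2) (Add 110 29 2))))))))))"

definition check_runs :: ram where
  "check_runs = Seq (scan_first 33 39 40) (Seq (scan_last 33 39 41)
    (Seq (scan_near 32 40 41 40 41 42) (Seq (scan_near 34 36 37 40 41 43)
    (Seq (scan_near 31 36 37 40 41 44) (Seq evaluate (IfLess 2 59 record_walk Skip))))))"

definition check_second :: ram where
  "check_second = Seq (Add 61 33 39) (Seq (Load 61 61) (IfLess 2 61 check_runs Skip))"

definition check_first :: ram where
  "check_first = Seq (Add 61 30 35) (Seq (Load 61 61) (IfLess 2 61
    (Seq (scan_first 30 35 36) (Seq (scan_last 30 35 37) (Seq (scan_near 31 36 37 36 37 38)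
      (tloop 39 check_second)))) Skip))"

definition row_base :: "nat \<Rightarrow> nat \<Rightarrow> nat \<Rightarrow> ram" where
  "row_base x y c = Seq (Add c (Suc x) y) (Add c c 8)"

definition check_walk :: ram where
  "check_walk = Seq (row_base 20 22 30) (Seq (row_base 22 24 31) (Seq (row_base 24 26 32)
    (Seq (row_base 26 28 33) (Seq (row_base 22 26 34) (tloop 35 check_first)))))"

definition search_prog :: ram where
  "search_prog = Seq (Const 100 0)
    (vloop 20 (vloop 22 (vloop 24 (vloop 26 (vloop 28 check_walk)))))"

text \<open>Each pair has a row for either order of its ends, so every update concerns two cells;
  diagonal rows stay zero because singletons are no edges.\<close>

definition holds_table :: "'v list \<Rightarrow> nat \<Rightarrow> nat \<Rightarrow> ('v set \<times> nat) set \<Rightarrow> (nat \<Rightarrow> nat) \<Rightarrow> bool" where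
  "holds_table vs T P S M \<longleftrightarrow> (\<forall>x<length vs. \<forall>y<length vs. \<forall>u. 1 \<le> u \<and> u \<le> T \<longrightarrow>
     M (x * (length vs * Suc T) + y * Suc T + P + u) = of_bool (({vs ! x, vs ! y}, u) \<in> S))"

text \<open>Absorbs the loop overhead into the constant factor: the five nested levels raise it from
  \<open>290\<close> to \<open>320\<close>, and initialising the result makes
  \<open>321\<close>.\<close>

lemma loop_cost:
  fixes n X :: nat
  assumes "0 < n" "1 \<le> X"
  shows "n * (c * X + 3) + 3 \<le> (c + 6) * (n * X)"
proof -
  have X: "n \<le> n * X" "1 \<le> n * X" using assms by simp_all
  have eq: "n * (c * X + 3) + 3 = c * (n * X) + 3 * n + 3" "(c + 6) * (n * X) = c * (n * X) + 6 * (n * X)"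
    by (simp_all add: algebra_simps)
  have "C + 3 * n + 3 \<le> C + 6 * A" if "n \<le> A" "1 \<le> A" for A C :: nat
    using that by simp
  from this[OF X] show ?thesis unfolding eq .
qed

section \<open>Correctness and cost of the search program\<close>

locale machine =
  fixes vs :: "'v list" and T d1 d2 P :: nat
  assumes distinct_vs: "distinct vs" and T: "1 \<le> T"
begin

abbreviation "n \<equiv> length vs"

definition env :: "(nat \<Rightarrow> nat) \<Rightarrow> bool" where
  "env R \<longleftrightarrow> R 1 = 1 \<and> R 2 = 0 \<and> R 3 = T \<and> R 4 = Suc T \<and> R 5 = n * Suc T \<and>
     R 6 = d1 \<and> R 7 = d2 \<and> R 8 = P"

definition vertex_at :: "(nat \<Rightarrow> nat) \<Rightarrow> nat \<Rightarrow> nat \<Rightarrow> bool" where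
  "vertex_at R c x \<longleftrightarrow> R c = x * Suc T \<and> R (Suc c) = x * (n * Suc T)"

definition found_at :: "(nat \<times> nat \<times> nat \<times> nat \<times> nat) option \<Rightarrow> (nat \<Rightarrow> nat) \<Rightarrow> bool" where
  "found_at a R \<longleftrightarrow> (case a of None \<Rightarrow> R 100 = 0
     | Some (q, p, v, r, s) \<Rightarrow> R 100 = 1 \<and> vertex_at R 101 q \<and> vertex_at R 103 p \<and>
         vertex_at R 105 v \<and> vertex_at R 107 r \<and> vertex_at R 109 s)"

lemma env_cong: "env R \<Longrightarrow> \<forall>r<9. R' r = R r \<Longrightarrow> env R'"
  by (simp add: env_def)

lemma vertex_at_cong: "vertex_at R c x \<Longrightarrow> \<forall>r\<le>Suc c. R' r = R r \<Longrightarrow> vertex_at R' c x"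
  by (simp add: vertex_at_def)

lemma found_at_cong: "found_at a R \<Longrightarrow> \<forall>r\<ge>100. R' r = R r \<Longrightarrow> found_at a R'"
  by (auto simp: found_at_def vertex_at_def split: option.splits)

lemma found_at_upd: "found_at a R \<Longrightarrow> c < 100 \<Longrightarrow> found_at a (R(c := v))"
  by (rule found_at_cong) auto

end

locale search_machine = machine +
  fixes S :: "('a set \<times> nat) set" and M :: "nat \<Rightarrow> nat"
  assumes S: "S \<subseteq> vertex_pairs (set vs) \<times> {1..T}" and table: "holds_table vs T P S M"
begin

abbreviation "E x y \<equiv> edge_times S {vs ! x, vs ! y}"

definition base_at :: "(nat \<Rightarrow> nat) \<Rightarrow> nat \<Rightarrow> nat \<Rightarrow> nat \<Rightarrow> bool" where
  "base_at R b x y \<longleftrightarrow> R b = x * (n * Suc T) + y * Suc T + P"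

lemma E_sub: "E x y \<subseteq> {1..T}"
  using S by (auto simp: edge_times_def)

lemma cell:
  assumes "base_at R b x y" "x < n" "y < n" "1 \<le> u" "u \<le> T"
  shows "M (R b + u) = of_bool (u \<in> E x y)"
  using table assms unfolding holds_table_def base_at_def edge_times_def by simp

lemma row:
  assumes "env R" "base_at R b x y" "x < n" "y < n" "b < 60"
  shows "row R M T d1 d2 b (E x y)"
  using assms E_sub cell by unfold_locales (simp_all add: env_def)

lemma base_at_cong: "base_at R b x y \<Longrightarrow> R' b = R b \<Longrightarrow> base_at R' b x y"
  by (simp add: base_at_def)

definition bases :: "(nat \<Rightarrow> nat) \<Rightarrow> nat \<Rightarrow> nat \<Rightarrow> nat \<Rightarrow> nat \<Rightarrow> nat \<Rightarrow> bool" where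
  "bases R q p v r s \<longleftrightarrow> env R \<and> q < n \<and> p < n \<and> v < n \<and> r < n \<and> s < n \<and>
     vertex_at R 20 q \<and> vertex_at R 22 p \<and> vertex_at R 24 v \<and> vertex_at R 26 r \<and> vertex_at R 28 s \<and>
     base_at R 30 q p \<and> base_at R 31 p v \<and> base_at R 32 v r \<and> base_at R 33 r s \<and> base_at R 34 p r"

lemma bases_cong: "bases R q p v r s \<Longrightarrow> \<forall>r<35. R' r = R r \<Longrightarrow> bases R' q p v r s"
  unfolding bases_def
  by (auto intro: env_cong vertex_at_cong base_at_cong)

lemma bases_frame: "bases R q p v r s \<Longrightarrow> scratch_frame c R R' \<Longrightarrow> 35 \<le> c \<Longrightarrow> bases R' q p v r s"
  by (rule bases_cong) (auto simp: scratch_frame_def)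

lemma check_runs:
  assumes B: "bases R q p v r s" and t: "t \<in> E q p" and t': "R 39 = t'" "t' \<in> E r s"
    and R: "R 36 = run_first d1 (E q p) t" "R 37 = run_last d1 (E q p) t"
      "R 38 = of_bool (\<exists>u\<in>E p v. near d2 u u (R 36) (R 37))"
    and acc: "found_at acc R"
  shows "ends check_runs (R, M) (\<lambda>m (R', M'). m \<le> 65 * T + 140 \<and> M' = M \<and> (\<forall>r<40. R' r = R r) \<and>
    found_at (test d1 d2 S vs q p v r s t t' acc) R')"
proof -
  let ?f = "R 36" and ?l = "R 37"
  define f' where "f' = run_first d1 (E r s) t'"
  define l' where "l' = run_last d1 (E r s) t'"
  let ?b = "\<exists>u\<in>E v r. near d2 u u f' l'"
  let ?c = "\<exists>u\<in>E p r. near d2 u u ?f ?l \<and> near d2 u u f' l'"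
  let ?d = "\<exists>u\<in>E p v. near d2 u u ?f ?l \<and> near d2 u u f' l'"
  note B1 = B
  have "row R M T d1 d2 33 (E r s)" using B1 by (simp add: bases_def row)
  from row.scan_first[OF this, of 39 40]
  have "ends (scan_first 33 39 40) (R, M) (\<lambda>m (R', M'). m \<le> T * 13 + 4 \<and> M' = M \<and>
    scratch_frame 40 R R' \<and> R' 40 = f')"
    using t' by (simp add:  f'_def l'_def)
  then obtain m1 R1 where x1: "exec (scan_first 33 39 40) (R, M) m1 (R1, M)" "m1 \<le> T * 13 + 4"
    and f1: "scratch_frame 40 R R1" and v1: "R1 40 = f'"
    by (rule endsE) blast
  note e1 = scratch_frameD[OF f1]
  have B2: "bases R1 q p v r s" by (rule bases_frame[OF B1 f1]) simp
  have "row R1 M T d1 d2 33 (E r s)" using B2 by (simp add: bases_def row)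
  from row.scan_last[OF this, of 39 41]
  have "ends (scan_last 33 39 41) (R1, M) (\<lambda>m (R', M'). m \<le> T * 13 + 4 \<and> M' = M \<and>
    scratch_frame 41 R1 R' \<and> R' 41 = l')"
    using t' by (simp add: e1 f'_def l'_def)
  then obtain m2 R2 where x2: "exec (scan_last 33 39 41) (R1, M) m2 (R2, M)" "m2 \<le> T * 13 + 4"
    and f2: "scratch_frame 41 R1 R2" and v2: "R2 41 = l'"
    by (rule endsE) blast
  note e2 = scratch_frameD[OF f2]
  have B3: "bases R2 q p v r s" by (rule bases_frame[OF B2 f2]) simp
  have "row R2 M T d1 d2 32 (E v r)" using B3 by (simp add: bases_def row)
  from row.scan_near[OF this, of 40 41 40 41 42]
  have "ends (scan_near 32 40 41 40 41 42) (R2, M) (\<lambda>m (R', M'). m \<le> T * 13 + 4 \<and> M' = M \<and>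
    scratch_frame 42 R2 R' \<and> R' 42 = of_bool ?b)"
    by (simp add: e1 e2 v1 v2)
  then obtain m3 R3 where x3: "exec (scan_near 32 40 41 40 41 42) (R2, M) m3 (R3, M)" "m3 \<le> T * 13 + 4"
    and f3: "scratch_frame 42 R2 R3" and v3: "R3 42 = of_bool ?b"
    by (rule endsE) blast
  note e3 = scratch_frameD[OF f3]
  have B4: "bases R3 q p v r s" by (rule bases_frame[OF B3 f3]) simp
  have "row R3 M T d1 d2 34 (E p r)" using B4 by (simp add: bases_def row)
  from row.scan_near[OF this, of 36 37 40 41 43]
  have "ends (scan_near 34 36 37 40 41 43) (R3, M) (\<lambda>m (R', M'). m \<le> T * 13 + 4 \<and> M' = M \<and>
    scratch_frame 43 R3 R' \<and> R' 43 = of_bool ?c)"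
    by (simp add: e1 e2 e3 v1 v2 v3)
  then obtain m4 R4 where x4: "exec (scan_near 34 36 37 40 41 43) (R3, M) m4 (R4, M)" "m4 \<le> T * 13 + 4"
    and f4: "scratch_frame 43 R3 R4" and v4: "R4 43 = of_bool ?c"
    by (rule endsE) blast
  note e4 = scratch_frameD[OF f4]
  have B5: "bases R4 q p v r s" by (rule bases_frame[OF B4 f4]) simp
  have "row R4 M T d1 d2 31 (E p v)" using B5 by (simp add: bases_def row)
  from row.scan_near[OF this, of 36 37 40 41 44]
  have "ends (scan_near 31 36 37 40 41 44) (R4, M) (\<lambda>m (R', M'). m \<le> T * 13 + 4 \<and> M' = M \<and>
    scratch_frame 44 R4 R' \<and> R' 44 = of_bool ?d)"
    by (simp add: e1 e2 e3 e4 v1 v2 v3 v4)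
  then obtain m5 R5 where x5: "exec (scan_near 31 36 37 40 41 44) (R4, M) m5 (R5, M)" "m5 \<le> T * 13 + 4"
    and f5: "scratch_frame 44 R4 R5" and v5: "R5 44 = of_bool ?d"
    by (rule endsE) blast
  note e5 = scratch_frameD[OF f5]
  have B6: "bases R5 q p v r s" by (rule bases_frame[OF B5 f5]) simp
  have low: "R5 r = R r" if "r < 40" for r using that by (simp add: e1 e2 e3 e4 e5)
  have high: "R5 r = R r" if "100 \<le> r" for r using that by (simp add: e1 e2 e3 e4 e5)
  have vals: "R5 40 = f'" "R5 41 = l'" "R5 42 = of_bool ?b" "R5 43 = of_bool ?c" "R5 44 = of_bool ?d"
    by (simp_all add: e1 e2 e3 e4 e5 v1 v2 v3 v4 v5)
  let ?m = "m1 + (m2 + (m3 + (m4 + m5)))"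
  \<comment> \<open>Five scans of \<open>13 * T + 4\<close> steps; the other \<open>120\<close>
    steps of the bound pay for \<open>evaluate\<close> and for recording the walk.\<close>
  have bound: "?m \<le> 65 * T + 20" using x1 x2 x3 x4 x5 by simp
  have s6: "ends (Seq evaluate (IfLess 2 59 record_walk Skip)) (R5, M) (\<lambda>k (R', M').
      ?m + k \<le> 65 * T + 140 \<and> M' = M \<and> (\<forall>r<40. R' r = R r) \<and>
      found_at (test d1 d2 S vs q p v r s t t' acc) R')"
  proof -
    have env: "R5 1 = 1" "R5 2 = 0" "R5 6 = d1" "R5 7 = d2"
      and lt: "p < n" "v < n" "r < n" "s < n"
      and v: "R5 22 = p * Suc T" "R5 24 = v * Suc T" "R5 26 = r * Suc T" "R5 28 = s * Suc T"
      using B6 by (auto simp: bases_def env_def vertex_at_def)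
    \<comment> \<open>Vertices are compared through their multiples of \<open>T + 1\<close>, which
      determine the positions, and positions determine vertices since \<open>vs\<close> is
      distinct.\<close>
    have eq: "R5 26 = R5 22 \<longleftrightarrow> vs ! r = vs ! p" "R5 28 = R5 24 \<longleftrightarrow> vs ! s = vs ! v"
      using distinct_vs lt unfolding v by (simp_all add: nth_eq_iff_index_eq del: mult_Suc_right)
    let ?a = "\<exists>u\<in>E p v. near d2 u u ?f ?l"
    have flags: "R5 38 = flag ?a" "R5 42 = flag ?b" "R5 43 = flag ?c" "R5 44 = flag ?d"
      "R5 36 = ?f" "R5 37 = ?l" "R5 40 = f'" "R5 41 = l'"
      using vals R(3) low by (simp_all add: flag_def)
    let ?viol = "violation d1 d2 S (vs ! q) (vs ! p) (vs ! v) (vs ! r) (vs ! s) t t'"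
    have viol: "((?a \<and> ?b \<and> (near (R5 7) (R5 36) (R5 37) (R5 40) (R5 41) \<or>
        (R5 26 = R5 22 \<or> R5 28 = R5 24) \<and> ?d)) \<and>
      \<not> (aligned (R5 6) (R5 36) (R5 37) (R5 40) (R5 41) \<and> (R5 26 = R5 22 \<or> ?c))) \<longleftrightarrow> ?viol"
      using t t'(2) unfolding eq env flags
      by (simp add: violation_def linked_def Let_def R(1,2) f'_def l'_def)
    have acc5: "found_at acc R5" using found_at_cong[OF acc] high by simp
    have v5: "vertex_at R5 20 q" "vertex_at R5 22 p" "vertex_at R5 24 v" "vertex_at R5 26 r"
      "vertex_at R5 28 s" using B6 by (auto simp: bases_def)
    obtain k R6 where R6: "exec evaluate (R5, M) k (R6, M)" "k \<le> 100"
      and frame: "\<forall>r. r < 45 \<or> 60 \<le> r \<longrightarrow> R6 r = R5 r" and R59: "R6 59 = flag ?viol"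
      by (rule endsE[OF ends_evaluate[OF env(1)[unfolded One_nat_def] env(2) flags(1-4), unfolded viol]]) blast
    have "ends (IfLess 2 59 record_walk Skip) (R6, M) (\<lambda>j (R', M'). ?m + (k + j) \<le> 65 * T + 140 \<and>
        M' = M \<and> (\<forall>r<40. R' r = R r) \<and> found_at (test d1 d2 S vs q p v r s t t' acc) R')"
    proof (cases ?viol)
      case True
      have "R6 2 < R6 59" using frame env R59 True by (simp add: flag_def)
      moreover have "ends record_walk (R6, M) (\<lambda>j (R', M'). ?m + (k + Suc j) \<le> 65 * T + 140 \<and>
        M' = M \<and> (\<forall>r<40. R' r = R r) \<and> found_at (Some (q, p, v, r, s)) R')"
        using frame v5 bound low env(2) R6(2)
        unfolding record_walk_def
        by (simp add: ends_Seq ends_simps found_at_def vertex_at_def)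
      ultimately show ?thesis using True by (simp add: ends_IfLess test_def)
    next
      case False
      have "\<not> R6 2 < R6 59" using R59 False by (simp add: flag_def)
      moreover have "found_at acc R6" using found_at_cong[OF acc5] frame by simp
      ultimately show ?thesis
        using False frame low bound R6(2) by (simp add: ends_simps test_def)
    qed
    then show ?thesis by (rule ends_exec_Seq[OF R6(1)])
  qed
  show ?thesis
    unfolding check_runs_def
    by (rule ends_exec_Seq[OF x1(1)], rule ends_exec_Seq[OF x2(1)], rule ends_exec_Seq[OF x3(1)],
        rule ends_exec_Seq[OF x4(1)], rule ends_exec_Seq[OF x5(1)])
      (use s6 in \<open>simp add: add.assoc\<close>)
qed

lemma test_trivial: "t \<notin> E q p \<or> t' \<notin> E r s \<Longrightarrow> test d1 d2 S vs q p v r s t t' a = a"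
  by (auto simp: test_def violation_def)

lemma check_second:
  assumes B: "bases R q p v r s" and t: "t \<in> E q p" and t': "1 \<le> t'" "t' \<le> T" "R 39 = t'"
    and R: "R 36 = run_first d1 (E q p) t" "R 37 = run_last d1 (E q p) t"
      "R 38 = of_bool (\<exists>u\<in>E p v. near d2 u u (R 36) (R 37))"
    and acc: "found_at acc R"
  shows "ends check_second (R, M) (\<lambda>m (R', M'). m \<le> 65 * T + 143 \<and> M' = M \<and> (\<forall>r<40. R' r = R r) \<and>
    found_at (test d1 d2 S vs q p v r s t t' acc) R')"
proof -
  let ?R = "R(61 := of_bool (t' \<in> E r s))"
  have cell: "M (R 33 + R 39) = of_bool (t' \<in> E r s)"
    unfolding t'(3) by (rule cell) (use B t' in \<open>auto simp: bases_def\<close>)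
  have R2: "R 2 = 0" using B by (simp add: bases_def env_def)
  have acc': "found_at acc ?R" using acc by (rule found_at_upd) simp
  show ?thesis
  proof (cases "t' \<in> E r s")
    case True
    have "bases ?R q p v r s" by (rule bases_cong[OF B]) simp
    from ends_mono[OF check_runs[OF this t _ True, of acc]] acc' R t'
    have "ends check_runs (?R, M) (\<lambda>m (R', M'). Suc (Suc (Suc m)) \<le> 65 * T + 143 \<and> M' = M \<and>
      (\<forall>r<40. R' r = ?R r) \<and> found_at (test d1 d2 S vs q p v r s t t' acc) R')"
      by fastforce
    then have "ends check_runs (?R, M) (\<lambda>m (R', M'). Suc (Suc (Suc m)) \<le> 65 * T + 143 \<and> M' = M \<and>
      (\<forall>r<40. R' r = R r) \<and> found_at (test d1 d2 S vs q p v r s t t' acc) R')"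
      by (rule ends_mono) auto
    then show ?thesis
      using True R2 by (simp add: check_second_def ends_Seq ends_simps cell)
  next
    case False
    then show ?thesis
      using R2 acc' by (simp add: check_second_def ends_Seq ends_simps cell test_trivial)
  qed
qed

lemma fold_test_trivial:
  "t \<notin> E q p \<Longrightarrow> fold (\<lambda>t'. test d1 d2 S vs q p v r s t t') ts a = a"
  by (induction ts arbitrary: a) (simp_all add: test_trivial)

lemma check_first:
  assumes B: "bases R q p v r s" and t: "1 \<le> t" "t \<le> T" "R 35 = t" and acc: "found_at acc R"
  shows "ends check_first (R, M) (\<lambda>m (R', M'). m \<le> 270 * T ^ 2 \<and> M' = M \<and> (\<forall>r<36. R' r = R r) \<and>
    found_at (fold (\<lambda>t'. test d1 d2 S vs q p v r s t t') (ticks T) acc) R')"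
proof -
  let ?R = "R(61 := of_bool (t \<in> E q p))"
  have cell: "M (R 30 + R 35) = of_bool (t \<in> E q p)"
    unfolding t(3) by (rule cell) (use B t in \<open>auto simp: bases_def\<close>)
  have R2: "R 2 = 0" using B by (simp add: bases_def env_def)
  have acc': "found_at acc ?R" using acc by (rule found_at_upd) simp
  have sq: "T \<le> T ^ 2" "1 \<le> T ^ 2" "T * (65 * T + 143 + 2) = 65 * T ^ 2 + 145 * T"
    using T by (simp_all add: power2_eq_square algebra_simps)
  have cost: "T * (65 * T + 143 + 2) + 2 + 3 * (T * 13 + 4) + 3 \<le> 270 * T ^ 2"
  proof -
    \<comment> \<open>The coefficients add up to \<open>65 + 184 + 17 = 266\<close>.\<close>
    have "65 * A + 145 * T + 2 + 3 * (T * 13 + 4) + 3 \<le> 270 * A" if "T \<le> A" "1 \<le> A" for A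
      using that by simp
    from this[OF sq(1,2)] show ?thesis unfolding sq(3) .
  qed
  show ?thesis
  proof (cases "t \<in> E q p")
    case True
    have B0: "bases ?R q p v r s" by (rule bases_cong[OF B]) simp
    have "row ?R M T d1 d2 30 (E q p)" using B0 by (simp add: bases_def row)
    from row.scan_first[OF this, of 35 36]
    have "ends (scan_first 30 35 36) (?R, M) (\<lambda>m (R', M'). m \<le> T * 13 + 4 \<and> M' = M \<and>
      scratch_frame 36 ?R R' \<and> R' 36 = run_first d1 (E q p) t)" using t True by simp
    then obtain m1 R1 where x1: "exec (scan_first 30 35 36) (?R, M) m1 (R1, M)" "m1 \<le> T * 13 + 4"
      and f1: "scratch_frame 36 ?R R1" and v1: "R1 36 = run_first d1 (E q p) t"
      by (rule endsE) blast
    note e1 = scratch_frameD[OF f1]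
    have B1: "bases R1 q p v r s" by (rule bases_frame[OF B0 f1]) simp
    have "row R1 M T d1 d2 30 (E q p)" using B1 by (simp add: bases_def row)
    from row.scan_last[OF this, of 35 37]
    have "ends (scan_last 30 35 37) (R1, M) (\<lambda>m (R', M'). m \<le> T * 13 + 4 \<and> M' = M \<and>
      scratch_frame 37 R1 R' \<and> R' 37 = run_last d1 (E q p) t)" using t True by (simp add: e1)
    then obtain m2 R2 where x2: "exec (scan_last 30 35 37) (R1, M) m2 (R2, M)" "m2 \<le> T * 13 + 4"
      and f2: "scratch_frame 37 R1 R2" and v2: "R2 37 = run_last d1 (E q p) t"
      by (rule endsE) blast
    note e2 = scratch_frameD[OF f2]
    have B2: "bases R2 q p v r s" by (rule bases_frame[OF B1 f2]) simp
    let ?a = "\<exists>u\<in>E p v. near d2 u u (run_first d1 (E q p) t) (run_last d1 (E q p) t)"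
    have "row R2 M T d1 d2 31 (E p v)" using B2 by (simp add: bases_def row)
    from row.scan_near[OF this, of 36 37 36 37 38]
    have "ends (scan_near 31 36 37 36 37 38) (R2, M) (\<lambda>m (R', M'). m \<le> T * 13 + 4 \<and> M' = M \<and>
      scratch_frame 38 R2 R' \<and> R' 38 = of_bool ?a)" by (simp add: e2 v2 v1)
    then obtain m3 R3 where x3: "exec (scan_near 31 36 37 36 37 38) (R2, M) m3 (R3, M)" "m3 \<le> T * 13 + 4"
      and f3: "scratch_frame 38 R2 R3" and v3: "R3 38 = of_bool ?a"
      by (rule endsE) blast
    note e3 = scratch_frameD[OF f3]
    have B3: "bases R3 q p v r s" by (rule bases_frame[OF B2 f3]) simp
    have env3: "R3 1 = 1" "R3 4 = Suc T" using B3 by (simp_all add: bases_def env_def)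
    have acc3: "found_at acc R3" using found_at_cong[OF acc] by (simp add: e1 e2 e3)
    have "ends (tloop 39 check_second) (R3, M) (\<lambda>m (R', M'). m \<le> T * (65 * T + 143 + 2) + 2 \<and> M' = M \<and>
      (\<forall>r<39. R' r = R3 r) \<and> found_at (fold (\<lambda>t'. test d1 d2 S vs q p v r s t t') (ticks T) acc) R')"
    proof (rule tloop[where A = found_at, OF _ env3 acc3])
      fix i R' a
      assume i: "1 \<le> i" "i \<le> T" "\<forall>r<39. R' r = R3 r" "R' 39 = i" and a: "found_at a R'"
      have B': "bases R' q p v r s" by (rule bases_cong[OF B3]) (simp add: i)
      show "ends check_second (R', M) (\<lambda>m (R'', M'). m \<le> 65 * T + 143 \<and> M' = M \<and>
        (\<forall>r<Suc 39. R'' r = R' r) \<and> found_at (test d1 d2 S vs q p v r s t i a) R'')"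
        using check_second[of R' q p v r s t i a, OF B' True i(1,2,4)] a i
        by (simp add: e1 e2 e3 v1 v2 v3)
    qed (simp_all add: found_at_upd)
    then have s4: "ends (tloop 39 check_second) (R3, M) (\<lambda>m (R', M').
      Suc (Suc (Suc (m1 + (m2 + (m3 + m))))) \<le> 270 * T ^ 2 \<and> M' = M \<and>
      (\<forall>r<36. R' r = R r) \<and> found_at (fold (\<lambda>t'. test d1 d2 S vs q p v r s t t') (ticks T) acc) R')"
      by (rule ends_mono) (use x1 x2 x3 cost in \<open>auto simp: e1 e2 e3\<close>)
    have "ends (Seq (scan_first 30 35 36) (Seq (scan_last 30 35 37) (Seq (scan_near 31 36 37 36 37 38)
      (tloop 39 check_second)))) (?R, M) (\<lambda>m (R', M'). Suc (Suc (Suc m)) \<le> 270 * T ^ 2 \<and> M' = M \<and>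
      (\<forall>r<36. R' r = R r) \<and> found_at (fold (\<lambda>t'. test d1 d2 S vs q p v r s t t') (ticks T) acc) R')"
      by (rule ends_exec_Seq[OF x1(1)], rule ends_exec_Seq[OF x2(1)], rule ends_exec_Seq[OF x3(1)], rule s4)
    then show ?thesis
      using True R2 by (simp add: check_first_def ends_Seq[of "Add 61 30 35"] ends_Seq[of "Load 61 61"] ends_simps cell)
  next
    case False
    then show ?thesis
      using R2 acc' sq(2)
      by (simp add: check_first_def ends_Seq ends_simps cell fold_test_trivial)
  qed
qed

lemma check_walk:
  assumes env: "env R" and lt: "q < n" "p < n" "v < n" "r < n" "s < n"
    and R: "vertex_at R 20 q" "vertex_at R 22 p" "vertex_at R 24 v" "vertex_at R 26 r" "vertex_at R 28 s"
    and acc: "found_at acc R"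
  shows "ends check_walk (R, M) (\<lambda>m (R', M'). m \<le> 290 * T ^ 3 \<and> M' = M \<and> (\<forall>r<30. R' r = R r) \<and>
    found_at (fold (\<lambda>t. fold (\<lambda>t'. test d1 d2 S vs q p v r s t t') (ticks T)) (ticks T) acc) R')"
proof -
  let ?b = "\<lambda>x y. x * (n * Suc T) + y * Suc T + P"
  let ?R = "R(30 := ?b q p, 31 := ?b p v, 32 := ?b v r, 33 := ?b r s, 34 := ?b p r)"
  have B: "bases ?R q p v r s"
    unfolding bases_def
    by (intro conjI env_cong[OF env] vertex_at_cong[OF R(1)] vertex_at_cong[OF R(2)]
        vertex_at_cong[OF R(3)] vertex_at_cong[OF R(4)] vertex_at_cong[OF R(5)] lt)
      (auto simp: base_at_def)
  have env': "?R 1 = 1" "?R 4 = Suc T" using B by (simp_all add: bases_def env_def)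
  have acc': "found_at acc ?R" using acc by (intro found_at_upd) simp_all
  have cube: "T \<le> T ^ 3" "1 \<le> T ^ 3" "T * (270 * T ^ 2 + 2) = 270 * T ^ 3 + 2 * T"
    using T by (simp_all add: power2_eq_square power3_eq_cube algebra_simps)
  have cost: "T * (270 * T ^ 2 + 2) + 2 + 10 \<le> 290 * T ^ 3"
  proof -
    have "270 * A + 2 * T + 2 + 10 \<le> 290 * A" if "T \<le> A" "1 \<le> A" for A
      using that by simp
    from this[OF cube(1,2)] show ?thesis unfolding cube(3) .
  qed
  have "ends (tloop 35 check_first) (?R, M) (\<lambda>m (R', M'). m \<le> T * (270 * T ^ 2 + 2) + 2 \<and> M' = M \<and>
    (\<forall>r<35. R' r = ?R r) \<and>
    found_at (fold (\<lambda>t. fold (\<lambda>t'. test d1 d2 S vs q p v r s t t') (ticks T)) (ticks T) acc) R')"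
  proof (rule tloop[where A = found_at, OF _ env' acc'])
    fix i R' a
    assume i: "1 \<le> i" "i \<le> T" "\<forall>r<35. R' r = ?R r" "R' 35 = i" and a: "found_at a R'"
    have "bases R' q p v r s" by (rule bases_cong[OF B]) (use i in blast)
    from check_first[of R' q p v r s i a, OF this i(1,2,4) a]
    show "ends check_first (R', M) (\<lambda>m (R'', M'). m \<le> 270 * T ^ 2 \<and> M' = M \<and>
        (\<forall>r<Suc 35. R'' r = R' r) \<and>
        found_at (fold (\<lambda>t'. test d1 d2 S vs q p v r s i t') (ticks T) a) R'')" by simp
  qed (simp_all add: found_at_upd)
  then have "ends (tloop 35 check_first) (?R, M) (\<lambda>m (R', M'). Suc (Suc (Suc (Suc (Suc (Suc (Suc (Suc (Suc (Suc m))))))))) \<le> 290 * T ^ 3 \<and> M' = M \<and>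
    (\<forall>r<30. R' r = R r) \<and>
    found_at (fold (\<lambda>t. fold (\<lambda>t'. test d1 d2 S vs q p v r s t t') (ticks T)) (ticks T) acc) R')"
    by (rule ends_mono) (use cost in auto)
  moreover have "R 8 = P" using env by (simp add: env_def)
  ultimately show ?thesis
    using R by (simp add: check_walk_def row_base_def vertex_at_def ends_Seq ends_simps add_ac del: mult_Suc_right)
qed

abbreviation "walk_test q p v r s \<equiv> fold (\<lambda>t. fold (\<lambda>t'. test d1 d2 S vs q p v r s t t') (ticks T)) (ticks T)"

text \<open>A form of \<open>vloop\<close> that nests: cost bounds have the shape
  \<open>c * X\<close> inside and outside, and \<open>env\<close> is handed down.\<close>

lemma vloop_level:
  assumes env: "env R" and x: "9 \<le> x" "Suc x < 100" and acc: "found_at acc R" and n: "0 < n" and X: "1 \<le> X"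
    and body: "\<And>i R' a. i < n \<Longrightarrow> env R' \<Longrightarrow> (\<forall>r<x. R' r = R r) \<Longrightarrow> vertex_at R' x i \<Longrightarrow> found_at a R' \<Longrightarrow>
      ends p (R', M) (\<lambda>m (R'', M'). m \<le> c * X \<and> M' = M \<and> (\<forall>r<Suc (Suc x). R'' r = R' r) \<and>
        found_at (f i a) R'')"
  shows "ends (vloop x p) (R, M) (\<lambda>m (R', M'). m \<le> (c + 6) * (n * X) \<and> M' = M \<and> (\<forall>r<x. R' r = R r) \<and>
    found_at (fold f [0..<n] acc) R')"
proof -
  have "ends (vloop x p) (R, M) (\<lambda>m (R', M'). m \<le> n * (c * X + 3) + 3 \<and> M' = M \<and> (\<forall>r<x. R' r = R r) \<and>
    found_at (fold f [0..<n] acc) R')"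
  proof (rule vloop[where T = T and A = found_at])
    fix i R' a
    assume i: "i < n" "\<forall>r<x. R' r = R r" "R' x = i * Suc T" "R' (Suc x) = i * (n * Suc T)" "found_at a R'"
    have "env R'" by (rule env_cong[OF env]) (use i x in auto)
    then show "ends p (R', M) (\<lambda>m (R'', M'). m \<le> c * X \<and> M' = M \<and> (\<forall>r<Suc (Suc x). R'' r = R' r) \<and>
        found_at (f i a) R'')"
      using i by (intro body) (simp_all add: vertex_at_def)
  next
    show "found_at a (R'(x := v))" "found_at a (R'(Suc x := v))" if "found_at a R'" for a R' v
      using found_at_upd[OF that] x by simp_all
  qed (use env x acc in \<open>simp_all add: env_def\<close>)
  then show ?thesis
    by (rule ends_mono) (use loop_cost[OF n X, of c] in auto)
qed

lemma search_prog:
  assumes env: "env R" and n: "0 < n"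
  shows "ends search_prog (R, M) (\<lambda>m (R', M'). m \<le> 321 * (T ^ 3 * n ^ 5) \<and> M' = M \<and>
    (\<forall>r<20. R' r = R r) \<and> found_at (search d1 d2 S vs T None) R')"
proof -
  have X: "1 \<le> T ^ 3" "1 \<le> n * T ^ 3" "1 \<le> n * (n * T ^ 3)" "1 \<le> n * (n * (n * T ^ 3))"
    "1 \<le> n * (n * (n * (n * T ^ 3)))"
    using Suc_leI[OF n] T by simp_all
  note keep = vertex_at_cong
  have "ends (vloop 20 (vloop 22 (vloop 24 (vloop 26 (vloop 28 check_walk))))) (R(100 := 0), M)
    (\<lambda>m (R', M'). m \<le> ((((290 + 6) + 6) + 6) + 6 + 6) * (n * (n * (n * (n * (n * T ^ 3))))) \<and> M' = M \<and>
    (\<forall>r<20. R' r = (R(100 := 0)) r) \<and> found_at (search d1 d2 S vs T None) R')"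
    unfolding search_def
  proof (rule vloop_level)
    show "env (R(100 := 0))" by (rule env_cong[OF env]) simp
    show "found_at None (R(100 := 0))" by (simp add: found_at_def)
    fix q R1 a1
    assume q: "q < n" "env R1" "vertex_at R1 20 q" "found_at a1 R1"
    show "ends (vloop 22 (vloop 24 (vloop 26 (vloop 28 check_walk)))) (R1, M) (\<lambda>m (R', M').
      m \<le> ((((290 + 6) + 6) + 6) + 6) * (n * (n * (n * (n * T ^ 3)))) \<and> M' = M \<and>
      (\<forall>r<Suc (Suc 20). R' r = R1 r) \<and> found_at (fold (\<lambda>p. fold (\<lambda>v. fold (\<lambda>r. fold (\<lambda>s.
        walk_test q p v r s) [0..<n]) [0..<n]) [0..<n]) [0..<n] a1) R')"
      unfolding eval_nat_numeral(3)[symmetric] Suc_numeral add_num_simps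
    proof (rule vloop_level[OF q(2) _ _ q(4) n])
      fix p R2 a2
      assume p: "p < n" "env R2" "\<forall>r<22. R2 r = R1 r" "vertex_at R2 22 p" "found_at a2 R2"
      have q2: "vertex_at R2 20 q" by (rule keep[OF q(3)]) (use p in auto)
      show "ends (vloop 24 (vloop 26 (vloop 28 check_walk))) (R2, M) (\<lambda>m (R', M').
        m \<le> (((290 + 6) + 6) + 6) * (n * (n * (n * T ^ 3))) \<and> M' = M \<and>
        (\<forall>r<Suc (Suc 22). R' r = R2 r) \<and> found_at (fold (\<lambda>v. fold (\<lambda>r. fold (\<lambda>s.
          walk_test q p v r s) [0..<n]) [0..<n]) [0..<n] a2) R')"
        unfolding Suc_numeral add_num_simps
      proof (rule vloop_level[OF p(2) _ _ p(5) n])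
        fix v R3 a3
        assume v: "v < n" "env R3" "\<forall>r<24. R3 r = R2 r" "vertex_at R3 24 v" "found_at a3 R3"
        have v3: "vertex_at R3 20 q" by (rule keep[OF q2]) (use v in auto)
        have p3: "vertex_at R3 22 p" by (rule keep[OF p(4)]) (use v in auto)
        show "ends (vloop 26 (vloop 28 check_walk)) (R3, M) (\<lambda>m (R', M').
          m \<le> ((290 + 6) + 6) * (n * (n * T ^ 3)) \<and> M' = M \<and>
          (\<forall>r<Suc (Suc 24). R' r = R3 r) \<and> found_at (fold (\<lambda>r. fold (\<lambda>s.
            walk_test q p v r s) [0..<n]) [0..<n] a3) R')"
          unfolding Suc_numeral add_num_simps
        proof (rule vloop_level[OF v(2) _ _ v(5) n])
          fix r R4 a4
          assume r: "r < n" "env R4" "\<forall>r<26. R4 r = R3 r" "vertex_at R4 26 r" "found_at a4 R4"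
          have q4: "vertex_at R4 20 q" by (rule keep[OF v3]) (use r in auto)
          have p4: "vertex_at R4 22 p" by (rule keep[OF p3]) (use r in auto)
          have v4: "vertex_at R4 24 v" by (rule keep[OF v(4)]) (use r in auto)
          show "ends (vloop 28 check_walk) (R4, M) (\<lambda>m (R', M').
            m \<le> (290 + 6) * (n * T ^ 3) \<and> M' = M \<and>
            (\<forall>r<Suc (Suc 26). R' r = R4 r) \<and> found_at (fold (\<lambda>s. walk_test q p v r s) [0..<n] a4) R')"
            unfolding Suc_numeral add_num_simps
          proof (rule vloop_level[OF r(2) _ _ r(5) n X(1)])
            fix s R5 a5
            assume s: "s < n" "env R5" "\<forall>r<28. R5 r = R4 r" "vertex_at R5 28 s" "found_at a5 R5"
            have q5: "vertex_at R5 20 q" by (rule keep[OF q4]) (use s in auto)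
            have p5: "vertex_at R5 22 p" by (rule keep[OF p4]) (use s in auto)
            have v5: "vertex_at R5 24 v" by (rule keep[OF v4]) (use s in auto)
            have r5: "vertex_at R5 26 r" by (rule keep[OF r(4)]) (use s in auto)
            show "ends check_walk (R5, M) (\<lambda>m (R', M'). m \<le> 290 * T ^ 3 \<and> M' = M \<and>
              (\<forall>r<Suc (Suc 28). R' r = R5 r) \<and> found_at (walk_test q p v r s a5) R')"
              using check_walk[of R5 q p v r s a5, OF s(2) q(1) p(1) v(1) r(1) s(1) q5 p5 v5 r5 s(4,5)] by simp
          qed simp_all
        qed (use X Suc_leI[OF n] in simp_all)
      qed (use X Suc_leI[OF n] in simp_all)
    qed (use X Suc_leI[OF n] in simp_all)
  qed (use X n Suc_leI[OF n] in simp_all)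
  moreover have "1 + m \<le> 321 * (T ^ 3 * n ^ 5)"
    if "m \<le> ((((290 + 6) + 6) + 6) + 6 + 6) * (n * (n * (n * (n * (n * T ^ 3)))))" for m
  proof -
    have eq: "n * (n * (n * (n * (n * T ^ 3)))) = T ^ 3 * n ^ 5"
      by (simp add: eval_nat_numeral ac_simps)
    have one: "1 \<le> T ^ 3 * n ^ 5" using Suc_leI[OF n] T by simp
    have "1 + m \<le> 321 * A" if "1 \<le> A" "m \<le> ((((290 + 6) + 6) + 6) + 6 + 6) * A" for A using that by simp
    from this[OF one that[unfolded eq]] show ?thesis .
  qed
  ultimately have "ends (vloop 20 (vloop 22 (vloop 24 (vloop 26 (vloop 28 check_walk))))) (R(100 := 0), M)
    (\<lambda>m (R', M'). 1 + m \<le> 321 * (T ^ 3 * n ^ 5) \<and> M' = M \<and>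
    (\<forall>r<20. R' r = R r) \<and> found_at (search d1 d2 S vs T None) R')"
    by (elim ends_mono) (auto simp del: add_num_simps)
  then show ?thesis
    unfolding search_prog_def ends_Seq ends_simps .
qed

end

section \<open>Updating the time table\<close>

definition clear_prog :: ram where
  "clear_prog = Seq (Add 16 8 2) (WhileLess 16 12 (Seq (Store 16 2) (Add 16 16 1)))"

lemma clear_prog:
  assumes R: "R 1 = 1" "R 2 = 0" "R 8 = P" "R 12 = P + N"
  shows "ends clear_prog (R, M) (\<lambda>m (R', M'). m \<le> 3 * N + 2 \<and> (\<forall>r. r \<noteq> 16 \<longrightarrow> R' r = R r) \<and>
    M' = (\<lambda>a. if P \<le> a \<and> a < P + N then 0 else M a))"
proof -
  let ?I = "\<lambda>i (R', M'). (\<forall>r. r \<noteq> 16 \<longrightarrow> R' r = R r) \<and> R' 16 = P + i \<and>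
    M' = (\<lambda>a. if P \<le> a \<and> a < P + i then 0 else M a)"
  have "ends (WhileLess 16 12 (Seq (Store 16 2) (Add 16 16 1))) (R(16 := P), M)
    (\<lambda>m s'. m \<le> N * (2 + 1) + 1 \<and> ?I N s')"
  proof (rule ends_WhileLess[where I = ?I])
    fix i s assume i: "i < N" and I: "?I i s"
    obtain R' M' where s: "s = (R', M')" by (cases s)
    have R': "\<forall>r. r \<noteq> 16 \<longrightarrow> R' r = R r" "R' 16 = P + i" using I by (simp_all add: s)
    show "fst s 16 < fst s 12 \<and> ends (Seq (Store 16 2) (Add 16 16 1)) s (\<lambda>m s'. m \<le> 2 \<and> ?I (Suc i) s')"
      using R R' i I by (auto simp: s ends_Seq ends_simps fun_eq_iff)
  qed (use R in auto)
  then show ?thesis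
    unfolding clear_prog_def ends_Seq ends_simps using R
    by (simp add: case_prod_unfold) (erule ends_mono, auto)
qed

text \<open>Multiplication by repeated addition. The time is linear in the vertex position, which is
  affordable because it happens only while loading input triples.\<close>

definition stride_prog :: "nat \<Rightarrow> nat \<Rightarrow> ram" where
  "stride_prog x i = Seq (Const x 0) (Seq (Const (Suc x) 0) (Seq (Const 30 0)
     (WhileLess 30 i (Seq (Add x x 4) (Seq (Add (Suc x) (Suc x) 5) (Add 30 30 1))))))"

lemma stride_prog:
  assumes R: "R 1 = 1" "R 4 = a" "R 5 = b" and x: "5 < x" "Suc x < 30" "i < 30" "i \<noteq> x" "i \<noteq> Suc x"
  shows "ends (stride_prog x i) (R, M) (\<lambda>m (R', M'). m \<le> 4 * R i + 4 \<and> M' = M \<and>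
    (\<forall>r. r \<noteq> x \<and> r \<noteq> Suc x \<and> r \<noteq> 30 \<longrightarrow> R' r = R r) \<and> R' x = R i * a \<and> R' (Suc x) = R i * b)"
proof -
  let ?I = "\<lambda>j (R', M'). M' = M \<and> (\<forall>r. r \<noteq> x \<and> r \<noteq> Suc x \<and> r \<noteq> 30 \<longrightarrow> R' r = R r) \<and>
    R' x = j * a \<and> R' (Suc x) = j * b \<and> R' 30 = j"
  have "ends (WhileLess 30 i (Seq (Add x x 4) (Seq (Add (Suc x) (Suc x) 5) (Add 30 30 1))))
    (R(x := 0, Suc x := 0, 30 := 0), M) (\<lambda>m s'. m \<le> R i * (3 + 1) + 1 \<and> ?I (R i) s')"
  proof (rule ends_WhileLess[where I = ?I])
    fix j s assume j: "j < R i" and I: "?I j s"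
    obtain R' M' where s: "s = (R', M')" by (cases s)
    have R': "\<forall>r. r \<noteq> x \<and> r \<noteq> Suc x \<and> r \<noteq> 30 \<longrightarrow> R' r = R r" "R' 30 = j" "R' x = j * a"
      "R' (Suc x) = j * b" "M' = M"
      using I by (simp_all add: s)
    then have "R' 1 = 1" "R' 4 = a" "R' 5 = b" "R' i = R i" using R x by simp_all
    then show "fst s 30 < fst s i \<and> ends (Seq (Add x x 4) (Seq (Add (Suc x) (Suc x) 5) (Add 30 30 1))) s
        (\<lambda>m s'. m \<le> 3 \<and> ?I (Suc j) s')"
      using R R' j x by (simp add: s ends_Seq ends_simps)
  qed (use R x in auto)
  then show ?thesis
    unfolding stride_prog_def ends_Seq ends_simps
    by (rule ends_mono) auto
qed

lemma radix_unique:
  fixes a w :: nat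
  assumes "a + x * w = a' + x' * w" "a < w" "a' < w"
  shows "x = x'" "a = a'"
proof -
  have "(a + x * w) div w = x" "(a' + x' * w) div w = x'" using assms(2,3) by simp_all
  then show "x = x'" using assms(1) by simp
  then show "a = a'" using assms(1) by simp
qed

context machine
begin

definition addr :: "nat \<Rightarrow> nat \<Rightarrow> nat \<Rightarrow> nat" where
  "addr x y u = x * (n * Suc T) + y * Suc T + P + u"

lemma addr_ge: "P \<le> addr x y u"
  by (simp add: addr_def)

lemma addr_lt:
  assumes "x < n" "y < n" "u \<le> T"
  shows "addr x y u < P + n * (n * Suc T)"
proof -
  have "y * Suc T + u < Suc y * Suc T" using assms(3) by simp
  also have "\<dots> \<le> n * Suc T" using assms(2) by (intro mult_le_mono1) simp
  finally have "x * (n * Suc T) + (y * Suc T + u) < Suc x * (n * Suc T)" by simp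
  also have "\<dots> \<le> n * (n * Suc T)" using assms(1) by (intro mult_le_mono1) simp
  finally show ?thesis by (simp add: addr_def)
qed

lemma addr_inj:
  assumes "y < n" "y' < n" "u \<le> T" "u' \<le> T" "addr x y u = addr x' y' u'"
  shows "x = x' \<and> y = y' \<and> u = u'"
proof -
  have lt: "y * Suc T + u < n * Suc T" if "y < n" "u \<le> T" for y u
  proof -
    have "y * Suc T + u < Suc y * Suc T" using that by simp
    also have "\<dots> \<le> n * Suc T" using that by (intro mult_le_mono1) simp
    finally show ?thesis .
  qed
  have eq: "(y * Suc T + u) + x * (n * Suc T) = (y' * Suc T + u') + x' * (n * Suc T)"
    using assms(5) by (simp add: addr_def)
  note outer = radix_unique[OF eq lt[OF assms(1,3)] lt[OF assms(2,4)]]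
  then have "u + y * Suc T = u' + y' * Suc T" by linarith
  then have "y = y'" "u = u'" using radix_unique[of u y "Suc T" u' y'] assms(3,4) by simp_all
  then show ?thesis using outer(1) by simp
qed

lemma holds_table_addr:
  "holds_table vs T P S M \<longleftrightarrow> (\<forall>x<n. \<forall>y<n. \<forall>u. 1 \<le> u \<and> u \<le> T \<longrightarrow>
     M (addr x y u) = of_bool (({vs ! x, vs ! y}, u) \<in> S))"
  by (simp add: holds_table_def addr_def)

lemma pair_eq_iff:
  assumes "x < n" "y < n" "x' < n" "y' < n"
  shows "{vs ! x, vs ! y} = {vs ! x', vs ! y'} \<longleftrightarrow> (x = x' \<and> y = y') \<or> (x = y' \<and> y = x')"
  using assms distinct_vs by (auto simp: doubleton_eq_iff nth_eq_iff_index_eq)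

text \<open>Serves both for inserting an input time-edge and for toggling one: only membership of
  that time-edge may differ between \<open>S\<close> and \<open>S'\<close>.\<close>

lemma holds_table_update:
  assumes tab: "holds_table vs T P S M" and x: "x < n" "y < n" and u: "1 \<le> u" "u \<le> T"
    and S': "S' - {({vs ! x, vs ! y}, u)} = S - {({vs ! x, vs ! y}, u)}"
    and b: "b = of_bool (({vs ! x, vs ! y}, u) \<in> S')"
  shows "holds_table vs T P S' (M(addr x y u := b, addr y x u := b))"
  unfolding holds_table_addr
proof (intro allI impI, elim conjE)
  fix x' y' u' assume x': "x' < n" "y' < n" and u': "1 \<le> u'" "u' \<le> T"
  have old: "M (addr x' y' u') = of_bool (({vs ! x', vs ! y'}, u') \<in> S)"
    using tab x' u' by (simp add: holds_table_addr)
  have iff: "addr x' y' u' = addr x y u \<longleftrightarrow> x' = x \<and> y' = y \<and> u' = u"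
    "addr x' y' u' = addr y x u \<longleftrightarrow> x' = y \<and> y' = x \<and> u' = u"
    using addr_inj x x' u u' by blast+
  show "(M(addr x y u := b, addr y x u := b)) (addr x' y' u') = of_bool (({vs ! x', vs ! y'}, u') \<in> S')"
  proof (cases "({vs ! x', vs ! y'}, u') = ({vs ! x, vs ! y}, u)")
    case True
    then have "(x' = x \<and> y' = y \<or> x' = y \<and> y' = x) \<and> u' = u"
      using pair_eq_iff[OF x' x] by simp
    then have "addr x' y' u' = addr x y u \<or> addr x' y' u' = addr y x u" using iff by blast
    then show ?thesis using b unfolding True by (simp only: fun_upd_apply if_True) auto
  next
    case False
    then have "addr x' y' u' \<noteq> addr x y u" "addr x' y' u' \<noteq> addr y x u"
      unfolding iff by (auto simp: insert_commute)
    moreover have "({vs ! x', vs ! y'}, u') \<in> S' \<longleftrightarrow> ({vs ! x', vs ! y'}, u') \<in> S" using S' False by blast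
    ultimately show ?thesis using old by simp
  qed
qed

end

definition copy_pair :: "nat \<Rightarrow> nat \<Rightarrow> ram" where
  "copy_pair x y = Seq (Add 20 x 2) (Seq (Add 21 (Suc x) 2) (Seq (Add 22 y 2) (Add 23 (Suc y) 2)))"

text \<open>Division by \<open>T\<close> with at most four subtractions: whenever register
  \<open>30\<close> is still at least \<open>T\<close>, subtract and pass to the next pair. What
  remains is the remainder that encodes the time.\<close>

definition select_pair :: ram where
  "select_pair = Seq (copy_pair 101 103) (IfLess 30 3 Skip (Seq (Sub 30 30 3)
    (Seq (copy_pair 103 105) (IfLess 30 3 Skip (Seq (Sub 30 30 3)
    (Seq (copy_pair 105 107) (IfLess 30 3 Skip (Seq (Sub 30 30 3)
    (Seq (copy_pair 107 109) (IfLess 30 3 Skip (Seq (Sub 30 30 3)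
    (copy_pair 103 107))))))))))))"

text \<open>Toggles the cells of both orders. For \<open>x = y\<close> these are the same cell and
  the toggles cancel, as the case \<open>x = y\<close> of \<open>flip\<close> demands.\<close>

definition flip_prog :: ram where
  "flip_prog = Seq (Add 30 30 1) (Seq (Add 30 30 8)
    (Seq (Add 31 21 22) (Seq (Add 31 31 30) (Seq (Load 32 31) (Seq (Sub 32 1 32) (Seq (Store 31 32)
    (Seq (Add 31 23 20) (Seq (Add 31 31 30) (Seq (Load 32 31) (Seq (Sub 32 1 32) (Store 31 32)))))))))))"

definition branch_prog :: ram where
  "branch_prog = Seq (Load 30 14) (Seq select_pair flip_prog)"

context machine
begin

lemma select_pair:
  assumes env: "env R" and d: "R 30 = d" "d < 5 * T" and z: "found_at (Some z) R"
  shows "ends select_pair (R, M) (\<lambda>m (R', M'). m \<le> 30 \<and> M' = M \<and> (\<forall>r<20. R' r = R r) \<and>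
    (case branch_pair (d div T) z of (x, y) \<Rightarrow> vertex_at R' 20 x \<and> vertex_at R' 22 y) \<and> R' 30 = d mod T)"
proof -
  obtain q p v r s where z': "z = (q, p, v, r, s)" by (cases z)
  define i e where "i = d div T" and "e = d mod T"
  have e: "e < T" using T by (simp add: e_def)
  have "d = i * T + e" by (simp add: i_def e_def)
  have "i < 5" using d(2) by (simp add: i_def less_mult_imp_div_less)
  then consider "i = 0" | "i = 1" | "i = 2" | "i = 3" | "i = 4" by linarith
  then have "ends select_pair (R, M) (\<lambda>m (R', M'). m \<le> 30 \<and> M' = M \<and> (\<forall>r<20. R' r = R r) \<and>
    (case branch_pair i z of (x, y) \<Rightarrow> vertex_at R' 20 x \<and> vertex_at R' 22 y) \<and> R' 30 = e)"
    using env z e d(1) unfolding z' \<open>d = i * T + e\<close>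
    by cases (simp_all add: select_pair_def copy_pair_def ends_Seq ends_simps env_def found_at_def
        vertex_at_def)
  then show ?thesis by (simp only: i_def e_def)
qed

lemma flip_prog:
  assumes env: "env R" and x: "vertex_at R 20 x" "x < n" and y: "vertex_at R 22 y" "y < n"
    and u: "R 30 < T" and tab: "holds_table vs T P S M" and S: "S \<subseteq> vertex_pairs (set vs) \<times> {1..T}"
  shows "ends flip_prog (R, M) (\<lambda>m (R', M'). m \<le> 12 \<and> (\<forall>r<20. R' r = R r) \<and> (\<forall>a<P. M' a = M a) \<and>
    holds_table vs T P (if x = y then S else sym_diff S {({vs ! x, vs ! y}, R 30 + 1)}) M')"
proof -
  let ?u = "R 30 + 1"
  let ?a = "addr x y ?u" and ?a' = "addr y x ?u"
  let ?M' = "M(?a := 1 - M ?a)" 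
  let ?M'' = "?M'(?a' := 1 - ?M' ?a')"
  have R: "R 1 = 1" "R 8 = P" using env by (simp_all add: env_def)
  have addrs: "R 21 + R 22 + (?u + P) = ?a" "R 23 + R 20 + (?u + P) = ?a'"
    using x y by (simp_all add: vertex_at_def addr_def)
  have run: "ends flip_prog (R, M) (\<lambda>m (R', M'). m \<le> 12 \<and> (\<forall>r<20. R' r = R r) \<and> M' = ?M'')"
    using R addrs by (simp add: flip_prog_def ends_Seq ends_simps)
  have low: "\<forall>a<P. ?M'' a = M a"
    using addr_ge[of x y ?u] addr_ge[of y x ?u] by auto
  have "holds_table vs T P (if x = y then S else sym_diff S {({vs ! x, vs ! y}, ?u)}) ?M''"
  proof (cases "x = y")
    case True
    \<comment> \<open>With truncated subtraction, toggling twice restores a cell only if it holds at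
      most \<open>1\<close>; here it holds \<open>0\<close>.\<close>
    have "({vs ! x, vs ! x}, ?u) \<notin> S" using S by (auto simp: vertex_pairs_def)
    then have "M ?a = 0" using tab x u True by (simp add: holds_table_addr)
    then have "?M'' = M" using True by (simp add: fun_eq_iff)
    then show ?thesis using True tab by simp
  next
    case False
    have ne: "?a' \<noteq> ?a" using addr_inj[of x y ?u ?u y x] x y u False by auto
    have m: "M ?a = of_bool (({vs ! x, vs ! y}, ?u) \<in> S)" "M ?a' = of_bool (({vs ! x, vs ! y}, ?u) \<in> S)"
      using tab x(2) y(2) u unfolding holds_table_addr by (simp_all add: insert_commute)
    let ?S' = "sym_diff S {({vs ! x, vs ! y}, ?u)}"
    let ?b = "of_bool (({vs ! x, vs ! y}, ?u) \<in> ?S') :: nat"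
    have "1 - M ?a = ?b" "1 - ?M' ?a' = ?b" using m ne by simp_all
    then have "?M'' = M(?a := ?b, ?a' := ?b)" by simp
    moreover have "holds_table vs T P ?S' (M(?a := ?b, ?a' := ?b))"
      by (rule holds_table_update[OF tab x(2) y(2)]) (use u in auto)
    ultimately show ?thesis using False by simp
  qed
  with run low show ?thesis by (elim ends_mono) auto
qed

lemma branch_prog:
  assumes env: "env R" and d: "M (R 14) < 5 * T" and z: "found_at (Some z) R"
    and lt: "z = (q, p, v, r, s)" "q < n" "p < n" "v < n" "r < n" "s < n"
    and tab: "holds_table vs T P S M" and S: "S \<subseteq> vertex_pairs (set vs) \<times> {1..T}"
  shows "ends branch_prog (R, M) (\<lambda>m (R', M'). m \<le> 43 \<and> (\<forall>r<20. R' r = R r) \<and> (\<forall>a<P. M' a = M a) \<and>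
    holds_table vs T P (flip vs T S z (M (R 14))) M')"
proof -
  let ?d = "M (R 14)"
  let ?R = "R(30 := ?d)"
  obtain x y where xy: "branch_pair (?d div T) z = (x, y)" by fastforce
  then have "x < n" "y < n" using lt by (auto split: if_splits)
  have env': "env ?R" by (rule env_cong[OF env]) simp
  have "found_at (Some z) ?R" using z by (rule found_at_upd) simp
  from select_pair[OF env' _ d this, of M, unfolded xy prod.case]
  have "ends select_pair (?R, M) (\<lambda>m (R', M'). m \<le> 30 \<and> M' = M \<and> (\<forall>r<20. R' r = ?R r) \<and>
    (vertex_at R' 20 x \<and> vertex_at R' 22 y) \<and> R' 30 = ?d mod T)" by simp
  then obtain m1 R1 where x1: "exec select_pair (?R, M) m1 (R1, M)" "m1 \<le> 30"
    and R1: "\<forall>r<20. R1 r = ?R r" "vertex_at R1 20 x" "vertex_at R1 22 y" "R1 30 = ?d mod T"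
    by (rule endsE) blast
  have env1: "env R1" by (rule env_cong[OF env]) (use R1 in simp)
  have "R1 30 < T" using R1(4) T by simp
  from flip_prog[OF env1 R1(2) \<open>x < n\<close> R1(3) \<open>y < n\<close> this tab S]
  have "ends flip_prog (R1, M) (\<lambda>m (R', M'). 1 + (m1 + m) \<le> 43 \<and> (\<forall>r<20. R' r = R r) \<and>
    (\<forall>a<P. M' a = M a) \<and> holds_table vs T P (flip vs T S z ?d) M')"
    by (rule ends_mono) (use x1 R1 in \<open>auto simp: flip_def xy\<close>)
  from ends_exec_Seq[OF x1(1) this]
  show ?thesis unfolding branch_prog_def ends_Seq[of "Load 30 14"] ends_simps .
qed

end

section \<open>Counting through the branching sequences\<close>

definition digit :: "nat \<Rightarrow> nat \<Rightarrow> nat \<Rightarrow> nat" where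
  "digit b j i = (j div b ^ i) mod b"

lemma digits_exist:
  assumes "\<And>i. i < k \<Longrightarrow> \<sigma> i < b"
  shows "\<exists>j<b ^ k. \<forall>i<k. digit b j i = \<sigma> i"
  using assms
proof (induction k arbitrary: \<sigma>)
  case (Suc k)
  have "\<exists>j<b ^ k. \<forall>i<k. digit b j i = \<sigma> (Suc i)"
    by (rule Suc.IH) (simp add: Suc.prems)
  then obtain j where j: "j < b ^ k" "\<forall>i<k. digit b j i = \<sigma> (Suc i)" by blast
  have b: "\<sigma> 0 < b" using Suc.prems by simp
  have "digit b (\<sigma> 0 + b * j) i = \<sigma> i" if "i < Suc k" for i
  proof (cases i)
    case 0
    then show ?thesis using b by (simp add: digit_def)
  next
    case (Suc l)
    have "(\<sigma> 0 + b * j) div b = j" using b by simp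
    then have "(\<sigma> 0 + b * j) div b ^ Suc l = j div b ^ l" by (simp add: div_mult2_eq)
    then show ?thesis using j(2) Suc that by (simp add: digit_def)
  qed
  moreover have "\<sigma> 0 + b * j < b ^ Suc k"
  proof -
    have "\<sigma> 0 + b * j < b * Suc j" using b by simp
    also have "\<dots> \<le> b * b ^ k" using j(1) by (intro mult_le_mono2) simp
    finally show ?thesis by simp
  qed
  ultimately show ?case by blast
qed simp

text \<open>Position \<open>i\<close> receives a carry exactly if \<open>b ^ i\<close> divides
  \<open>Suc j\<close>; the second statement says that the carry is passed on exactly from the
  largest digit.\<close>

lemma digit_Suc:
  assumes "0 < b"
  shows "digit b (Suc j) i = (if b ^ i dvd Suc j
      then if Suc (digit b j i) < b then Suc (digit b j i) else 0 else digit b j i)"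
    and "b ^ Suc i dvd Suc j \<longleftrightarrow> b ^ i dvd Suc j \<and> \<not> Suc (digit b j i) < b"
proof -
  let ?q = "b ^ i"
  have q: "0 < ?q" using assms by simp
  have lt: "(j div ?q) mod b < b" using assms by simp
  have div: "Suc j div ?q = (if ?q dvd Suc j then Suc (j div ?q) else j div ?q)"
    by (simp add: div_Suc dvd_eq_mod_eq_0)
  show "digit b (Suc j) i = (if ?q dvd Suc j
      then if Suc (digit b j i) < b then Suc (digit b j i) else 0 else digit b j i)"
    using lt by (auto simp: digit_def div mod_Suc)
  have "b ^ Suc i dvd Suc j \<longleftrightarrow> ?q dvd Suc j \<and> b dvd Suc j div ?q"
  proof (cases "?q dvd Suc j")
    case True
    then obtain c where c: "Suc j = ?q * c" by (rule dvdE)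
    have "b ^ Suc i = ?q * b" by simp
    then show ?thesis using q assms unfolding c \<open>b ^ Suc i = ?q * b\<close> by simp
  next
    case False
    then have "\<not> b ^ Suc i dvd Suc j" using dvd_mult_right[of b ?q "Suc j"] unfolding power_Suc by blast
    then show ?thesis using False by blast
  qed
  moreover have "b dvd Suc j div ?q \<longleftrightarrow> \<not> Suc (digit b j i) < b" if "?q dvd Suc j"
  proof -
    have eq: "Suc j div ?q = Suc (j div ?q)" unfolding div using that by (rule if_P)
    have "b dvd Suc x \<longleftrightarrow> Suc (x mod b) = b" for x
      unfolding dvd_eq_mod_eq_0 mod_Suc by simp
    then have "b dvd Suc j div ?q \<longleftrightarrow> Suc (digit b j i) = b" unfolding eq digit_def .
    moreover have "Suc (digit b j i) \<le> b" using lt unfolding digit_def by (rule Suc_leI)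
    ultimately show ?thesis by linarith
  qed
  ultimately show "b ^ Suc i dvd Suc j \<longleftrightarrow> ?q dvd Suc j \<and> \<not> Suc (digit b j i) < b" by blast
qed

text \<open>Register \<open>16\<close> is the carry. A carry out of the last digit means that every
  sequence has been tried and clears register \<open>13\<close>.\<close>

definition next_prog :: ram where
  "next_prog = Seq (Const 16 1) (Seq (Sub 18 8 1) (Seq (Add 17 9 2) (Seq (WhileLess 17 18
     (Seq (IfLess 2 16 (Seq (Load 20 17) (Seq (Add 20 20 1)
        (IfLess 20 11 (Seq (Store 17 20) (Const 16 0)) (Store 17 2)))) Skip)
      (Add 17 17 1)))
     (Sub 13 1 16))))"

lemma next_prog:
  assumes R: "R 1 = 1" "R 2 = 0" "R 8 = D + k + 1" "R 9 = D" "R 11 = b" and b: "0 < b"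
    and M: "\<forall>i<k. M (D + i) = digit b j i" and j: "j < b ^ k"
  shows "ends next_prog (R, M) (\<lambda>m (R', M'). m \<le> 8 * k + 5 \<and> (\<forall>r<13. R' r = R r) \<and>
    R' 13 = flag (Suc j < b ^ k) \<and> (\<forall>i<k. M' (D + i) = digit b (Suc j) i) \<and>
    (\<forall>a. a < D \<or> D + k \<le> a \<longrightarrow> M' a = M a))"
proof -
  let ?body = "Seq (IfLess 2 16 (Seq (Load 20 17) (Seq (Add 20 20 1)
        (IfLess 20 11 (Seq (Store 17 20) (Const 16 0)) (Store 17 2)))) Skip) (Add 17 17 1)"
  let ?R = "R(16 := 1, 18 := D + k, 17 := D)"
  let ?I = "\<lambda>i (R', M'). (\<forall>r<13. R' r = R r) \<and> R' 18 = D + k \<and> R' 17 = D + i \<and>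
    R' 16 = of_bool (b ^ i dvd Suc j) \<and>
    M' = (\<lambda>a. if D \<le> a \<and> a < D + i then digit b (Suc j) (a - D) else M a)"
  have "ends (WhileLess 17 18 ?body) (?R, M) (\<lambda>m s'. m \<le> k * (7 + 1) + 1 \<and> ?I k s')"
  proof (rule ends_WhileLess[where I = ?I])
    fix i s assume i: "i < k" and I: "?I i s"
    obtain R' M' where s: "s = (R', M')" by (cases s)
    have R': "\<forall>r<13. R' r = R r" "R' 18 = D + k" "R' 17 = D + i" "R' 16 = of_bool (b ^ i dvd Suc j)"
      and M': "M' = (\<lambda>a. if D \<le> a \<and> a < D + i then digit b (Suc j) (a - D) else M a)"
      using I by (simp_all add: s)
    have regs: "R' 2 = 0" "R' (Suc 0) = Suc 0" "R' 11 = b" using R' R by simp_all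
    have dig: "M' (D + i) = digit b j i" using M i by (simp add: M')
    have upd: "M'(D + i := digit b (Suc j) i) =
      (\<lambda>a. if D \<le> a \<and> a < D + Suc i then digit b (Suc j) (a - D) else M a)"
      by (auto simp: M' fun_eq_iff less_Suc_eq)
    have "ends ?body s (\<lambda>m s'. m \<le> 7 \<and> ?I (Suc i) s')"
    proof (cases "b ^ i dvd Suc j")
      case False
      then have "M'(D + i := digit b (Suc j) i) = M'" using dig digit_Suc(1)[OF b, of j i] by auto
      then show ?thesis
        using False R' regs upd digit_Suc(2)[OF b, of i j]
        by (simp add: s ends_Seq ends_simps del: power_Suc)
    next
      case True
      show ?thesis
      proof (cases "Suc (digit b j i) < b")
        case lt: True
        then have "M'(D + i := Suc (digit b j i)) =
          (\<lambda>a. if D \<le> a \<and> a < D + Suc i then digit b (Suc j) (a - D) else M a)"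
          using upd digit_Suc(1)[OF b, of j i] True by simp
        then show ?thesis
          using True lt R' regs dig digit_Suc(2)[OF b, of i j]
          by (simp add: s ends_Seq ends_simps del: power_Suc)
      next
        case lt: False
        then have "M'(D + i := 0) =
          (\<lambda>a. if D \<le> a \<and> a < D + Suc i then digit b (Suc j) (a - D) else M a)"
          using upd digit_Suc(1)[OF b, of j i] True by simp
        then show ?thesis
          using True lt R' regs dig digit_Suc(2)[OF b, of i j]
          by (simp add: s ends_Seq ends_simps del: power_Suc)
      qed
    qed
    then show "fst s 17 < fst s 18 \<and> ends ?body s (\<lambda>m s'. m \<le> 7 \<and> ?I (Suc i) s')"
      using R' i by (simp add: s)
  qed auto
  \<comment> \<open>Since \<open>Suc j <= b ^ k\<close>, the only possible multiple is
    \<open>b ^ k\<close> itself.\<close>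
  moreover have "b ^ k dvd Suc j \<longleftrightarrow> \<not> Suc j < b ^ k"
    using j by (metis Suc_leI dvd_imp_le dvd_refl le_antisym not_le zero_less_Suc)
  ultimately have "ends (WhileLess 17 18 ?body) (?R, M) (\<lambda>m (R', M'). 3 + (m + 1) \<le> 8 * k + 5 \<and>
    R' 1 - R' 16 = flag (Suc j < b ^ k) \<and> (\<forall>r<13. R' r = R r) \<and>
    (\<forall>i<k. M' (D + i) = digit b (Suc j) i) \<and> (\<forall>a. a < D \<or> D + k \<le> a \<longrightarrow> M' a = M a))"
    by (elim ends_mono) (use R in \<open>auto simp: flag_def\<close>)
  then show ?thesis
    unfolding next_prog_def
    using R by (simp add: ends_Seq ends_simps) (erule ends_mono, auto simp: ends_simps)
qed

section \<open>The main program\<close>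

definition read_triple :: ram where
  "read_triple = Seq (Load 17 16) (Seq (Add 16 16 1) (Seq (Load 18 16) (Seq (Add 16 16 1)
    (Seq (Load 19 16) (Add 16 16 1)))))"

definition write_cells :: ram where
  "write_cells = Seq (Add 31 21 22) (Seq (Add 31 31 8) (Seq (Add 31 31 19) (Seq (Store 31 1)
    (Seq (Add 31 23 20) (Seq (Add 31 31 8) (Seq (Add 31 31 19) (Store 31 1)))))))"

text \<open>
  The input lies below the address \<open>D\<close>. It is followed by the \<open>k\<close> digits, in base \<open>5 T\<close>, of the
  current branching sequence, by one cell that stays zero (it is read by the branching step after
  the last search, whose result is never used), and by the time table. Register \<open>9\<close> holds \<open>D\<close>,
  \<open>10\<close> the budget \<open>k\<close>, \<open>11\<close> the base, \<open>12\<close> the end of the table, \<open>14\<close> the address of the next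
  digit and \<open>15\<close> the number \<open>n\<close> of vertices; \<open>13\<close> is positive until all sequences are tried.
\<close>

definition load_prog :: ram where
  "load_prog = Seq (Const 16 5) (WhileLess 16 9
    (Seq read_triple (Seq (stride_prog 20 17) (Seq (stride_prog 22 18) write_cells))))"

lemma read_triple:
  assumes "R 1 = 1" "M (R 16) = i" "M (R 16 + 1) = j" "M (R 16 + 2) = t"
  shows "ends read_triple (R, M) (\<lambda>m (R', M'). m \<le> 6 \<and> M' = M \<and> (\<forall>r<16. R' r = R r) \<and>
    R' 16 = R 16 + 3 \<and> R' 17 = i \<and> R' 18 = j \<and> R' 19 = t)"
  using assms by (simp add: read_triple_def ends_Seq ends_simps numeral_2_eq_2 numeral_3_eq_3)

text \<open>A search without a hit sets register \<open>0\<close>, which is never reset; so an early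
  success survives the rest of the replay and all later replays.\<close>

definition simulate_prog :: ram where
  "simulate_prog = Seq (Add 14 9 2) (WhileLess 14 8
    (Seq search_prog (Seq (IfLess 2 100 branch_prog (Const 0 1)) (Add 14 14 1))))"

definition try_all_prog :: ram where
  "try_all_prog = WhileLess 2 13 (Seq clear_prog (Seq load_prog (Seq simulate_prog next_prog)))"

definition read_prog :: ram where
  "read_prog = Seq (Const 1 1) (Seq (Load 15 2) (Seq (Const 16 1) (Seq (Load 17 16)
    (Seq (Const 16 2) (Seq (Load 10 16) (Seq (Const 16 3) (Seq (Load 6 16)
    (Seq (Const 16 4) (Seq (Load 7 16) (Seq (Const 16 5) (Seq (Add 9 16 17) (Seq (Add 9 9 17)
    (Seq (Add 9 9 17) (Seq (Add 8 9 10) (Add 8 8 1)))))))))))))))"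

definition lifetime_prog :: ram where
  "lifetime_prog = Seq (Const 16 5) (Seq (Const 18 3) (WhileLess 16 9
    (Seq (Add 17 16 1) (Seq (Add 17 17 1) (Seq (Load 17 17) (Seq (IfLess 3 17 (Add 3 17 2) Skip)
    (Add 16 16 18)))))))"

definition repeat_add :: "nat \<Rightarrow> nat \<Rightarrow> ram" where
  "repeat_add c d = Seq (Const 16 0) (WhileLess 16 15 (Seq (Add c c d) (Add 16 16 1)))"

text \<open>Register \<open>11\<close> becomes \<open>5 * T\<close> through \<open>2 * T\<close>,
  \<open>4 * T\<close> and \<open>4 * T + T\<close>; the table sizes come from adding
  \<open>n\<close> times.\<close>

definition sizes_prog :: ram where
  "sizes_prog = Seq (Add 4 3 1) (Seq (Add 11 3 3) (Seq (Add 11 11 11) (Seq (Add 11 11 3)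
    (Seq (repeat_add 5 4) (Seq (Add 12 8 2) (Seq (repeat_add 12 5) (Const 13 1)))))))"

definition main_prog :: ram where
  "main_prog = Seq read_prog (Seq lifetime_prog (Seq sizes_prog try_all_prog))"

section \<open>One replay, and the enumeration of all replays\<close>

locale encoding =
  fixes vs :: "'v list" and ts :: "(nat \<times> nat \<times> nat) list" and k T d1 d2 :: nat
  assumes distinct_vs: "distinct vs" and T: "1 \<le> T"
    and triples: "\<And>i j t. (i, j, t) \<in> set ts \<Longrightarrow> i < j \<and> j < length vs \<and> 1 \<le> t \<and> t \<le> T"
begin

definition "D = 5 + 3 * length ts"
definition "base = D + k + 1"

sublocale machine vs T d1 d2 base
  using distinct_vs T by unfold_locales

definition triple_edge :: "nat \<times> nat \<times> nat \<Rightarrow> 'v set \<times> nat" where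
  "triple_edge = (\<lambda>(i, j, t). ({vs ! i, vs ! j}, t))"

definition input_at :: "(nat \<Rightarrow> nat) \<Rightarrow> bool" where
  "input_at M \<longleftrightarrow> M 0 = n \<and> M 1 = length ts \<and> M 2 = k \<and> M 3 = d1 \<and> M 4 = d2 \<and>
     (\<forall>a<length ts. (M (5 + 3 * a), M (6 + 3 * a), M (7 + 3 * a)) = ts ! a)"

lemma input_at_cong:
  assumes "input_at M" "\<forall>a<D. M' a = M a"
  shows "input_at M'"
  using assms by (simp add: input_at_def D_def)

abbreviation "table S M \<equiv> holds_table vs T base S M"

definition main_env :: "(nat \<Rightarrow> nat) \<Rightarrow> bool" where
  "main_env R \<longleftrightarrow> env R \<and> R 9 = D \<and> R 11 = 5 * T \<and> R 12 = base + n * (n * Suc T)"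

lemma main_env_cong: "main_env R \<Longrightarrow> \<forall>r<13. 0 < r \<longrightarrow> R' r = R r \<Longrightarrow> main_env R'"
  by (simp add: main_env_def env_def)

abbreviation "low M M' \<equiv> (\<forall>a<base. M' a = M a)"

lemma clear_table:
  assumes "main_env R"
  shows "ends clear_prog (R, M) (\<lambda>m (R', M'). m \<le> 3 * (n * (n * Suc T)) + 2 \<and>
    (\<forall>r<16. R' r = R r) \<and> low M M' \<and> table {} M')"
proof -
  have R: "R 1 = 1" "R 2 = 0" "R 8 = base" "R 12 = base + n * (n * Suc T)"
    using assms by (simp_all add: main_env_def env_def)
  have z: "table {} (\<lambda>a. if base \<le> a \<and> a < base + n * (n * Suc T) then 0 else M a)"
    unfolding holds_table_addr
  proof (intro allI impI)
    fix x y u assume "x < n" "y < n" "1 \<le> u \<and> u \<le> T"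
    then show "(if base \<le> addr x y u \<and> addr x y u < base + n * (n * Suc T) then 0
        else M (addr x y u)) = of_bool (({vs ! x, vs ! y}, u) \<in> {})"
      using addr_ge[of x y u] addr_lt[of x y u] by simp
  qed
  show ?thesis
    by (rule ends_mono[OF clear_prog[OF R]]) (use z in auto)
qed

lemma load_table:
  assumes env: "main_env R" and input: "input_at M" and tab: "table {} M"
  shows "ends load_prog (R, M) (\<lambda>m (R', M'). m \<le> length ts * (8 * n + 23) + 2 \<and>
    (\<forall>r<16. R' r = R r) \<and> low M M' \<and> table (triple_edge ` set ts) M')"
proof -
  let ?body = "Seq read_triple (Seq (stride_prog 20 17) (Seq (stride_prog 22 18) write_cells))"
  let ?I = "\<lambda>a (R', M'). (\<forall>r<16. R' r = R r) \<and> R' 16 = 5 + 3 * a \<and> low M M' \<and>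
    table (triple_edge ` set (take a ts)) M'"
  have "ends (WhileLess 16 9 ?body) (R(16 := 5), M)
    (\<lambda>m s'. m \<le> length ts * ((8 * n + 22) + 1) + 1 \<and> ?I (length ts) s')"
  proof (rule ends_WhileLess[where I = ?I])
    fix a s assume a: "a < length ts" and I: "?I a s"
    obtain R' M' where s: "s = (R', M')" by (cases s)
    have R': "\<forall>r<16. R' r = R r" "R' 16 = 5 + 3 * a" and M': "low M M'"
      and tab': "table (triple_edge ` set (take a ts)) M'"
      using I by (simp_all add: s)
    obtain i j t where ijt: "ts ! a = (i, j, t)" by (cases "ts ! a")
    have lt: "i < j" "i < n" "j < n" "1 \<le> t" "t \<le> T"
      using triples[of i j t] a ijt nth_mem[OF a] by auto
    have "input_at M'" by (rule input_at_cong[OF input]) (use M' in \<open>simp add: base_def\<close>)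
    then have cells: "M' (5 + 3 * a) = i" "M' (6 + 3 * a) = j" "M' (7 + 3 * a) = t"
      using a ijt by (auto simp: input_at_def)
    have regs: "R' 1 = 1" "R' 2 = 0" "R' 4 = Suc T" "R' 5 = n * Suc T" "R' 8 = base" "R' 9 = D"
      using R'(1) env by (simp_all add: main_env_def env_def)
    have "M' (R' 16) = i" "M' (R' 16 + 1) = j" "M' (R' 16 + 2) = t"
    proof -
      have "5 + 3 * a + 1 = 6 + 3 * a" "5 + 3 * a + 2 = 7 + 3 * a" by simp_all
      then show "M' (R' 16) = i" "M' (R' 16 + 1) = j" "M' (R' 16 + 2) = t"
        unfolding R'(2) using cells by metis+
    qed
    from read_triple[OF regs(1) this]
    obtain m0 R0 where x0: "exec read_triple (R', M') m0 (R0, M')" "m0 \<le> 6"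
      and R0: "\<forall>r<16. R0 r = R' r" "R0 16 = R' 16 + 3" "R0 17 = i" "R0 18 = j" "R0 19 = t"
      by (rule endsE) blast
    have "ends (stride_prog 20 17) (R0, M') (\<lambda>m (R'', M''). m \<le> 4 * i + 4 \<and> M'' = M' \<and>
      (\<forall>r. r \<noteq> 20 \<and> r \<noteq> 21 \<and> r \<noteq> 30 \<longrightarrow> R'' r = R0 r) \<and> R'' 20 = i * Suc T \<and> R'' 21 = i * (n * Suc T))"
      using stride_prog[of R0 "Suc T" "n * Suc T" 20 17 M'] regs R0 by (simp del: mult_Suc_right)
    then obtain m1 R1 where x1: "exec (stride_prog 20 17) (R0, M') m1 (R1, M')" "m1 \<le> 4 * i + 4"
      and R1: "\<forall>r. r \<noteq> 20 \<and> r \<noteq> 21 \<and> r \<noteq> 30 \<longrightarrow> R1 r = R0 r" "R1 20 = i * Suc T"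
        "R1 21 = i * (n * Suc T)" by (rule endsE) blast
    have "ends (stride_prog 22 18) (R1, M') (\<lambda>m (R'', M''). m \<le> 4 * j + 4 \<and> M'' = M' \<and>
      (\<forall>r. r \<noteq> 22 \<and> r \<noteq> 23 \<and> r \<noteq> 30 \<longrightarrow> R'' r = R1 r) \<and> R'' 22 = j * Suc T \<and> R'' 23 = j * (n * Suc T))"
      using stride_prog[of R1 "Suc T" "n * Suc T" 22 18 M'] regs R0 R1 by (simp del: mult_Suc_right)
    then obtain m2 R2 where x2: "exec (stride_prog 22 18) (R1, M') m2 (R2, M')" "m2 \<le> 4 * j + 4"
      and R2: "\<forall>r. r \<noteq> 22 \<and> r \<noteq> 23 \<and> r \<noteq> 30 \<longrightarrow> R2 r = R1 r" "R2 22 = j * Suc T"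
        "R2 23 = j * (n * Suc T)" by (rule endsE) blast
    have regs2: "R2 1 = 1" "R2 8 = base" "R2 19 = t" "R2 20 = i * Suc T" "R2 21 = i * (n * Suc T)"
      using R0 R1 R2 regs by simp_all
    let ?M'' = "M'(addr i j t := 1, addr j i t := 1)"
    have "take (Suc a) ts = take a ts @ [(i, j, t)]" using a ijt by (simp add: take_Suc_conv_app_nth)
    then have S: "triple_edge ` set (take (Suc a) ts) =
      insert ({vs ! i, vs ! j}, t) (triple_edge ` set (take a ts))"
      by (simp add: triple_edge_def)
    have "table (triple_edge ` set (take (Suc a) ts)) ?M''"
      by (rule holds_table_update[OF tab' lt(2,3,4,5)]) (simp_all add: S)
    moreover have "low M ?M''"
      using M' addr_ge[of i j t] addr_ge[of j i t] by auto
    moreover have "\<forall>r<16. R2 r = R r" "R2 16 = 5 + 3 * Suc a" using R2 R1 R0 R' by simp_all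
    ultimately have I': "?I (Suc a) (R2(31 := addr j i t), ?M'')" by simp
    have addrs: "R2 21 + R2 22 + base + t = addr i j t" "R2 23 + R2 20 + base + t = addr j i t"
      using regs2 R2 by (simp_all add: addr_def del: mult_Suc_right)
    have "ends write_cells (R2, M') (\<lambda>m s'. m \<le> 8 \<and> s' = (R2(31 := addr j i t), ?M''))"
      using regs2(1-3) addrs by (simp add: write_cells_def ends_Seq ends_simps)
    then have tail: "ends write_cells (R2, M') (\<lambda>m s'. m0 + (m1 + (m2 + m)) \<le> 8 * n + 22 \<and> ?I (Suc a) s')"
      by (rule ends_mono) (use I' x0(2) x1(2) x2(2) lt in auto)
    have "ends ?body s (\<lambda>m s'. m \<le> 8 * n + 22 \<and> ?I (Suc a) s')"
      unfolding s
      by (rule ends_exec_Seq[OF x0(1)], rule ends_exec_Seq[OF x1(1)], rule ends_exec_Seq[OF x2(1)], rule tail)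
    then show "fst s 16 < fst s 9 \<and> ends ?body s (\<lambda>m s'. m \<le> 8 * n + 22 \<and> ?I (Suc a) s')"
      using R'(2) regs a by (simp add: s D_def)
  next
    show "?I 0 (R(16 := 5), M)" using tab by simp
    show "\<not> fst s 16 < fst s 9" if "?I (length ts) s" for s
      using that env by (cases s) (auto simp: main_env_def D_def)
  qed
  then show ?thesis
    unfolding load_prog_def ends_Seq[of "Const 16 5"] ends_simps
    by (rule ends_mono) (auto simp: algebra_simps)
qed

definition S0 :: "('v set \<times> nat) set" where
  "S0 = triple_edge ` set ts"

lemma S0_sub: "S0 \<subseteq> vertex_pairs (set vs) \<times> {1..T}"
proof
  fix z assume "z \<in> S0"
  then obtain i j t where ijt: "(i, j, t) \<in> set ts" "z = ({vs ! i, vs ! j}, t)"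
    unfolding S0_def triple_edge_def by auto
  then have lt: "i < j" "j < n" "1 \<le> t" "t \<le> T" using triples by blast+
  then have "vs ! i \<noteq> vs ! j" using distinct_vs by (simp add: nth_eq_iff_index_eq)
  then show "z \<in> vertex_pairs (set vs) \<times> {1..T}"
    using lt ijt(2) by (simp add: vertex_pairs_def)
qed

abbreviation "pick \<equiv> (\<lambda>S. search d1 d2 S vs T None)"

sublocale branching vs T d1 d2 pick
  by (rule branching_search[OF distinct_vs T])

text \<open>The value \<open>0\<close> from position \<open>k\<close> on mirrors the zero cell
  behind the digits.\<close>

definition \<sigma> :: "nat \<Rightarrow> nat \<Rightarrow> nat" where
  "\<sigma> j i = (if i < k then digit (5 * T) j i else 0)"

definition succeeds :: "nat \<Rightarrow> bool" where
  "succeeds j \<longleftrightarrow> (\<exists>i\<le>k. pick (steps S0 (\<sigma> j) i) = None)"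

lemma \<sigma>_less: "\<sigma> j i < 5 * T"
  using T by (simp add: \<sigma>_def digit_def)

text \<open>Numbers below \<open>(5 * T) ^ k\<close> run through all digit sequences of length
  \<open>k\<close>, and the first \<open>k\<close> levels read no other digits.\<close>

lemma fixable_iff_succeeds: "fixable (set vs) T d1 d2 k S0 \<longleftrightarrow> (\<exists>j<(5 * T) ^ k. succeeds j)"
  unfolding fixable_iff_steps[OF S0_sub]
proof
  assume "\<exists>\<tau>. (\<forall>i<k. \<tau> i < 5 * T) \<and> (\<exists>i\<le>k. pick (steps S0 \<tau> i) = None)"
  then obtain \<tau> i where \<tau>: "\<forall>i<k. \<tau> i < 5 * T" "i \<le> k" "pick (steps S0 \<tau> i) = None" by blast
  obtain j where j: "j < (5 * T) ^ k" "\<forall>i<k. digit (5 * T) j i = \<tau> i"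
    using digits_exist[of k \<tau> "5 * T"] \<tau>(1) by blast
  have "steps S0 (\<sigma> j) i = steps S0 \<tau> i"
    by (rule steps_cong) (use \<tau>(2) j(2) in \<open>simp add: \<sigma>_def\<close>)
  then have "succeeds j" unfolding succeeds_def using \<tau>(2,3) by metis
  then show "\<exists>j<(5 * T) ^ k. succeeds j" using j(1) by blast
next
  assume "\<exists>j<(5 * T) ^ k. succeeds j"
  then obtain j where "succeeds j" by blast
  then show "\<exists>\<tau>. (\<forall>i<k. \<tau> i < 5 * T) \<and> (\<exists>i\<le>k. pick (steps S0 \<tau> i) = None)"
    unfolding succeeds_def using \<sigma>_less by blast
qed

abbreviation "X \<equiv> T ^ 3 * n ^ 5"

lemma simulate_step:
  assumes env: "main_env R" and tab: "table (steps S0 (\<sigma> j) i) M" and n: "0 < n"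
    and i: "R 14 = D + i" "M (D + i) = \<sigma> j i" and ans: "R 0 = of_bool b"
  shows "ends (Seq search_prog (Seq (IfLess 2 100 branch_prog (Const 0 1)) (Add 14 14 1))) (R, M)
    (\<lambda>m (R', M'). m \<le> 321 * X + 45 \<and> (\<forall>r<14. 0 < r \<longrightarrow> R' r = R r) \<and> R' 14 = D + Suc i \<and>
      R' 0 = of_bool (b \<or> pick (steps S0 (\<sigma> j) i) = None) \<and> low M M' \<and>
      table (steps S0 (\<sigma> j) (Suc i)) M')"
proof -
  let ?S = "steps S0 (\<sigma> j) i"
  have S: "?S \<subseteq> vertex_pairs (set vs) \<times> {1..T}" by (rule steps_sub[OF S0_sub])
  interpret search_machine vs T d1 d2 base ?S M
    using S tab by unfold_locales
  have "env R" using env by (simp add: main_env_def)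
  from search_prog[OF this n]
  obtain m1 R1 where x1: "exec search_prog (R, M) m1 (R1, M)" "m1 \<le> 321 * X"
    and R1: "\<forall>r<20. R1 r = R r" "found_at (pick ?S) R1"
    by (rule endsE) blast
  have env1: "env R1" by (rule env_cong[OF \<open>env R\<close>]) (use R1 in simp)
  then have regs: "R1 2 = 0" "R1 (Suc 0) = Suc 0" by (simp_all add: env_def)
  have "ends (Seq (IfLess 2 100 branch_prog (Const 0 1)) (Add 14 14 1)) (R1, M)
    (\<lambda>m (R', M'). m1 + m \<le> 321 * X + 45 \<and> (\<forall>r<14. 0 < r \<longrightarrow> R' r = R r) \<and> R' 14 = D + Suc i \<and>
      R' 0 = of_bool (b \<or> pick ?S = None) \<and> low M M' \<and> table (steps S0 (\<sigma> j) (Suc i)) M')"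
  proof (cases "pick ?S")
    case None
    then have "steps S0 (\<sigma> j) (Suc i) = ?S" by (simp add: step_def)
    moreover have "R1 100 = 0" using R1(2) None by (simp add: found_at_def)
    ultimately show ?thesis
      using None R1(1) regs i tab x1(2) by (simp add: ends_Seq ends_simps)
  next
    case (Some z)
    obtain q p v r s where z: "z = (q, p, v, r, s)" by (cases z)
    have lt: "q < n" "p < n" "v < n" "r < n" "s < n"
      using pick_Some[OF Some[unfolded z]] by blast+
    have f: "found_at (Some z) R1" "R1 100 = 1" using R1(2) Some z by (simp_all add: found_at_def)
    have M14: "M (R1 14) = \<sigma> j i" using R1 i by simp
    from branch_prog[of R1 M z q p v r s ?S, OF env1 _ f(1) z lt tab S]
    have "ends branch_prog (R1, M) (\<lambda>m (R', M'). m \<le> 43 \<and> (\<forall>r<20. R' r = R1 r) \<and> low M M' \<and>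
      table (flip vs T ?S z (\<sigma> j i)) M')" unfolding M14 using \<sigma>_less by blast
    moreover have "steps S0 (\<sigma> j) (Suc i) = flip vs T ?S z (\<sigma> j i)" using Some by (simp add: step_def)
    ultimately have "ends branch_prog (R1, M) (\<lambda>m (R', M'). m \<le> 43 \<and> (\<forall>r<20. R' r = R1 r) \<and> low M M' \<and>
      table (steps S0 (\<sigma> j) (Suc i)) M')" by (simp only:)
    then have "ends branch_prog (R1, M) (\<lambda>m (R', M'). m1 + (Suc m + 1) \<le> 321 * X + 45 \<and>
      (\<forall>r<14. 0 < r \<longrightarrow> (R'(14 := R' 14 + R' 1)) r = R r) \<and> R' 14 + R' 1 = D + Suc i \<and>
      R' 0 = of_bool (b \<or> pick ?S = None) \<and> low M M' \<and> table (steps S0 (\<sigma> j) (Suc i)) M')"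
      by (rule ends_mono) (use R1(1) regs i ans x1(2) Some in \<open>auto simp del: steps.simps\<close>)
    then have "ends (IfLess 2 100 branch_prog (Const 0 1)) (R1, M) (\<lambda>m (R', M'). m1 + (m + 1) \<le> 321 * X + 45 \<and>
      (\<forall>r<14. 0 < r \<longrightarrow> (R'(14 := R' 14 + R' 1)) r = R r) \<and> R' 14 + R' 1 = D + Suc i \<and>
      R' 0 = of_bool (b \<or> pick ?S = None) \<and> low M M' \<and> table (steps S0 (\<sigma> j) (Suc i)) M')"
      unfolding ends_IfLess using regs f(2) by simp
    then show ?thesis
      by (rule ends_SeqI) (clarsimp simp: ends_simps simp del: steps.simps)
  qed
  from ends_exec_Seq[OF x1(1) this] show ?thesis .
qed

lemma simulate_prog:
  assumes env: "main_env R" and tab: "table S0 M" and n: "0 < n"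
    and digits: "\<forall>i\<le>k. M (D + i) = \<sigma> j i" and ans: "R 0 = of_bool b"
  shows "ends simulate_prog (R, M) (\<lambda>m (R', M'). m \<le> (k + 1) * (321 * X + 46) + 2 \<and>
    (\<forall>r<14. 0 < r \<longrightarrow> R' r = R r) \<and> R' 0 = of_bool (b \<or> succeeds j) \<and> low M M')"
proof -
  define hit where "hit i \<longleftrightarrow> pick (steps S0 (\<sigma> j) i) = None" for i
  let ?body = "Seq search_prog (Seq (IfLess 2 100 branch_prog (Const 0 1)) (Add 14 14 1))"
  let ?I = "\<lambda>i (R', M'). (\<forall>r<14. 0 < r \<longrightarrow> R' r = R r) \<and> R' 14 = D + i \<and>
    R' 0 = of_bool (b \<or> (\<exists>i'<i. hit i')) \<and> low M M' \<and>
    table (steps S0 (\<sigma> j) i) M'"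
  have regs: "R 8 = base" "R 9 = D" "R 2 = 0" using env by (simp_all add: main_env_def env_def)
  have "ends (WhileLess 14 8 ?body) (R(14 := D), M)
    (\<lambda>m s'. m \<le> (k + 1) * ((321 * X + 45) + 1) + 1 \<and> ?I (k + 1) s')"
  proof (rule ends_WhileLess[where I = ?I])
    fix i s assume i: "i < k + 1" and I: "?I i s"
    obtain R' M' where s: "s = (R', M')" by (cases s)
    have R': "\<forall>r<14. 0 < r \<longrightarrow> R' r = R r" "R' 14 = D + i" "low M M'" "table (steps S0 (\<sigma> j) i) M'"
      "R' 0 = of_bool (b \<or> (\<exists>i'<i. hit i'))"
      using I by (simp_all add: s)
    have env': "main_env R'" by (rule main_env_cong[OF env]) (use R'(1) in simp)
    have dig: "M' (D + i) = \<sigma> j i" using R'(3) i digits by (simp add: base_def)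
    have "ends ?body s (\<lambda>m s'. m \<le> 321 * X + 45 \<and> ?I (Suc i) s')"
      unfolding s
      by (rule ends_mono[OF simulate_step[OF env' R'(4) n R'(2) dig R'(5), folded hit_def]])
        (use R' in \<open>auto simp: less_Suc_eq simp del: steps.simps\<close>)
    then show "fst s 14 < fst s 8 \<and> ends ?body s (\<lambda>m s'. m \<le> 321 * X + 45 \<and> ?I (Suc i) s')"
      using R' i regs by (simp add: s base_def)
  next
    show "?I 0 (R(14 := D), M)" using ans tab by simp
    show "\<not> fst s 14 < fst s 8" if "?I (k + 1) s" for s
      using that regs by (cases s) (auto simp: base_def)
  qed
  then have "ends (WhileLess 14 8 ?body) (R(14 := D), M) (\<lambda>m (R', M').
    1 + m \<le> (k + 1) * (321 * X + 46) + 2 \<and> (\<forall>r<14. 0 < r \<longrightarrow> R' r = R r) \<and>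
    R' 0 = of_bool (b \<or> succeeds j) \<and> low M M')"
    by (rule ends_mono) (auto simp: succeeds_def hit_def[symmetric] less_Suc_eq_le add_ac simp del: steps.simps)
  then show ?thesis
    unfolding simulate_prog_def ends_Seq[of "Add 14 9 2"] ends_simps regs by simp
qed

definition layout :: "(nat \<Rightarrow> nat) \<Rightarrow> nat \<Rightarrow> bool" where
  "layout M j \<longleftrightarrow> input_at M \<and> (\<forall>i<k. M (D + i) = digit (5 * T) j i) \<and> M (D + k) = 0"

text \<open>Clearing, loading, replaying and counting; \<open>11\<close> collects their additive
  constants \<open>2 + 2 + 2 + 5\<close>.\<close>

definition round_cost :: nat where
  "round_cost = 3 * (n * (n * Suc T)) + length ts * (8 * n + 23) + (k + 1) * (321 * X + 46) + 8 * k + 11"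

lemma layout_low: "layout M j \<Longrightarrow> low M M' \<Longrightarrow> layout M' j"
  using input_at_cong[of M M'] by (simp add: layout_def base_def)

lemma try_one:
  assumes env: "main_env R" and lay: "layout M j" and n: "0 < n" and j: "j < (5 * T) ^ k"
    and ans: "R 0 = of_bool b"
  shows "ends (Seq clear_prog (Seq load_prog (Seq simulate_prog next_prog))) (R, M)
    (\<lambda>m (R', M'). m \<le> round_cost \<and> main_env R' \<and> R' 0 = of_bool (b \<or> succeeds j) \<and>
      R' 13 = of_bool (Suc j < (5 * T) ^ k) \<and> layout M' (Suc j))"
proof -
  from clear_table[OF env, of M] obtain m1 R1 M1 where
    x1: "exec clear_prog (R, M) m1 (R1, M1)" "m1 \<le> 3 * (n * (n * Suc T)) + 2"
    and R1: "\<forall>r<16. R1 r = R r" "low M M1" "table {} M1"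
    unfolding ends_def by auto
  have env1: "main_env R1" by (rule main_env_cong[OF env]) (use R1 in simp)
  have lay1: "layout M1 j" by (rule layout_low[OF lay R1(2)])
  then have "input_at M1" by (simp add: layout_def)
  from load_table[OF env1 this R1(3)] obtain m2 R2 M2 where
    x2: "exec load_prog (R1, M1) m2 (R2, M2)" "m2 \<le> length ts * (8 * n + 23) + 2"
    and R2: "\<forall>r<16. R2 r = R1 r" "low M1 M2" "table S0 M2"
    unfolding ends_def S0_def by auto
  have env2: "main_env R2" by (rule main_env_cong[OF env1]) (use R2 in simp)
  have lay2: "layout M2 j" by (rule layout_low[OF lay1 R2(2)])
  then have dig: "\<forall>i\<le>k. M2 (D + i) = \<sigma> j i" by (auto simp: layout_def \<sigma>_def)
  have ans2: "R2 0 = of_bool b" using ans R1 R2 by simp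
  from simulate_prog[OF env2 R2(3) n dig ans2] obtain m3 R3 M3 where
    x3: "exec simulate_prog (R2, M2) m3 (R3, M3)" "m3 \<le> (k + 1) * (321 * X + 46) + 2"
    and R3: "\<forall>r<14. 0 < r \<longrightarrow> R3 r = R2 r" "R3 0 = of_bool (b \<or> succeeds j)" "low M2 M3"
    unfolding ends_def by auto
  have env3: "main_env R3" by (rule main_env_cong[OF env2]) (use R3 in simp)
  have lay3: "layout M3 j" by (rule layout_low[OF lay2 R3(3)])
  have regs: "R3 1 = 1" "R3 2 = 0" "R3 8 = base" "R3 9 = D" "R3 11 = 5 * T"
    using env3 by (simp_all add: main_env_def env_def)
  note regs = regs[unfolded base_def]
  have digits: "\<forall>i<k. M3 (D + i) = digit (5 * T) j i" using lay3 by (simp add: layout_def)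
  have pos: "0 < 5 * T" using T by simp
  have "ends next_prog (R3, M3) (\<lambda>m (R', M'). m1 + (m2 + (m3 + m)) \<le> round_cost \<and> main_env R' \<and>
    R' 0 = of_bool (b \<or> succeeds j) \<and> R' 13 = of_bool (Suc j < (5 * T) ^ k) \<and> layout M' (Suc j))"
  proof (rule ends_mono[OF next_prog[OF regs pos digits j]], clarify)
    fix m R' M'
    assume m: "m \<le> 8 * k + 5" and R': "\<forall>r<13. R' r = R3 r" "R' 13 = flag (Suc j < (5 * T) ^ k)"
      and M': "\<forall>i<k. M' (D + i) = digit (5 * T) (Suc j) i" "\<forall>a. a < D \<or> D + k \<le> a \<longrightarrow> M' a = M3 a"
    have "main_env R'" by (rule main_env_cong[OF env3]) (use R' in simp)
    moreover have "input_at M'"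
      by (rule input_at_cong[of M3]) (use lay3 M' in \<open>auto simp: layout_def\<close>)
    then have "layout M' (Suc j)" using M' lay3 by (simp add: layout_def)
    moreover have "m1 + (m2 + (m3 + m)) \<le> round_cost"
      using m x1(2) x2(2) x3(2) unfolding round_cost_def by linarith
    ultimately show "m1 + (m2 + (m3 + m)) \<le> round_cost \<and> main_env R' \<and>
      R' 0 = of_bool (b \<or> succeeds j) \<and> R' 13 = of_bool (Suc j < (5 * T) ^ k) \<and> layout M' (Suc j)"
      using R' R3(2) by (simp add: flag_def)
  qed
  from ends_exec_Seq[OF x1(1) ends_exec_Seq[OF x2(1) ends_exec_Seq[OF x3(1) this]]]
  show ?thesis by simp
qed

lemma try_all:
  assumes env: "main_env R" and lay: "layout M 0" and n: "0 < n" and R: "R 0 = 0" "R 13 = 1"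
  shows "ends try_all_prog (R, M) (\<lambda>m (R', M'). m \<le> (5 * T) ^ k * (round_cost + 1) + 1 \<and>
    R' 0 = of_bool (fixable (set vs) T d1 d2 k S0))"
proof -
  let ?N = "(5 * T) ^ k"
  let ?I = "\<lambda>j (R', M'). main_env R' \<and> R' 0 = of_bool (\<exists>j'<j. succeeds j') \<and>
    R' 13 = of_bool (j < ?N) \<and> layout M' j"
  have N: "0 < ?N" using T by simp
  have "ends try_all_prog (R, M) (\<lambda>m s'. m \<le> ?N * (round_cost + 1) + 1 \<and> ?I ?N s')"
    unfolding try_all_prog_def
  proof (rule ends_WhileLess[where I = ?I])
    fix j s assume j: "j < ?N" and I: "?I j s"
    obtain R' M' where s: "s = (R', M')" by (cases s)
    have I': "main_env R'" "R' 0 = of_bool (\<exists>j'<j. succeeds j')" "R' 13 = of_bool (j < ?N)" "layout M' j"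
      using I by (simp_all add: s)
    have "R' 2 = 0" using I'(1) by (simp add: main_env_def env_def)
    then have "fst s 2 < fst s 13" using I'(3) j by (simp add: s)
    moreover have "ends (Seq clear_prog (Seq load_prog (Seq simulate_prog next_prog))) s
      (\<lambda>m s'. m \<le> round_cost \<and> ?I (Suc j) s')"
      unfolding s by (rule ends_mono[OF try_one[OF I'(1,4) n j I'(2)]]) (auto simp: less_Suc_eq)
    ultimately show "fst s 2 < fst s 13 \<and> ends (Seq clear_prog (Seq load_prog (Seq simulate_prog next_prog))) s
      (\<lambda>m s'. m \<le> round_cost \<and> ?I (Suc j) s')" by blast
  next
    show "?I 0 (R, M)" using env lay R N by simp
    show "\<not> fst s 2 < fst s 13" if "?I ?N s" for s using that by (cases s) auto
  qed
  then show ?thesis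
    unfolding fixable_iff_succeeds by (rule ends_mono) auto
qed

end

section \<open>Initialisation and running time\<close>

lemma nth_concat_triples:
  assumes "a < length ts"
  shows "concat (map (\<lambda>(i, j, t). [i, j, t]) ts) ! (3 * a) = fst (ts ! a)"
    and "concat (map (\<lambda>(i, j, t). [i, j, t]) ts) ! (3 * a + 1) = fst (snd (ts ! a))"
    and "concat (map (\<lambda>(i, j, t). [i, j, t]) ts) ! (3 * a + 2) = snd (snd (ts ! a))"
proof -
  have "concat (map (\<lambda>(i, j, t). [i, j, t]) ts) ! (3 * a) = fst (ts ! a) \<and>
    concat (map (\<lambda>(i, j, t). [i, j, t]) ts) ! (3 * a + 1) = fst (snd (ts ! a)) \<and>
    concat (map (\<lambda>(i, j, t). [i, j, t]) ts) ! (3 * a + 2) = snd (snd (ts ! a))"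
    using assms
  proof (induction ts arbitrary: a)
    case (Cons x ts)
    obtain i j t where x: "x = (i, j, t)" by (cases x)
    show ?case
    proof (cases a)
      case 0
      then show ?thesis by (simp add: x numeral_2_eq_2)
    next
      case (Suc b)
      have "3 * a = Suc (Suc (Suc (3 * b)))" using Suc by simp
      then show ?thesis using Cons.IH[of b] Cons.prems Suc by (simp add: x numeral_2_eq_2)
    qed
  qed simp
  then show "concat (map (\<lambda>(i, j, t). [i, j, t]) ts) ! (3 * a) = fst (ts ! a)"
    and "concat (map (\<lambda>(i, j, t). [i, j, t]) ts) ! (3 * a + 1) = fst (snd (ts ! a))"
    and "concat (map (\<lambda>(i, j, t). [i, j, t]) ts) ! (3 * a + 2) = snd (snd (ts ! a))" by auto
qed

lemma length_concat_triples: "length (concat (map (\<lambda>(i, j, t). [i, j, t]) ts)) = 3 * length ts"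
  by (induction ts) auto

lemma repeat_add:
  assumes R: "R 1 = 1" "R 2 = 0" and c: "c < 15" "d < 15" "c \<noteq> d" "c \<noteq> 1"
  shows "ends (repeat_add c d) (R, M)
    (\<lambda>m (R', M'). m \<le> 3 * R 15 + 2 \<and> M' = M \<and> (\<forall>r<16. r \<noteq> c \<longrightarrow> R' r = R r) \<and>
      R' c = R c + R 15 * R d)"
proof -
  let ?I = "\<lambda>i (R', M'). M' = M \<and> (\<forall>r<16. r \<noteq> c \<longrightarrow> R' r = R r) \<and> R' 16 = i \<and> R' c = R c + i * R d"
  have "ends (WhileLess 16 15 (Seq (Add c c d) (Add 16 16 1))) (R(16 := 0), M)
    (\<lambda>m s'. m \<le> R 15 * (2 + 1) + 1 \<and> ?I (R 15) s')"
  proof (rule ends_WhileLess[where I = ?I])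
    fix i s assume i: "i < R 15" and I: "?I i s"
    obtain R' M' where s: "s = (R', M')" by (cases s)
    have R': "\<forall>r<16. r \<noteq> c \<longrightarrow> R' r = R r" "R' 16 = i" "R' c = R c + i * R d" "M' = M"
      using I by (simp_all add: s)
    then have "R' (Suc 0) = Suc 0" "R' 15 = R 15" "R' d = R d" using R c by auto
    then show "fst s 16 < fst s 15 \<and> ends (Seq (Add c c d) (Add 16 16 1)) s (\<lambda>m s'. m \<le> 2 \<and> ?I (Suc i) s')"
      using R' i c by (simp add: s ends_Seq ends_simps)
  qed (use c in auto)
  then show ?thesis
    unfolding repeat_add_def ends_Seq ends_simps by (rule ends_mono) auto
qed

context encoding
begin

definition sized :: "(nat \<Rightarrow> nat) \<Rightarrow> nat \<Rightarrow> bool" where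
  "sized R t \<longleftrightarrow> R 0 = 0 \<and> R 1 = 1 \<and> R 2 = 0 \<and> R 3 = t \<and> R 5 = 0 \<and> R 6 = d1 \<and> R 7 = d2 \<and>
     R 8 = base \<and> R 9 = D \<and> R 15 = n"

lemma read_prog:
  assumes "input_at M"
  shows "ends read_prog ((\<lambda>_. 0), M) (\<lambda>m (R', M'). m \<le> 16 \<and> M' = M \<and> sized R' 0)"
proof -
  have "M 0 = n" "M (Suc 0) = length ts" "M 2 = k" "M 3 = d1" "M 4 = d2"
    using assms by (simp_all add: input_at_def)
  then show ?thesis
    by (simp add: read_prog_def ends_Seq ends_simps sized_def base_def D_def)
qed

text \<open>The inserted \<open>0\<close> is the initial value of register \<open>3\<close> and
  takes care of the empty prefix.\<close>

definition latest :: "nat \<Rightarrow> nat" where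
  "latest a = Max (insert 0 (snd ` snd ` set (take a ts)))"

lemma latest_Suc:
  assumes "a < length ts"
  shows "latest (Suc a) = max (latest a) (snd (snd (ts ! a)))"
proof -
  have "insert 0 (snd ` snd ` set (take (Suc a) ts)) =
    insert (snd (snd (ts ! a))) (insert 0 (snd ` snd ` set (take a ts)))"
    using assms by (auto simp: take_Suc_conv_app_nth)
  then show ?thesis
    unfolding latest_def by (metis List.finite_set Max_insert finite_imageI finite_insert insert_not_empty max.commute)
qed

lemma lifetime_prog:
  assumes "input_at M" and R: "sized R 0"
  shows "ends lifetime_prog (R, M) (\<lambda>m (R', M'). m \<le> 7 * length ts + 3 \<and> M' = M \<and>
    sized R' (latest (length ts)))"
proof -
  let ?body = "Seq (Add 17 16 1) (Seq (Add 17 17 1) (Seq (Load 17 17)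
    (Seq (IfLess 3 17 (Add 3 17 2) Skip) (Add 16 16 18))))"
  let ?I = "\<lambda>a (R', M'). M' = M \<and> sized R' (latest a) \<and> R' 16 = 5 + 3 * a \<and> R' 18 = 3"
  have "ends (WhileLess 16 9 ?body) (R(16 := 5, 18 := 3), M)
    (\<lambda>m s'. m \<le> length ts * (6 + 1) + 1 \<and> ?I (length ts) s')"
  proof (rule ends_WhileLess[where I = ?I])
    show "?I 0 (R(16 := 5, 18 := 3), M)" using R by (simp add: sized_def latest_def)
    show "\<not> fst s 16 < fst s 9" if "?I (length ts) s" for s
      using that by (cases s) (auto simp: sized_def D_def)
    fix a s assume a: "a < length ts" and I: "?I a s"
    obtain R' M' where s: "s = (R', M')" by (cases s)
    have R': "sized R' (latest a)" "R' 16 = 5 + 3 * a" "R' 18 = 3" "M' = M" using I by (simp_all add: s)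
    have "(M (5 + 3 * a), M (6 + 3 * a), M (7 + 3 * a)) = ts ! a"
      using assms(1) a by (simp add: input_at_def)
    then have "snd (snd (ts ! a)) = M (7 + 3 * a)" by (metis snd_conv)
    moreover have "7 + 3 * a = Suc (Suc (5 + 3 * a))" by simp
    ultimately have "snd (snd (ts ! a)) = M (Suc (Suc (5 + 3 * a)))" by (simp only:)
    then have "latest (Suc a) = max (latest a) (M (Suc (Suc (5 + 3 * a))))"
      using latest_Suc[OF a] by simp
    then show "fst s 16 < fst s 9 \<and> ends ?body s (\<lambda>m s'. m \<le> 6 \<and> ?I (Suc a) s')"
      using R' a by (simp add: s ends_Seq ends_simps sized_def D_def max_def)
  qed
  then show ?thesis
    unfolding lifetime_prog_def ends_Seq[of "Const 16 5"] ends_Seq[of "Const 18 3"] ends_simps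
    by (rule ends_mono) auto
qed

lemma sizes_prog:
  assumes R: "sized R T"
  shows "ends sizes_prog (R, M) (\<lambda>m (R', M'). m \<le> 6 * n + 10 \<and> M' = M \<and> main_env R' \<and>
    R' 0 = 0 \<and> R' 13 = 1)"
proof -
  let ?R = "R(4 := Suc T, 11 := T + T + (T + T) + T)"
  have "ends (repeat_add 5 4) (?R, M)
    (\<lambda>m (R', M'). m \<le> 3 * n + 2 \<and> M' = M \<and> (\<forall>r<16. r \<noteq> 5 \<longrightarrow> R' r = ?R r) \<and> R' 5 = n * Suc T)"
    using repeat_add[of ?R 5 4 M] R by (simp add: sized_def)
  then obtain m1 R1 where x1: "exec (repeat_add 5 4)
      (?R, M) m1 (R1, M)" "m1 \<le> 3 * n + 2"
    and R1: "\<forall>r<16. r \<noteq> 5 \<longrightarrow> R1 r = ?R r" "R1 5 = n * Suc T"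
    by (rule endsE) blast
  let ?R1 = "R1(12 := base)"
  have r1: "R1 2 = 0" "R1 8 = base" using R R1 by (simp_all add: sized_def)
  have "ends (repeat_add 12 5) (?R1, M)
    (\<lambda>m (R', M'). m \<le> 3 * n + 2 \<and> M' = M \<and> (\<forall>r<16. r \<noteq> 12 \<longrightarrow> R' r = ?R1 r) \<and>
      R' 12 = base + n * (n * Suc T))"
    using repeat_add[of ?R1 12 5 M] R R1 by (simp add: sized_def)
  then obtain m2 R2 where x2: "exec (repeat_add 12 5)
      (?R1, M) m2 (R2, M)" "m2 \<le> 3 * n + 2"
    and R2: "\<forall>r<16. r \<noteq> 12 \<longrightarrow> R2 r = ?R1 r" "R2 12 = base + n * (n * Suc T)"
    by (rule endsE) blast
  have env: "main_env (R2(13 := 1)) \<and> R2 0 = 0"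
    using R R1 R2 by (simp add: main_env_def env_def sized_def)
  then have "ends (Const 13 1) (R2, M) (\<lambda>m (R', M'). 5 + (m1 + (m2 + m)) \<le> 6 * n + 10 \<and> M' = M \<and>
    main_env R' \<and> R' 0 = 0 \<and> R' 13 = 1)"
    using x1(2) x2(2) by (simp add: ends_simps)
  note tail = ends_exec_Seq[OF x2(1), of _ "\<lambda>m (R', M'). 5 + (m1 + m) \<le> 6 * n + 10 \<and> M' = M \<and>
    main_env R' \<and> R' 0 = 0 \<and> R' 13 = 1", OF this]
  have "ends (Seq (Add 12 8 2) (Seq (repeat_add 12 5) (Const 13 1))) (R1, M)
    (\<lambda>m (R', M'). 4 + (m1 + m) \<le> 6 * n + 10 \<and> M' = M \<and> main_env R' \<and> R' 0 = 0 \<and> R' 13 = 1)"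
    unfolding ends_Seq[of "Add 12 8 2"] ends_simps r1 using tail by simp
  from ends_exec_Seq[OF x1(1), of _ "\<lambda>m (R', M'). 4 + m \<le> 6 * n + 10 \<and> M' = M \<and>
    main_env R' \<and> R' 0 = 0 \<and> R' 13 = 1", OF this]
  have "ends (Seq (repeat_add 5 4) (Seq (Add 12 8 2) (Seq (repeat_add 12 5) (Const 13 1)))) (?R, M)
    (\<lambda>m (R', M'). 4 + m \<le> 6 * n + 10 \<and> M' = M \<and> main_env R' \<and> R' 0 = 0 \<and> R' 13 = 1)" .
  moreover have "R 3 = T" "R 1 = 1" using R by (simp_all add: sized_def)
  ultimately show ?thesis
    unfolding sizes_prog_def ends_Seq[of "Add 4 3 1"] ends_Seq[of "Add 11 3 3"]
      ends_Seq[of "Add 11 11 11"] ends_Seq[of "Add 11 11 3"] ends_simps by simp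
qed

lemma main_prog:
  assumes input: "input_at M" and zero: "\<And>a. D \<le> a \<Longrightarrow> M a = 0" and n: "0 < n"
    and latest: "latest (length ts) = T"
  shows "ends main_prog ((\<lambda>_. 0), M) (\<lambda>m (R', M').
    m \<le> 7 * length ts + 6 * n + 30 + (5 * T) ^ k * (round_cost + 1) \<and>
    R' 0 = of_bool (fixable (set vs) T d1 d2 k S0))"
proof -
  from endsE[OF read_prog[OF input]] obtain m1 R1 where
    x1: "exec read_prog ((\<lambda>_. 0), M) m1 (R1, M)" "m1 \<le> 16" and R1: "sized R1 0" by blast
  from endsE[OF lifetime_prog[OF input R1]] obtain m2 R2 where
    x2: "exec lifetime_prog (R1, M) m2 (R2, M)" "m2 \<le> 7 * length ts + 3" and R2: "sized R2 T"
    unfolding latest by blast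
  from endsE[OF sizes_prog[OF R2]] obtain m3 R3 where
    x3: "exec sizes_prog (R2, M) m3 (R3, M)" "m3 \<le> 6 * n + 10"
    and R3: "main_env R3" "R3 0 = 0" "R3 13 = 1" by blast
  have lay: "layout M 0" using input zero by (simp add: layout_def digit_def)
  have "ends try_all_prog (R3, M) (\<lambda>m (R', M').
    m1 + (m2 + (m3 + m)) \<le> 7 * length ts + 6 * n + 30 + (5 * T) ^ k * (round_cost + 1) \<and>
    R' 0 = of_bool (fixable (set vs) T d1 d2 k S0))"
    by (rule ends_mono[OF try_all[OF R3(1) lay n R3(2,3)]]) (use x1(2) x2(2) x3(2) in auto)
  from ends_exec_Seq[OF x1(1) ends_exec_Seq[OF x2(1) ends_exec_Seq[OF x3(1) this]]]
  show ?thesis unfolding main_prog_def .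
qed

text \<open>As \<open>length ts <= n^2 * T\<close>, loading and clearing are bounded by multiples of
  \<open>X\<close>, so one round costs at most \<open>424 * (k + 1) * X\<close> with
  \<open>424 = 6 + 31 + 321 + 46 + 8 + 12\<close>. Initialisation adds \<open>7 + 6 + 30\<close>,
  which makes \<open>467\<close>.\<close>

lemma total_cost:
  assumes n: "0 < n" and m: "length ts \<le> n * (n * T)"
  shows "7 * length ts + 6 * n + 30 + (5 * T) ^ k * (round_cost + 1) \<le> 467 * ((10 * T) ^ k * X)"
proof -
  have T2: "T ^ 3 = T * (T * T)" by (simp add: power3_eq_cube)
  have n2: "n ^ 5 = n * (n * (n * (n * n)))" by (simp add: eval_nat_numeral)
  have n1: "1 \<le> n" using Suc_leI[OF n] by (simp only: One_nat_def)
  have "n * (n * n * T) \<le> n * (n * n * T) * (n * n * (T * T))" using n1 T by simp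
  also have "\<dots> = X" unfolding T2 n2 by (simp add: ac_simps)
  finally have cube: "n * (n * n * T) \<le> X" .
  have sq: "n * (n * T) \<le> n * (n * n * T)" using n1 by simp
  have "n \<le> n * (n * T)" using n1 T by simp
  then have nX: "n \<le> X" using sq cube by linarith
  have X1: "1 \<le> X" using nX n1 by linarith
  have mX: "length ts \<le> X" using m sq cube by linarith
  have "n * (n * Suc T) \<le> 2 * (n * (n * T))" using T by (simp add: algebra_simps)
  then have a: "n * (n * Suc T) \<le> 2 * X" using sq cube by linarith
  have "n * length ts \<le> n * (n * (n * T))" using m by (rule mult_le_mono2)
  also have "\<dots> = n * (n * n * T)" by simp
  finally have "n * length ts \<le> X" using cube by (rule order_trans)
  then have b: "length ts * (8 * n + 23) \<le> 31 * X" using mX by (simp add: algebra_simps)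
  let ?K = "(k + 1) * X"
  have K: "X \<le> ?K" "k + 1 \<le> ?K"
    using mult_le_mono1[of 1 "k + 1" X] mult_le_mono2[OF X1, of "k + 1"] by (simp_all only: mult_1 mult_1_right le_add2)
  have "(k + 1) * (321 * X + 46) = 321 * ?K + 46 * (k + 1)" by (simp add: algebra_simps)
  moreover have "3 * A + B + (321 * Q + 46 * (k + 1)) + 8 * k + 11 + 1 \<le> 424 * Q"
    if "A \<le> 2 * Y" "B \<le> 31 * Y" "Y \<le> Q" "k + 1 \<le> Q" "1 \<le> Y" for A B Q Y
    using that by simp
  from this[OF a b K X1] have "3 * (n * (n * Suc T)) + length ts * (8 * n + 23) +
    (321 * ?K + 46 * (k + 1)) + 8 * k + 11 + 1 \<le> 424 * ?K" .
  ultimately have "round_cost + 1 \<le> 424 * ?K"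
    unfolding round_cost_def by (simp only:)
  then have "(5 * T) ^ k * (round_cost + 1) \<le> (5 * T) ^ k * (424 * ?K)" by (rule mult_le_mono2)
  also have "\<dots> = 424 * ((5 * T) ^ k * ?K)" by (simp only: mult.left_commute)
  finally have rounds: "(5 * T) ^ k * (round_cost + 1) \<le> 424 * ((5 * T) ^ k * ?K)" .
  have Xle: "X \<le> (5 * T) ^ k * ?K"
  proof -
    have "1 * X \<le> (5 * T) ^ k * ?K" by (rule mult_le_mono[OF _ K(1)]) (use T in simp)
    then show ?thesis by simp
  qed
  have "7 * A + 6 * B + 30 + C \<le> 467 * Q"
    if "A \<le> Y" "B \<le> Y" "1 \<le> Y" "C \<le> 424 * Q" "Y \<le> Q" for A B C Q Y :: nat
    using that by simp
  from this[OF mX nX X1 rounds Xle]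
  have "7 * length ts + 6 * n + 30 + (5 * T) ^ k * (round_cost + 1) \<le> 467 * ((5 * T) ^ k * ?K)" .
  also have "\<dots> \<le> 467 * ((5 * T) ^ k * (2 ^ k * X))"
    \<comment> \<open>Here \<open>k + 1 <= 2 ^ k\<close> turns the base \<open>5 * T\<close> into
      \<open>10 * T\<close>.\<close>
    using Suc_leI[OF less_exp[of k]] by (intro mult_le_mono2 mult_le_mono1) (simp only: Suc_eq_plus1)
  also have "(5 * T) ^ k * (2 ^ k * X) = (10 * T) ^ k * X"
  proof -
    have "(10 * T) ^ k = (5 * T * 2) ^ k" by (simp add: mult.commute)
    also have "\<dots> = (5 * T) ^ k * 2 ^ k" by (rule power_mult_distrib)
    finally show ?thesis by (simp only: mult.assoc)
  qed
  finally show ?thesis .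
qed

end

theorem theorem5:
  "\<exists>(p :: ram) (c :: nat).
     \<forall>(G :: nat temporal_graph) k \<Delta>1 \<Delta>2 w.
       ETC_instance G k \<Delta>1 \<Delta>2 \<longrightarrow> encodes w G k \<Delta>1 \<Delta>2 \<longrightarrow>
       decides_within p w (ETC G k \<Delta>1 \<Delta>2)
         (c * ((10 * lifetime G) ^ k * lifetime G ^ 3 * card (verts G) ^ 5))"
proof (intro exI[of _ main_prog] exI[of _ 467] allI impI)
  fix G :: "nat temporal_graph" and k \<Delta>1 \<Delta>2 w
  assume inst: "ETC_instance G k \<Delta>1 \<Delta>2" and "encodes w G k \<Delta>1 \<Delta>2"
  then obtain vs ts where vs: "distinct vs" "set vs = verts G" and ts: "distinct ts"
    and lt: "\<forall>(i, j, t)\<in>set ts. i < j \<and> j < length vs"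
    and S: "(\<lambda>(i, j, t). ({vs ! i, vs ! j}, t)) ` set ts = time_edges G"
    and w: "w = [length vs, length ts, k, \<Delta>1, \<Delta>2] @ concat (map (\<lambda>(i, j, t). [i, j, t]) ts)"
    unfolding encodes_def by blast
  have wf: "wf_temporal_graph G" and ne: "time_edges G \<noteq> {}" and \<Delta>: "1 \<le> \<Delta>1" "\<Delta>1 < \<Delta>2"
    using inst by (simp_all add: ETC_instance_def)
  let ?T = "lifetime G"
  have time: "1 \<le> t \<and> t \<le> ?T" if "(e, t) \<in> time_edges G" for e t
    using time_edges_wf(2)[OF wf] that by auto
  have triples: "i < j \<and> j < length vs \<and> 1 \<le> t \<and> t \<le> ?T" if "(i, j, t) \<in> set ts" for i j t
  proof -
    have "({vs ! i, vs ! j}, t) \<in> time_edges G"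
      unfolding S[symmetric] using that by (rule rev_image_eqI) simp
    then show ?thesis using lt that time by fastforce
  qed
  have T: "1 \<le> ?T" using ne time by (metis ex_in_conv order_trans prod.exhaust)
  interpret encoding vs ts k ?T \<Delta>1 \<Delta>2
    using vs(1) T triples by unfold_locales
  have S0: "S0 = time_edges G" unfolding S0_def triple_edge_def by (rule S)
  \<comment> \<open>Some time-edge exists, so there is a vertex and the claimed bound is
    positive.\<close>
  obtain i j t where ijt: "(i, j, t) \<in> set ts" using ne S by fastforce
  then have n: "0 < n" using triples by fastforce
  have "snd ` snd ` set ts = snd ` time_edges G" unfolding S[symmetric] by force
  moreover have "Max (snd ` time_edges G) = ?T" by (simp add: lifetime_def)
  moreover have "finite (snd ` time_edges G)" "snd ` time_edges G \<noteq> {}"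
    using time_edges_wf(1)[OF wf] ne by simp_all
  ultimately have latest: "latest (length ts) = ?T" by (simp add: latest_def)
  let ?M = "snd (initial_state w)"
  have M: "?M a = (if a < length w then w ! a else 0)" for a by (simp add: initial_state_def)
  have len: "length w = D" unfolding w D_def by (simp add: length_concat_triples)
  have cells: "(?M (5 + 3 * a), ?M (6 + 3 * a), ?M (7 + 3 * a)) = ts ! a" if "a < length ts" for a
  proof -
    let ?c = "concat (map (\<lambda>(i, j, t). [i, j, t]) ts)"
    have w5: "?M (5 + b) = ?c ! b" if "b < 3 * length ts" for b
    proof -
      have "5 + b < length w" using that len by (simp add: D_def)
      then show ?thesis unfolding M using w by (simp add: nth_append)
    qed
    have "?M (5 + 3 * a) = fst (ts ! a)" "?M (5 + (3 * a + 1)) = fst (snd (ts ! a))"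
      "?M (5 + (3 * a + 2)) = snd (snd (ts ! a))"
      using w5[of "3 * a"] w5[of "3 * a + 1"] w5[of "3 * a + 2"] nth_concat_triples[OF that] that by auto
    moreover have "5 + (3 * a + 1) = 6 + 3 * a" "5 + (3 * a + 2) = 7 + 3 * a" by simp_all
    ultimately show ?thesis by (metis prod.collapse)
  qed
  have input: "input_at ?M"
  proof -
    have "?M 0 = n" "?M 1 = length ts" "?M 2 = k" "?M 3 = \<Delta>1" "?M 4 = \<Delta>2"
      by (simp_all add: initial_state_def w)
    then show ?thesis unfolding input_at_def using cells by blast
  qed
  have zero: "?M a = 0" if "D \<le> a" for a using that len by (simp add: M)
  \<comment> \<open>The listed triples are distinct elements of a set of size
    \<open>n * n * ?T\<close>.\<close>
  have m: "length ts \<le> n * (n * ?T)"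
  proof -
    have "set ts \<subseteq> {..<n} \<times> {..<n} \<times> {1..?T}" using triples by fastforce
    then have "card (set ts) \<le> card ({..<n} \<times> {..<n} \<times> {1..?T})" by (intro card_mono) auto
    then show ?thesis using distinct_card[OF ts] by simp
  qed
  have "ends main_prog (initial_state w) (\<lambda>m (R', M'). m \<le> 467 * ((10 * ?T) ^ k * X) \<and>
    R' 0 = of_bool (fixable (verts G) ?T \<Delta>1 \<Delta>2 k (time_edges G)))"
  proof -
    have "ends main_prog ((\<lambda>_. 0), ?M) (\<lambda>m (R', M').
        m \<le> 7 * length ts + 6 * n + 30 + (5 * ?T) ^ k * (round_cost + 1) \<and>
        R' 0 = of_bool (fixable (verts G) ?T \<Delta>1 \<Delta>2 k (time_edges G)))"
      unfolding S0[symmetric] vs(2)[symmetric] by (rule main_prog[OF input _ n latest]) (rule zero)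
    moreover have "initial_state w = ((\<lambda>_. 0), ?M)" by (simp add: initial_state_def)
    ultimately show ?thesis
      by (simp only:) (erule ends_mono, use order_trans[OF _ total_cost[OF n m]] in blast)
  qed
  then have "ends main_prog (initial_state w) (\<lambda>m (R', M'). m \<le> 467 * ((10 * ?T) ^ k * ?T ^ 3 * card (verts G) ^ 5) \<and>
    R' 0 = (if ETC G k \<Delta>1 \<Delta>2 then 1 else 0))"
    unfolding ETC_iff_fixable[OF wf \<Delta>] distinct_card[OF vs(1), unfolded vs(2)]
    by (elim ends_mono) (auto simp: mult.assoc)
  then show "decides_within main_prog w (ETC G k \<Delta>1 \<Delta>2)
      (467 * ((10 * ?T) ^ k * ?T ^ 3 * card (verts G) ^ 5))"
    unfolding decides_within_def ends_def by fastforce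
qed

end
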